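(* Assume that conditions $(D_1)$ and $(D_2)$ described in the context hold, and let $\gamma\in\Gamma$. Let $\widehat S_\gamma$ be the weighted least squares estimate and $S^*_\gamma$ the shrinkage weighted least squares estimate with the same weight vector $\gamma$. Put $\Delta_Q(S)=\mathcal R_Q(S^*_\gamma,S)-\mathcal R_Q(\widehat S_\gamma,S)$. Then for any $n\ge n_0$ $$\sup_{Q\in\mathcal Q_n}\ \sup_{\|S\|\le r^*_n}\Delta_Q(S)<-\mathbf c_n^2 .$$
   Context: Model. One observes $(y_t)_{0\le t\le n}$ with $dy_t=S(t)\,dt+d\xi_t$, $0\le t\le n$, where $S$ is an unknown $1$-periodic function $\mathbb R\to\mathbb R$, $S\in L_2[0,1]$, and $(\xi_t)$ is an unobservable conditionally Gaussian semimartingale with paths in the Skorokhod space $D[0,n]$ and distribution $Q$ belonging to a family $\mathcal Q_n$. For every $Q\in\mathcal Q_n$ and every cadlag $f\in L_2[0,n]$ the stochastic integral $I_n(f)=\int_0^n f(s)\,d\xi_s$ is well defined and $E_Q I_n(f)=0$, $E_Q I_n^2(f)\le \varkappa_Q\int_0^n f^2(s)\,ds$, where $\varkappa_Q>0$ is a constant depending on $Q$. $E_{Q,S}$ is the expectation under the law of $y$ for given $Q$ and $S$; $\|f\|^2=\int_0^1 f^2(t)\,dt$; the risk is $\mathcal R_Q(\widehat S,S)=E_{Q,S}\|\widehat S-S\|^2$. Estimates. $(\phi_j)_{j\ge1}$ is an orthonormal basis of $L_2[0,1]$, extended $1$-periodically to $\mathbb R$. $\theta_j=\int_0^1 S\phi_j\,dt$,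 $\widehat\theta_{j,n}=\frac1n\int_0^n\phi_j(t)\,dy_t=\theta_j+n^{-1/2}\xi_{j,n}$ with $\xi_{j,n}=n^{-1/2}I_n(\phi_j)$. $\Gamma\subset[0,1]^n$ is a finite set of weight vectors $\gamma=(\gamma(j))_{1\le j\le n}$, and $\widehat S_\gamma=\sum_{j=1}^n\gamma(j)\widehat\theta_{j,n}\phi_j$. $(D_1)$: for every $\gamma\in\Gamma$ there is a fixed integer $d=d(\gamma)$ such that $\gamma(j)=1$ for $1\le j\le d$. $(D_2)$: there exists $n_0\ge1$ such that for any $n\ge n_0$ there is a $\sigma$-field $\mathcal G_n$ for which the vector $(\xi_{j,n})_{1\le j\le d}$ is $\mathcal G_n$-conditionally Gaussian in $\mathbb R^d$ with covariance matrix $\mathbf G_n=(E(\xi_{i,n}\xi_{j,n}\mid\mathcal G_n))_{1\le i,j\le d}$, and for some nonrandom constant $l^*_n>0$, $\inf_{Q\in\mathcal Q_n}(\operatorname{tr}\mathbf G_n-\lambda_{\max}(\mathbf G_n))\ge l^*_n$ a.s., where $\lambda_{\max}$ denotes the maximal eigenvalue. Shrinkage. $|x|_d^2=\sum_{j=1}^d x_j^2$, $\widetilde\theta_n=(\widehat\theta_{j,n})_{1\le j\le d}$, $\theta^*_{j,n}=(1-g(j))\widehat\theta_{j,n}$ with $g(j)=\dfrac{\mathbf c_n}{|\widetilde\theta_n|_d}\mathbf 1_{\{1\le j\le d\}}$, $$\mathbf c_n=\frac{l^*_n}{\left(r^*_n+\sqrt{d\varkappa_*/n}\right)n},\qquad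 \varkappa_*=\sup_{Q\in\mathcal Q_n}\varkappa_Q<\infty,$$ and $r^*_n>0$ is such that $r_n^*\to\infty$ and $r^*_n/n^{\check\delta}\to0$ as $n\to\infty$ for any $\check\delta>0$. Finally $S^*_\gamma=\sum_{j=1}^n\gamma(j)\theta^*_{j,n}\phi_j$. *)

theory Defs
  imports "HOL-Probability.Probability" "Jordan_Normal_Form.Char_Poly"
begin

section \<open>Functions on the time axis\<close>

definition cadlag_on :: "real set \<Rightarrow> (real \<Rightarrow> real) \<Rightarrow> bool" where
  "cadlag_on A f \<longleftrightarrow> (\<forall>t\<in>A. (f \<longlongrightarrow> f t) (at t within A \<inter> {t<..}) \<and>
                            (\<exists>l. (f \<longlongrightarrow> l) (at t within A \<inter> {..<t})))"

definition L2_fun :: "real \<Rightarrow> real \<Rightarrow> (real \<Rightarrow> real) \<Rightarrow> bool" where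
  "L2_fun a b f \<longleftrightarrow> set_borel_measurable lborel {a..b} f \<and>
                     set_integrable lborel {a..b} (\<lambda>t. (f t)\<^sup>2)"

definition L2_inner :: "(real \<Rightarrow> real) \<Rightarrow> (real \<Rightarrow> real) \<Rightarrow> real" where
  "L2_inner f g = (LINT t:{0..1}|lborel. f t * g t)"

definition L2_norm :: "(real \<Rightarrow> real) \<Rightarrow> real" where
  "L2_norm f = sqrt (LINT t:{0..1}|lborel. (f t)\<^sup>2)"

definition periodic1 :: "(real \<Rightarrow> real) \<Rightarrow> bool" where
  "periodic1 f \<longleftrightarrow> (\<forall>t. f (t + 1) = f t)"

text \<open>The basis functions are cadlag because the noise integral below is only defined
  for cadlag integrands. Only the indices \<open>j \<ge> 1\<close> are used.\<close>

definition orthonormal_basis :: "(nat \<Rightarrow> real \<Rightarrow> real) \<Rightarrow> bool" where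
  "orthonormal_basis \<phi> \<longleftrightarrow>
     (\<forall>j\<ge>1. periodic1 (\<phi> j) \<and> cadlag_on UNIV (\<phi> j) \<and> L2_fun 0 1 (\<phi> j)) \<and>
     (\<forall>i\<ge>1. \<forall>j\<ge>1. L2_inner (\<phi> i) (\<phi> j) = (if i = j then 1 else 0)) \<and>
     (\<forall>f. L2_fun 0 1 f \<longrightarrow>
        (\<lambda>N. L2_norm (\<lambda>t. f t - (\<Sum>j=1..N. L2_inner f (\<phi> j) * \<phi> j t))) \<longlonglongrightarrow> 0)"

definition is_partition :: "real \<Rightarrow> nat \<Rightarrow> (nat \<Rightarrow> real) \<Rightarrow> bool" where
  "is_partition T N p \<longleftrightarrow> p 0 = 0 \<and> p N = T \<and> (\<forall>i<N. p i \<le> p (Suc i))"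


section \<open>Semimartingales on a bounded time interval\<close>

definition martingale_on ::
    "'w measure \<Rightarrow> (real \<Rightarrow> 'w measure) \<Rightarrow> real \<Rightarrow> (real \<Rightarrow> 'w \<Rightarrow> real) \<Rightarrow> bool" where
  "martingale_on M F T X \<longleftrightarrow>
     (\<forall>t\<in>{0..T}. X t \<in> borel_measurable (F t) \<and> integrable M (X t)) \<and>
     (\<forall>s\<in>{0..T}. \<forall>t\<in>{s..T}. AE \<omega> in M. real_cond_exp M (F s) (X t) \<omega> = X s \<omega>)"

text \<open>On the closed interval \<open>[0,T]\<close> a localizing sequence has to reach \<open>T\<close> after finitely
  many steps, almost surely.\<close>

definition local_martingale_on ::
    "'w measure \<Rightarrow> (real \<Rightarrow> 'w measure) \<Rightarrow> real \<Rightarrow> (real \<Rightarrow> 'w \<Rightarrow> real) \<Rightarrow> bool" where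
  "local_martingale_on M F T X \<longleftrightarrow>
     (\<exists>\<tau> :: nat \<Rightarrow> 'w \<Rightarrow> real.
        (\<forall>k. stopping_time F (\<tau> k) \<and> (\<forall>\<omega>\<in>space M. 0 \<le> \<tau> k \<omega>) \<and>
             martingale_on M F T (\<lambda>t \<omega>. X (min t (\<tau> k \<omega>)) \<omega>)) \<and>
        (AE \<omega> in M. incseq (\<lambda>k. \<tau> k \<omega>) \<and> (\<exists>k. T \<le> \<tau> k \<omega>)))"

definition finite_variation :: "real \<Rightarrow> (real \<Rightarrow> real) \<Rightarrow> bool" where
  "finite_variation T a \<longleftrightarrow>
     (\<exists>B. \<forall>N p. is_partition T N p \<longrightarrow> (\<Sum>i<N. \<bar>a (p (Suc i)) - a (p i)\<bar>) \<le> B)"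

definition semimartingale ::
    "'w measure \<Rightarrow> real \<Rightarrow> (real \<Rightarrow> 'w \<Rightarrow> real) \<Rightarrow> bool" where
  "semimartingale M T X \<longleftrightarrow>
     (\<exists>F N A. filtration (space M) F \<and> (\<forall>t. sets (F t) \<subseteq> sets M) \<and>
        local_martingale_on M F T N \<and>
        (\<forall>t\<in>{0..T}. A t \<in> borel_measurable (F t)) \<and>
        (\<forall>\<omega>\<in>space M. N 0 \<omega> = 0 \<and> cadlag_on {0..T} (\<lambda>t. N t \<omega>) \<and>
           cadlag_on {0..T} (\<lambda>t. A t \<omega>) \<and> finite_variation T (\<lambda>t. A t \<omega>)) \<and>
        (AE \<omega> in M. \<forall>t\<in>{0..T}. X t \<omega> = N t \<omega> + A t \<omega>))"

text \<open>The integral over \<open>[0,T]\<close> of a nonrandom cadlag function is the limit in probability of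
  the left-endpoint Riemann sums as the mesh tends to 0. For a semimartingale integrator this limit
  is the stochastic integral of the left-limit function \<open>f(s-)\<close>. It agrees almost surely with
  the integral of \<open>f\<close> for the processes below, which almost surely do not jump at a fixed time
  \<open>s > 0\<close>: their integrals are bounded in mean square by a multiple of the
  \<open>L\<^sub>2\<close> norm of the integrand.\<close>

definition is_stoch_integral ::
    "'w measure \<Rightarrow> real \<Rightarrow> (real \<Rightarrow> 'w \<Rightarrow> real) \<Rightarrow> (real \<Rightarrow> real) \<Rightarrow> ('w \<Rightarrow> real) \<Rightarrow> bool" where
  "is_stoch_integral M T X f I \<longleftrightarrow> I \<in> borel_measurable M \<and>
     (\<forall>\<epsilon>>0. \<exists>\<delta>>0. \<forall>N p. is_partition T N p \<and> (\<forall>i<N. p (Suc i) - p i < \<delta>) \<longrightarrow>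
        measure M {\<omega> \<in> space M.
          \<epsilon> < \<bar>(\<Sum>i<N. f (p i) * (X (p (Suc i)) \<omega> - X (p i) \<omega>)) - I \<omega>\<bar>} < \<epsilon>)"

definition stoch_integral ::
    "'w measure \<Rightarrow> real \<Rightarrow> (real \<Rightarrow> 'w \<Rightarrow> real) \<Rightarrow> (real \<Rightarrow> real) \<Rightarrow> 'w \<Rightarrow> real" where
  "stoch_integral M T X f = (SOME I. is_stoch_integral M T X f I)"


section \<open>Conditionally Gaussian vectors\<close>

text \<open>The law of \<open>m + A Z\<close> with \<open>Z\<close> standard normal in \<open>\<real>\<^sup>k\<close> and
  \<open>A A\<^sup>T = C\<close>; the covariance \<open>C\<close> may be singular.\<close>

definition gaussian_law ::
    "'i set \<Rightarrow> ('i \<Rightarrow> real) \<Rightarrow> ('i \<Rightarrow> 'i \<Rightarrow> real) \<Rightarrow> ('i \<Rightarrow> real) measure \<Rightarrow> bool" where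
  "gaussian_law J m C \<mu> \<longleftrightarrow>
     (\<exists>(k::nat) (A :: 'i \<Rightarrow> nat \<Rightarrow> real).
        (\<forall>i\<in>J. \<forall>j\<in>J. C i j = (\<Sum>l<k. A i l * A j l)) \<and>
        \<mu> = distr (\<Pi>\<^sub>M l\<in>{..<k}. std_normal_distribution) (\<Pi>\<^sub>M i\<in>J. borel)
               (\<lambda>z. \<lambda>i\<in>J. m i + (\<Sum>l<k. A i l * z l)))"

text \<open>A regular version \<open>\<kappa>\<close> of the conditional distribution of \<open>(X\<^sub>i)\<close>, \<open>i \<in> J\<close>,
  given \<open>G\<close> is almost surely Gaussian with mean \<open>m\<close> and covariance \<open>C\<close>.\<close>

definition cond_gaussian ::
    "'w measure \<Rightarrow> 'w measure \<Rightarrow> 'i set \<Rightarrow> ('i \<Rightarrow> 'w \<Rightarrow> real) \<Rightarrow>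
     ('w \<Rightarrow> 'i \<Rightarrow> real) \<Rightarrow> ('w \<Rightarrow> 'i \<Rightarrow> 'i \<Rightarrow> real) \<Rightarrow> bool" where
  "cond_gaussian M G J X m C \<longleftrightarrow>
     (\<exists>\<kappa> \<in> G \<rightarrow>\<^sub>M prob_algebra (\<Pi>\<^sub>M i\<in>J. borel).
        (\<forall>B \<in> sets (\<Pi>\<^sub>M i\<in>J. borel). AE \<omega> in M.
           real_cond_exp M G (\<lambda>\<omega>. indicator B (\<lambda>i\<in>J. X i \<omega>)) \<omega> = measure (\<kappa> \<omega>) B) \<and>
        (AE \<omega> in M. gaussian_law J (m \<omega>) (C \<omega>) (\<kappa> \<omega>)))"

text \<open>Finite-dimensional distributions given some sub-\<open>\<sigma>\<close>-field are Gaussian. By itself this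
  restricts nothing (take \<open>G = M\<close>); the quantitative requirement is \<open>cond_D2\<close>.\<close>

definition cond_gaussian_process :: "'w measure \<Rightarrow> real \<Rightarrow> (real \<Rightarrow> 'w \<Rightarrow> real) \<Rightarrow> bool" where
  "cond_gaussian_process M T X \<longleftrightarrow>
     (\<exists>G. subalgebra M G \<and>
        (\<forall>J. finite J \<and> J \<subseteq> {0..T} \<longrightarrow> (\<exists>m C. cond_gaussian M G J X m C)))"


section \<open>The observation model\<close>

text \<open>The Borel \<open>\<sigma>\<close>-field of the Skorokhod topology on \<open>D[0,T]\<close> is generated by the
  coordinate maps.\<close>

definition skorokhod_space :: "real \<Rightarrow> (real \<Rightarrow> real) measure" where
  "skorokhod_space T = restrict_space (\<Pi>\<^sub>M t\<in>{0..T}. borel) {x. cadlag_on {0..T} x}"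

text \<open>\<open>\<xi>\<close> is a noise on the probability space \<open>M\<close>, with distribution \<open>Q\<close> on
  \<open>D[0,n]\<close> and constant \<open>k = \<kappa>\<^sub>Q\<close>. The space \<open>M\<close> may be larger than the path
  space, as the \<open>\<sigma>\<close>-field in \<open>cond_D2\<close> need not be generated by \<open>\<xi>\<close>.\<close>

definition noise_model ::
    "nat \<Rightarrow> (real \<Rightarrow> real) measure \<Rightarrow> 'w measure \<Rightarrow> (real \<Rightarrow> 'w \<Rightarrow> real) \<Rightarrow> real \<Rightarrow> bool" where
  "noise_model n Q M \<xi> k \<longleftrightarrow>
     prob_space M \<and>
     (\<lambda>\<omega>. \<lambda>t\<in>{0..real n}. \<xi> t \<omega>) \<in> M \<rightarrow>\<^sub>M skorokhod_space (real n) \<and>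
     Q = distr M (skorokhod_space (real n)) (\<lambda>\<omega>. \<lambda>t\<in>{0..real n}. \<xi> t \<omega>) \<and>
     semimartingale M (real n) \<xi> \<and>
     cond_gaussian_process M (real n) \<xi> \<and>
     0 < k \<and>
     (\<forall>f. cadlag_on {0..real n} f \<and> L2_fun 0 (real n) f \<longrightarrow>
        (\<exists>I. is_stoch_integral M (real n) \<xi> f I) \<and>
        integrable M (stoch_integral M (real n) \<xi> f) \<and>
        integrable M (\<lambda>\<omega>. (stoch_integral M (real n) \<xi> f \<omega>)\<^sup>2) \<and>
        (LINT \<omega>|M. stoch_integral M (real n) \<xi> f \<omega>) = 0 \<and>
        (LINT \<omega>|M. (stoch_integral M (real n) \<xi> f \<omega>)\<^sup>2)
          \<le> k * (LINT s:{0..real n}|lborel. (f s)\<^sup>2))"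

text \<open>The process with \<open>dy\<^sub>t = S(t) dt + d\<xi>\<^sub>t\<close>. The initial value is immaterial, since only
  increments of \<open>y\<close> enter the estimates.\<close>

definition observation :: "(real \<Rightarrow> real) \<Rightarrow> (real \<Rightarrow> 'w \<Rightarrow> real) \<Rightarrow> real \<Rightarrow> 'w \<Rightarrow> real" where
  "observation S \<xi> t \<omega> = (LINT s:{0..t}|lborel. S s) + \<xi> t \<omega>"

definition signals :: "(real \<Rightarrow> real) set" where
  "signals = {S. periodic1 S \<and> S \<in> borel_measurable borel \<and> L2_fun 0 1 S}"

definition xi_coef ::
    "nat \<Rightarrow> 'w measure \<Rightarrow> (nat \<Rightarrow> real \<Rightarrow> real) \<Rightarrow> (real \<Rightarrow> 'w \<Rightarrow> real) \<Rightarrow> nat \<Rightarrow> 'w \<Rightarrow> real" where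
  "xi_coef n M \<phi> \<xi> j \<omega> = stoch_integral M (real n) \<xi> (\<phi> j) \<omega> / sqrt (real n)"


section \<open>Estimates\<close>

definition theta_hat ::
    "nat \<Rightarrow> 'w measure \<Rightarrow> (nat \<Rightarrow> real \<Rightarrow> real) \<Rightarrow> (real \<Rightarrow> 'w \<Rightarrow> real) \<Rightarrow> nat \<Rightarrow> 'w \<Rightarrow> real" where
  "theta_hat n M \<phi> y j \<omega> = stoch_integral M (real n) y (\<phi> j) \<omega> / real n"

definition weighted_series ::
    "nat \<Rightarrow> (nat \<Rightarrow> real) \<Rightarrow> (nat \<Rightarrow> real \<Rightarrow> real) \<Rightarrow> (nat \<Rightarrow> real) \<Rightarrow> real \<Rightarrow> real" where
  "weighted_series n \<gamma> \<phi> \<theta> t = (\<Sum>j=1..n. \<gamma> j * \<theta> j * \<phi> j t)"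

definition eucl_norm :: "nat \<Rightarrow> (nat \<Rightarrow> real) \<Rightarrow> real" where
  "eucl_norm d x = sqrt (\<Sum>j=1..d. (x j)\<^sup>2)"

definition shrink_factor :: "real \<Rightarrow> nat \<Rightarrow> (nat \<Rightarrow> real) \<Rightarrow> nat \<Rightarrow> real" where
  "shrink_factor c d \<theta> j = (if 1 \<le> j \<and> j \<le> d then c / eucl_norm d \<theta> else 0)"

definition shrink :: "real \<Rightarrow> nat \<Rightarrow> (nat \<Rightarrow> real) \<Rightarrow> nat \<Rightarrow> real" where
  "shrink c d \<theta> j = (1 - shrink_factor c d \<theta> j) * \<theta> j"

definition S_hat ::
    "nat \<Rightarrow> 'w measure \<Rightarrow> (nat \<Rightarrow> real \<Rightarrow> real) \<Rightarrow> (nat \<Rightarrow> real) \<Rightarrow> (real \<Rightarrow> 'w \<Rightarrow> real) \<Rightarrow>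
     'w \<Rightarrow> real \<Rightarrow> real" where
  "S_hat n M \<phi> \<gamma> y \<omega> = weighted_series n \<gamma> \<phi> (\<lambda>j. theta_hat n M \<phi> y j \<omega>)"

definition S_star ::
    "nat \<Rightarrow> 'w measure \<Rightarrow> (nat \<Rightarrow> real \<Rightarrow> real) \<Rightarrow> (nat \<Rightarrow> real) \<Rightarrow> real \<Rightarrow> nat \<Rightarrow>
     (real \<Rightarrow> 'w \<Rightarrow> real) \<Rightarrow> 'w \<Rightarrow> real \<Rightarrow> real" where
  "S_star n M \<phi> \<gamma> c d y \<omega> = weighted_series n \<gamma> \<phi> (shrink c d (\<lambda>j. theta_hat n M \<phi> y j \<omega>))"

definition risk :: "'w measure \<Rightarrow> ('w \<Rightarrow> real \<Rightarrow> real) \<Rightarrow> (real \<Rightarrow> real) \<Rightarrow> real" where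
  "risk M est S = (LINT \<omega>|M. (L2_norm (\<lambda>t. est \<omega> t - S t))\<^sup>2)"

definition risk_difference ::
    "nat \<Rightarrow> 'w measure \<Rightarrow> (real \<Rightarrow> 'w \<Rightarrow> real) \<Rightarrow> (nat \<Rightarrow> real \<Rightarrow> real) \<Rightarrow> (nat \<Rightarrow> real) \<Rightarrow>
     real \<Rightarrow> nat \<Rightarrow> (real \<Rightarrow> real) \<Rightarrow> real" where
  "risk_difference n M \<xi> \<phi> \<gamma> c d S =
     risk M (S_star n M \<phi> \<gamma> c d (observation S \<xi>)) S -
     risk M (S_hat n M \<phi> \<gamma> (observation S \<xi>)) S"

definition shrink_const :: "nat \<Rightarrow> nat \<Rightarrow> real \<Rightarrow> real \<Rightarrow> real \<Rightarrow> real" where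
  "shrink_const n d l r k = l / ((r + sqrt (real d * k / real n)) * real n)"

definition radius_sequence :: "(nat \<Rightarrow> real) \<Rightarrow> bool" where
  "radius_sequence r \<longleftrightarrow> (\<forall>n\<ge>1. 0 < r n) \<and> filterlim r at_top sequentially \<and>
     (\<forall>\<delta>>0. (\<lambda>n. r n / real n powr \<delta>) \<longlonglongrightarrow> 0)"


section \<open>Weights, and the two conditions\<close>

text \<open>\<open>\<Gamma> n\<close> is a finite subset of \<open>[0,1]\<^sup>n\<close>; vectors are functions on \<open>{1..n}\<close>.\<close>

definition weight_family :: "(nat \<Rightarrow> (nat \<Rightarrow> real) set) \<Rightarrow> bool" where
  "weight_family \<Gamma> \<longleftrightarrow> (\<forall>n\<ge>1. finite (\<Gamma> n) \<and> \<Gamma> n \<subseteq> (\<Pi>\<^sub>E j\<in>{1..n}. {0..1}))"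

definition cond_D1 :: "(nat \<Rightarrow> (nat \<Rightarrow> real) set) \<Rightarrow> (nat \<Rightarrow> (nat \<Rightarrow> real) \<Rightarrow> nat) \<Rightarrow> bool" where
  "cond_D1 \<Gamma> dfun \<longleftrightarrow> (\<forall>n\<ge>1. \<forall>\<gamma>\<in>\<Gamma> n.
     1 \<le> dfun n \<gamma> \<and> dfun n \<gamma> \<le> n \<and> (\<forall>j\<in>{1..dfun n \<gamma>}. \<gamma> j = 1))"

definition cond_cov ::
    "'w measure \<Rightarrow> 'w measure \<Rightarrow> (nat \<Rightarrow> 'w \<Rightarrow> real) \<Rightarrow> 'w \<Rightarrow> nat \<Rightarrow> nat \<Rightarrow> real" where
  "cond_cov M G X \<omega> i j = real_cond_exp M G (\<lambda>\<omega>. X i \<omega> * X j \<omega>) \<omega>"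

text \<open>Matrix rows and columns of the library are indexed from 0.\<close>

definition lambda_max :: "nat \<Rightarrow> (nat \<Rightarrow> nat \<Rightarrow> real) \<Rightarrow> real" where
  "lambda_max d C = Max {x. eigenvalue (Matrix.mat d d (\<lambda>(i, j). C (Suc i) (Suc j))) x}"

text \<open>The conditional mean is 0, since \<open>E(X\<^sub>i X\<^sub>j | G)\<close> is the conditional covariance.\<close>

definition cond_D2 ::
    "(nat \<Rightarrow> (real \<Rightarrow> real) measure set) \<Rightarrow> (nat \<Rightarrow> (real \<Rightarrow> real) measure \<Rightarrow> 'w measure) \<Rightarrow>
     (nat \<Rightarrow> (real \<Rightarrow> real) measure \<Rightarrow> real \<Rightarrow> 'w \<Rightarrow> real) \<Rightarrow> (nat \<Rightarrow> real \<Rightarrow> real) \<Rightarrow>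
     nat \<Rightarrow> (nat \<Rightarrow> real) \<Rightarrow> nat \<Rightarrow> bool" where
  "cond_D2 QQ M \<xi> \<phi> d l n0 \<longleftrightarrow> 1 \<le> n0 \<and>
     (\<forall>n\<ge>n0. 0 < l n \<and> (\<forall>Q\<in>QQ n. \<exists>G. subalgebra (M n Q) G \<and>
        (let X = xi_coef n (M n Q) \<phi> (\<xi> n Q); C = cond_cov (M n Q) G X in
           cond_gaussian (M n Q) G {1..d} X (\<lambda>\<omega> i. 0) C \<and>
           (AE \<omega> in M n Q. l n \<le> (\<Sum>i=1..d. C \<omega> i i) - lambda_max d (C \<omega>)))))"

end

theory Submission
  imports Defs
begin

text \<open>Both estimates have the same coefficients beyond index \<open>d\<close>, and the weights are 1 up to
  index \<open>d\<close>, so by orthonormality the comparison of the risks takes place in \<open>\<real>\<^sup>d\<close>. There the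
  least squares coefficients form a vector \<open>u = \<theta> + X / sqrt n\<close>, where \<open>X\<close> is conditionally
  Gaussian, and shrinking subtracts \<open>c u / |u|\<close>. Expanding the square gives
  \<open>\<Delta> \<le> c\<^sup>2 - 2 c E (\<langle>u - \<theta>, u\<rangle> / |u|)\<close>, see \<open>risk_difference_bound\<close>.

  The correlation \<open>E (\<langle>u - \<theta>, u\<rangle> / |u|)\<close> is bounded from below by Gaussian integration by parts,
  as for the James-Stein estimate. Given the conditioning \<open>\<sigma>\<close>-field, with conditional covariance
  \<open>C\<close>, it equals \<open>(1/n) E (tr C / |u| - \<langle>u, C u\<rangle> / |u|\<^sup>3)\<close>, which is at least
  \<open>(1/n) E ((tr C - \<lambda>\<^sub>m\<^sub>a\<^sub>x C) / |u|) \<ge> (l/n) E (1 / |u|)\<close>. As \<open>1/|u|\<close> is singular, the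
  identity is proved for \<open>sqrt (|u|\<^sup>2 + e)\<close> in place of \<open>|u|\<close>, and \<open>e\<close> tends to 0 by
  dominated convergence (\<open>stein_correlation_bound\<close>). The expectation of \<open>1/|u|\<close> is bounded by the
  tangent inequality \<open>1/t \<ge> (3 m\<^sup>2 - t\<^sup>2) / (2 m\<^sup>3)\<close>, in which only the second moment
  \<open>E |u|\<^sup>2 \<le> m\<^sup>2\<close> with \<open>m\<^sup>2 = r\<^sup>2 + d \<kappa>\<^sub>* / n\<close> enters; the result is \<open>1/m\<close>.

  Hence \<open>\<Delta> \<le> c\<^sup>2 - 2 c l / (n m)\<close>, with a right-hand side that depends neither on the noise
  distribution nor on the signal. Since \<open>m = sqrt (r\<^sup>2 + d \<kappa>\<^sub>* / n)\<close> is strictly smaller than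
  \<open>r + sqrt (d \<kappa>\<^sub>* / n)\<close>, the number \<open>l / (n m)\<close> strictly exceeds \<open>c\<close>, so the supremum stays
  strictly below \<open>-c\<^sup>2\<close>.

  Two facts connect this computation to the model. The integral of a cadlag function against the
  observation splits almost surely into the drift integral and the noise integral
  (\<open>theta_hat_decomposition\<close>), which rests on convergence of left-endpoint Riemann sums and on
  uniqueness of limits in probability. And \<open>\<lambda>\<^sub>m\<^sub>a\<^sub>x\<close>, the maximum of the eigenvalues, dominates the
  quadratic form of a symmetric matrix (\<open>quad_form_le_lambda_max\<close>).\<close>

section \<open>Gaussian integration by parts\<close>

text \<open>Stein's identity on the line: the product of \<open>g\<close> with the normal density \<open>p\<close> has derivative
  \<open>p (g' - t g)\<close> and vanishes at both ends.\<close>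

lemma std_normal_stein:
  fixes g g' :: "real \<Rightarrow> real"
  assumes deriv: "\<And>t. (g has_real_derivative g' t) (at t)"
    and cont: "continuous_on UNIV g'"
    and bnd: "\<And>t. \<bar>g t\<bar> \<le> B" "\<And>t. \<bar>g' t\<bar> \<le> B"
  shows "(\<integral>t. t * g t \<partial>std_normal_distribution) = (\<integral>t. g' t \<partial>std_normal_distribution)"
proof -
  have contg: "continuous_on UNIV g"
    using deriv by (meson DERIV_isCont continuous_at_imp_continuous_on)
  have [measurable]: "g \<in> borel_measurable borel" "g' \<in> borel_measurable borel"
    using cont contg by (auto intro: borel_measurable_continuous_onI)
  have int1: "integrable lborel (\<lambda>t. std_normal_density t * (t * g t))"
  proof (rule Bochner_Integration.integrable_bound)
    show "integrable lborel (\<lambda>t. B * (std_normal_density t * \<bar>t\<bar>^1))"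
      by (intro integrable_mult_right integrable_std_normal_moment_abs)
    show "AE t in lborel. norm (std_normal_density t * (t * g t)) \<le> norm (B * (std_normal_density t * \<bar>t\<bar>^1))"
    proof (rule AE_I2)
      fix t
      have "std_normal_density t * \<bar>t\<bar> * \<bar>g t\<bar> \<le> std_normal_density t * \<bar>t\<bar> * B"
        by (intro mult_left_mono bnd) auto
      moreover have "0 \<le> B" using bnd(1)[of 0] by simp
      ultimately show "norm (std_normal_density t * (t * g t)) \<le> norm (B * (std_normal_density t * \<bar>t\<bar>^1))"
        by (simp add: abs_mult mult_ac)
    qed
  qed simp
  have int2: "integrable lborel (\<lambda>t. std_normal_density t * g' t)"
  proof (rule Bochner_Integration.integrable_bound)
    show "integrable lborel (\<lambda>t. B * (std_normal_density t * t^0))"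
      by (intro integrable_mult_right integrable_std_normal_moment)
    show "AE t in lborel. norm (std_normal_density t * g' t) \<le> norm (B * (std_normal_density t * t^0))"
    proof (rule AE_I2)
      fix t
      have "std_normal_density t * \<bar>g' t\<bar> \<le> std_normal_density t * B"
        by (intro mult_left_mono bnd) auto
      moreover have "0 \<le> B" using bnd(1)[of 0] by simp
      ultimately show "norm (std_normal_density t * g' t) \<le> norm (B * (std_normal_density t * t^0))"
        by (simp add: abs_mult mult_ac)
    qed
  qed simp
  define F where "F t = std_normal_density t * g t" for t
  define F' where "F' t = std_normal_density t * g' t - std_normal_density t * (t * g t)" for t
  have dF: "(F has_real_derivative F' t) (at t)" for t
    unfolding F_def F'_def std_normal_density_def
    by (rule derivative_eq_intros deriv refl | simp)+ (simp add: field_simps)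
  have dens0: "((\<lambda>t. std_normal_density t) \<longlongrightarrow> 0) at_top" "((\<lambda>t. std_normal_density t) \<longlongrightarrow> 0) at_bot"
    unfolding std_normal_density_def by real_asymp+
  have lim: "(F \<longlongrightarrow> 0) Fl" if "((\<lambda>t. std_normal_density t) \<longlongrightarrow> 0) Fl" for Fl
  proof (rule Lim_null_comparison)
    show "\<forall>\<^sub>F t in Fl. norm (F t) \<le> B * std_normal_density t"
      using bnd(1) by (intro always_eventually) (auto simp: F_def abs_mult mult.commute intro!: mult_right_mono)
    show "((\<lambda>t. B * std_normal_density t) \<longlongrightarrow> 0) Fl"
      using tendsto_mult_left[OF that, of B] by simp
  qed
  have "(LBINT t=-\<infinity>..\<infinity>. F' t) = 0 - 0"
  proof (rule interval_integral_FTC_integrable)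
    show "(F has_vector_derivative F' x) (at x)" for x
      using dF by (simp add: has_real_derivative_iff_has_vector_derivative)
    show "isCont F' x" for x
    proof -
      have "isCont g x" "isCont g' x"
        using contg cont by (auto simp: continuous_on_eq_continuous_at)
      then show ?thesis unfolding F'_def std_normal_density_def
        by (intro continuous_intros) auto
    qed
    show "set_integrable lborel (einterval (-\<infinity>) \<infinity>) F'"
      using Bochner_Integration.integrable_diff[OF int2 int1]
      by (simp add: set_integrable_def F'_def)
    show "((F \<circ> real_of_ereal) \<longlongrightarrow> 0) (at_right (-\<infinity>))" 
      by (simp add: ereal_tendsto_simps lim dens0)
    show "((F \<circ> real_of_ereal) \<longlongrightarrow> 0) (at_left \<infinity>)" 
      by (simp add: ereal_tendsto_simps lim dens0)
  qed simp
  then have "(\<integral>t. F' t \<partial>lborel) = 0"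
    by (simp add: interval_lebesgue_integral_def set_lebesgue_integral_def)
  then have "(\<integral>t. std_normal_density t * (t * g t) \<partial>lborel) = (\<integral>t. std_normal_density t * g' t \<partial>lborel)"
    unfolding F'_def using int1 int2 by simp
  then show ?thesis
    by (subst (1 2) integral_density) auto
qed

abbreviation std_normal_product :: "nat \<Rightarrow> (nat \<Rightarrow> real) measure" where
  "std_normal_product k \<equiv> \<Pi>\<^sub>M l\<in>{..<k}. std_normal_distribution"

lemma prob_space_std_normal: "prob_space std_normal_distribution"
  by (rule prob_space_normal_density) simp

lemma prob_space_std_normal_product: "prob_space (std_normal_product k)"
  by (intro prob_space_PiM prob_space_std_normal)

lemma measurable_std_normal_product_coord:
  "l < k \<Longrightarrow> (\<lambda>z. z l) \<in> borel_measurable (std_normal_product k)"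
  using measurable_component_singleton[of l "{..<k}" "\<lambda>_. std_normal_distribution"]
  by simp

lemma integrable_std_normal_product_coord:
  assumes "l < k" shows "integrable (std_normal_product k) (\<lambda>z. (z l)^m)"
proof -
  have "integrable std_normal_distribution (\<lambda>x. x^m)"
    using integrable_std_normal_moment[of m] by (subst integrable_density) auto
  then have "integrable (distr (std_normal_product k) std_normal_distribution (\<lambda>z. z l)) (\<lambda>x. x^m)"
    using assms by (subst distr_PiM_component) (auto intro: prob_space_std_normal)
  moreover have "(\<lambda>x. x ^ m) \<in> borel_measurable std_normal_distribution" by simp
  ultimately show ?thesis
    using measurable_std_normal_product_coord[OF assms] by (subst (asm) integrable_distr_eq) auto
qed

text \<open>Integration by parts in one coordinate of a standard normal vector, the others being held
  fixed by Fubini's theorem.\<close>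

lemma std_normal_product_stein:
  fixes G G' :: "(nat \<Rightarrow> real) \<Rightarrow> real"
  assumes l: "l < k"
    and [measurable]: "G \<in> borel_measurable (std_normal_product k)"
      "G' \<in> borel_measurable (std_normal_product k)"
    and deriv: "\<And>z t. ((\<lambda>t. G (z(l := t))) has_real_derivative G' (z(l := t))) (at t)"
    and cont: "\<And>z. continuous_on UNIV (\<lambda>t. G' (z(l := t)))"
    and bnd: "\<And>z. \<bar>G z\<bar> \<le> B" "\<And>z. \<bar>G' z\<bar> \<le> B"
  shows "integrable (std_normal_product k) (\<lambda>z. z l * G z)"
    and "(\<integral>z. z l * G z \<partial>std_normal_product k) = (\<integral>z. G' z \<partial>std_normal_product k)"
proof -
  let ?Z = "std_normal_product k"
  interpret prob_space ?Z by (rule prob_space_std_normal_product)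
  interpret product_sigma_finite "\<lambda>_::nat. std_normal_distribution"
    by (intro product_sigma_finite.intro prob_space_imp_sigma_finite prob_space_std_normal)
  define I where "I = {..<k} - {l}"
  have ins: "{..<k} = insert l I" "finite I" "l \<notin> I" using l by (auto simp: I_def)
  have [measurable]: "(\<lambda>z. z l) \<in> borel_measurable ?Z"
    by (rule measurable_std_normal_product_coord[OF l])
  show i1: "integrable ?Z (\<lambda>z. z l * G z)"
  proof (rule Bochner_Integration.integrable_bound)
    show "integrable ?Z (\<lambda>z. B * (z l))"
      using integrable_std_normal_product_coord[OF l, of 1] by simp
    show "AE z in ?Z. norm (z l * G z) \<le> norm (B * z l)"
    proof (rule AE_I2)
      fix z
      have "\<bar>G z\<bar> \<le> \<bar>B\<bar>" using bnd(1)[of z] by simp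
      then show "norm (z l * G z) \<le> norm (B * z l)"
        unfolding real_norm_def abs_mult mult.commute[of "\<bar>z l\<bar>"] by (intro mult_right_mono) auto
    qed
  qed measurable
  have i2: "integrable ?Z G'"
    by (rule integrable_const_bound[of _ B]) (use bnd in auto)
  have "(\<integral>z. z l * G z \<partial>?Z) =
    (\<integral>z. (\<integral>t. (z(l:=t)) l * G (z(l := t)) \<partial>std_normal_distribution)
      \<partial>(\<Pi>\<^sub>M l\<in>I. std_normal_distribution))"
    using i1 ins(2,3) unfolding ins(1) by (subst product_integral_insert) simp_all
  also have "\<dots> = (\<integral>z. (\<integral>t. G' (z(l := t)) \<partial>std_normal_distribution)
      \<partial>(\<Pi>\<^sub>M l\<in>I. std_normal_distribution))"
  proof (rule Bochner_Integration.integral_cong[OF refl])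
    fix z :: "nat \<Rightarrow> real"
    show "(\<integral>t. (z(l:=t)) l * G (z(l := t)) \<partial>std_normal_distribution) =
        (\<integral>t. G' (z(l := t)) \<partial>std_normal_distribution)"
      using std_normal_stein[where B=B, OF deriv cont bnd] by simp
  qed
  also have "\<dots> = (\<integral>z. G' z \<partial>?Z)"
    using i2 ins(2,3) unfolding ins(1) by (subst product_integral_insert) simp_all
  finally show "(\<integral>z. z l * G z \<partial>?Z) = (\<integral>z. G' z \<partial>?Z)" .
qed

text \<open>Along the line \<open>v + t a\<close> the gradient of \<open>\<rho>\<close> contributes \<open>\<langle>a, u\<rangle> / \<rho>\<close>, hence the
  second term.\<close>

lemma smoothed_direction_deriv:
  fixes v a :: "'i \<Rightarrow> real" and J :: "'i set" and e :: real
  assumes e: "e > 0" 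
  defines "\<rho> \<equiv> \<lambda>t. sqrt ((\<Sum>j\<in>J. (v j + t * a j)\<^sup>2) + e)"
  shows "((\<lambda>t. (\<Sum>j\<in>J. a j * (v j + t * a j)) / \<rho> t) has_real_derivative
      (\<Sum>j\<in>J. (a j)\<^sup>2) / \<rho> t - (\<Sum>j\<in>J. a j * (v j + t * a j))\<^sup>2 / (\<rho> t)^3) (at t)"
proof -
  have pos: "(\<Sum>j\<in>J. (v j + t * a j)\<^sup>2) + e > 0" for t
    using e by (simp add: add_nonneg_pos sum_nonneg)
  have rpos: "\<rho> t > 0" for t using pos[of t] by (simp add: \<rho>_def)
  have d1: "((\<lambda>t. (\<Sum>j\<in>J. (v j + t * a j)\<^sup>2) + e) has_real_derivative
      2 * (\<Sum>j\<in>J. a j * (v j + t * a j))) (at t)"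
    by (auto intro!: derivative_eq_intros simp: sum_distrib_left mult_ac)
  have d2: "(\<rho> has_real_derivative (\<Sum>j\<in>J. a j * (v j + t * a j)) / \<rho> t) (at t)"
    unfolding \<rho>_def
    using DERIV_chain2[OF DERIV_real_sqrt[OF pos[of t]] d1]
    by (simp only: divide_inverse times_divide_eq_left times_divide_eq_right) (simp add: mult_ac)
  have d3: "((\<lambda>t. (\<Sum>j\<in>J. a j * (v j + t * a j))) has_real_derivative (\<Sum>j\<in>J. (a j)\<^sup>2)) (at t)"
    by (auto intro!: derivative_eq_intros simp: power2_eq_square)
  show ?thesis
    using rpos[of t]
    by (auto intro!: derivative_eq_intros d2 d3 simp: field_simps power2_eq_square power3_eq_cube)
qed

lemma abs_le_smoothed_norm:
  fixes u :: "'i \<Rightarrow> real"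
  assumes "finite J" "j \<in> J" "e > 0"
  shows "\<bar>u j\<bar> \<le> sqrt ((\<Sum>j\<in>J. (u j)\<^sup>2) + e)"
proof -
  have "(u j)\<^sup>2 \<le> (\<Sum>j\<in>J. (u j)\<^sup>2)" by (rule member_le_sum) (use assms in auto)
  then have "sqrt ((u j)\<^sup>2) \<le> sqrt ((\<Sum>j\<in>J. (u j)\<^sup>2) + e)" using assms by (intro real_sqrt_le_mono) simp
  then show ?thesis by simp
qed

lemma inner_le_smoothed_norm:
  fixes u a :: "'i \<Rightarrow> real"
  assumes "finite J" "e > 0"
  shows "\<bar>\<Sum>j\<in>J. a j * u j\<bar> \<le> (\<Sum>j\<in>J. \<bar>a j\<bar>) * sqrt ((\<Sum>j\<in>J. (u j)\<^sup>2) + e)"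
proof -
  have "\<bar>\<Sum>j\<in>J. a j * u j\<bar> \<le> (\<Sum>j\<in>J. \<bar>a j\<bar> * \<bar>u j\<bar>)"
    using sum_abs[of "\<lambda>j. a j * u j" J] by (simp add: abs_mult)
  also have "\<dots> \<le> (\<Sum>j\<in>J. \<bar>a j\<bar> * sqrt ((\<Sum>j\<in>J. (u j)\<^sup>2) + e))"
    by (intro sum_mono mult_left_mono abs_le_smoothed_norm assms) auto
  finally show ?thesis by (simp add: sum_distrib_right)
qed

text \<open>Write \<open>x - \<theta> = A z\<close>. Then \<open>\<langle>x - \<theta>, x\<rangle> / \<rho>\<close> is the sum over the coordinates \<open>z\<^sub>l\<close>
  of \<open>z\<^sub>l\<close> times \<open>\<langle>A\<^sub>l, x\<rangle> / \<rho>\<close>, with \<open>A\<^sub>l\<close> the \<open>l\<close>-th column, and the identity is applied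
  in each coordinate. With \<open>C = A A\<^sup>T\<close> the right-hand side is
  \<open>tr C / \<rho> - \<langle>x, C x\<rangle> / \<rho>\<^sup>3\<close>.\<close>

lemma gaussian_stein_identity:
  fixes \<theta> :: "'i \<Rightarrow> real" and A :: "'i \<Rightarrow> nat \<Rightarrow> real" and J :: "'i set" and e :: real and k :: nat
  assumes J: "finite J" and e: "e > 0"
  defines "x \<equiv> \<lambda>z j. \<theta> j + (\<Sum>l<k. A j l * z l)"
  defines "\<rho> \<equiv> \<lambda>z. sqrt ((\<Sum>j\<in>J. (x z j)\<^sup>2) + e)"
  shows "integrable (std_normal_product k) (\<lambda>z. (\<Sum>j\<in>J. (x z j - \<theta> j) * x z j) / \<rho> z)"
    "integrable (std_normal_product k) (\<lambda>z. (\<Sum>l<k. \<Sum>j\<in>J. (A j l)\<^sup>2) / \<rho> z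
        - (\<Sum>l<k. (\<Sum>j\<in>J. A j l * x z j)\<^sup>2) / (\<rho> z)^3)"
    "(\<integral>z. (\<Sum>j\<in>J. (x z j - \<theta> j) * x z j) / \<rho> z \<partial>std_normal_product k) =
      (\<integral>z. (\<Sum>l<k. \<Sum>j\<in>J. (A j l)\<^sup>2) / \<rho> z
        - (\<Sum>l<k. (\<Sum>j\<in>J. A j l * x z j)\<^sup>2) / (\<rho> z)^3 \<partial>std_normal_product k)"
proof -
  let ?Z = "std_normal_product k"
  interpret prob_space ?Z by (rule prob_space_std_normal_product)
  define G where "G l z = (\<Sum>j\<in>J. A j l * x z j) / \<rho> z" for l z
  define G' where "G' l z = (\<Sum>j\<in>J. (A j l)\<^sup>2) / \<rho> z - (\<Sum>j\<in>J. A j l * x z j)\<^sup>2 / (\<rho> z)^3" for l z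
  have [measurable]: "(\<lambda>z. z l) \<in> borel_measurable ?Z" if "l < k" for l
    by (rule measurable_std_normal_product_coord[OF that])
  have [measurable]: "(\<lambda>z. x z j) \<in> borel_measurable ?Z" for j unfolding x_def by measurable
  have [measurable]: "\<rho> \<in> borel_measurable ?Z" unfolding \<rho>_def by measurable
  have [measurable]: "G l \<in> borel_measurable ?Z" "G' l \<in> borel_measurable ?Z" for l 
    unfolding G_def G'_def by measurable
  \<comment> \<open>Moving \<open>z\<^sub>l\<close> moves \<open>x\<close> along the \<open>l\<close>-th column of \<open>A\<close>.\<close>
  have upd: "x (z(l:=t)) j = x (z(l:=0)) j + t * A j l" if "l < k" for z l t j
  proof -
    have "(\<Sum>m<k. A j m * (z(l:=t)) m) = (\<Sum>m<k. A j m * (z(l:=0)) m + (if m = l then t * A j l else 0))"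
      by (intro sum.cong) auto
    then show ?thesis using that by (simp add: x_def sum.distrib)
  qed
  have \<rho>e: "\<rho> z \<ge> sqrt e" for z unfolding \<rho>_def by (simp add: sum_nonneg)
  have \<rho>pos: "\<rho> z > 0" for z using \<rho>e[of z] e by (smt (verit) real_sqrt_gt_zero)
  define a where "a l = (\<Sum>j\<in>J. \<bar>A j l\<bar>)" for l
  define b where "b l = (\<Sum>j\<in>J. (A j l)\<^sup>2)" for l
  have in_le: "\<bar>\<Sum>j\<in>J. A j l * x z j\<bar> \<le> a l * \<rho> z" for l z
    unfolding a_def \<rho>_def by (rule inner_le_smoothed_norm[OF J e])
  have Gb: "\<bar>G l z\<bar> \<le> a l" for l z
    using in_le[of l z] \<rho>pos[of z] by (simp add: G_def field_simps)
  have b0: "b l \<ge> 0" for l by (simp add: b_def sum_nonneg)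
  have G'b: "\<bar>G' l z\<bar> \<le> (b l + (a l)\<^sup>2) / sqrt e" for l z
  proof -
    have "(\<Sum>j\<in>J. A j l * x z j)\<^sup>2 / (\<rho> z)^3 = (G l z)\<^sup>2 / \<rho> z"
      by (simp add: G_def field_simps power2_eq_square power3_eq_cube)
    moreover have "(G l z)\<^sup>2 \<le> (a l)\<^sup>2" using Gb[of l z] by (simp add: abs_le_square_iff[symmetric])
    ultimately have "\<bar>G' l z\<bar> \<le> (b l + (a l)\<^sup>2) / \<rho> z"
      using \<rho>pos[of z] b0[of l] unfolding G'_def b_def[symmetric]
      by (auto simp: abs_le_iff divide_right_mono add_divide_distrib[symmetric] diff_divide_distrib[symmetric])
    also have "\<dots> \<le> (b l + (a l)\<^sup>2) / sqrt e"
    proof (rule divide_left_mono[OF \<rho>e])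
      show "0 \<le> b l + (a l)\<^sup>2" using b0[of l] by simp
      show "0 < \<rho> z * sqrt e" using \<rho>pos[of z] e by simp
    qed
    finally show ?thesis .
  qed
  have stein: "integrable ?Z (\<lambda>z. z l * G l z) \<and> (\<integral>z. z l * G l z \<partial>?Z) = (\<integral>z. G' l z \<partial>?Z)" if l: "l < k" for l
  proof -
    let ?B = "max (a l) ((b l + (a l)\<^sup>2) / sqrt e)"
    have bb: "\<bar>G l z\<bar> \<le> ?B" "\<bar>G' l z\<bar> \<le> ?B" for z
      using Gb[of l z] G'b[of l z] by simp_all
    have d: "((\<lambda>t. G l (z(l := t))) has_real_derivative G' l (z(l := t))) (at t)" for z t
    proof -
      define v where "v = x (z(l := 0))"
      have u: "x (z(l := t)) j = v j + t * A j l" for t j unfolding v_def by (rule upd[OF l])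
      show ?thesis unfolding G_def G'_def \<rho>_def u by (rule smoothed_direction_deriv[OF e])
    qed
    have c: "continuous_on UNIV (\<lambda>t. G' l (z(l := t)))" for z
    proof -
      define v where "v = x (z(l := 0))"
      have u: "x (z(l := t)) j = v j + t * A j l" for t j unfolding v_def by (rule upd[OF l])
      have "(\<Sum>j\<in>J. (v j + t * A j l)\<^sup>2) + e \<noteq> 0" for t
        using e by (smt (verit) sum_nonneg zero_le_power2)
      then show ?thesis unfolding G'_def \<rho>_def u
        by (intro continuous_intros) auto
    qed
    show ?thesis
      using std_normal_product_stein[where G="G l" and G'="G' l" and B="?B", OF l _ _ d c bb] by simp
  qed
  have lhs: "(\<Sum>j\<in>J. (x z j - \<theta> j) * x z j) / \<rho> z = (\<Sum>l<k. z l * G l z)" for z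
  proof -
    have "(\<Sum>j\<in>J. (x z j - \<theta> j) * x z j) = (\<Sum>j\<in>J. \<Sum>l<k. z l * (A j l * x z j))"
      by (simp add: x_def sum_distrib_right sum_distrib_left mult_ac)
    also have "\<dots> = (\<Sum>l<k. z l * (\<Sum>j\<in>J. A j l * x z j))"
      by (subst sum.swap) (simp add: sum_distrib_left)
    finally show ?thesis
      by (simp only: G_def times_divide_eq_right) (rule sum_divide_distrib)
  qed
  have rhs: "(\<Sum>l<k. \<Sum>j\<in>J. (A j l)\<^sup>2) / \<rho> z - (\<Sum>l<k. (\<Sum>j\<in>J. A j l * x z j)\<^sup>2) / (\<rho> z)^3
      = (\<Sum>l<k. G' l z)" for z
    by (simp add: G'_def sum_subtractf sum_divide_distrib)
  have G'i: "integrable ?Z (G' l)" for l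
    by (rule integrable_const_bound) (use G'b in auto)
  show "integrable ?Z (\<lambda>z. (\<Sum>j\<in>J. (x z j - \<theta> j) * x z j) / \<rho> z)"
    unfolding lhs using stein by auto
  show "integrable ?Z (\<lambda>z. (\<Sum>l<k. \<Sum>j\<in>J. (A j l)\<^sup>2) / \<rho> z
        - (\<Sum>l<k. (\<Sum>j\<in>J. A j l * x z j)\<^sup>2) / (\<rho> z)^3)"
    unfolding rhs using G'i by auto
  show "(\<integral>z. (\<Sum>j\<in>J. (x z j - \<theta> j) * x z j) / \<rho> z \<partial>?Z) =
      (\<integral>z. (\<Sum>l<k. \<Sum>j\<in>J. (A j l)\<^sup>2) / \<rho> z
        - (\<Sum>l<k. (\<Sum>j\<in>J. A j l * x z j)\<^sup>2) / (\<rho> z)^3 \<partial>?Z)"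
    unfolding lhs rhs using stein G'i by (subst (1 2) Bochner_Integration.integral_sum) auto
qed

section \<open>The largest eigenvalue of a symmetric matrix\<close>

definition quad_form :: "nat \<Rightarrow> (nat \<Rightarrow> nat \<Rightarrow> real) \<Rightarrow> (nat \<Rightarrow> real) \<Rightarrow> (nat \<Rightarrow> real) \<Rightarrow> real" where
  "quad_form d C x y = (\<Sum>i=1..d. \<Sum>j=1..d. x i * C i j * y j)"

lemma quad_form_line:
  assumes sym: "\<And>i j. C i j = C j i"
  shows "quad_form d C (\<lambda>i. x i + t * y i) (\<lambda>i. x i + t * y i) =
    quad_form d C x x + 2 * t * quad_form d C y x + t\<^sup>2 * quad_form d C y y"
proof -
  have swap: "quad_form d C x y = quad_form d C y x"
    unfolding quad_form_def by (subst sum.swap) (simp add: sym mult_ac)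
  have "quad_form d C (\<lambda>i. x i + t * y i) (\<lambda>i. x i + t * y i) =
      (\<Sum>i=1..d. \<Sum>j=1..d. x i * C i j * x j + t * (x i * C i j * y j) + t * (y i * C i j * x j)
        + t\<^sup>2 * (y i * C i j * y j))"
    unfolding quad_form_def by (intro sum.cong refl) (simp add: algebra_simps power2_eq_square)
  also have "\<dots> = quad_form d C x x + t * quad_form d C x y + t * quad_form d C y x + t\<^sup>2 * quad_form d C y y"
    unfolding quad_form_def by (simp add: sum.distrib sum_distrib_left)
  finally show ?thesis by (simp add: swap)
qed

text \<open>A quadratic polynomial without constant term that is nowhere negative has no linear part:
  this is the first-order condition at a maximum of the Rayleigh quotient.\<close>

lemma linear_coeff_zero:
  fixes b c :: real
  assumes "\<And>t. 0 \<le> 2 * t * b + t\<^sup>2 * c"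
  shows "b = 0"
proof (rule ccontr)
  assume b: "b \<noteq> 0"
  define k where "k = \<bar>c\<bar> + 1"
  have k: "k > 0" "c < 2 * k" by (auto simp: k_def)
  \<comment> \<open>With \<open>t = - b / k\<close> the linear term outweighs the quadratic one as soon as \<open>c < 2 k\<close>.\<close>
  have "2 * (- b / k) * b + (- b / k)\<^sup>2 * c = (b\<^sup>2 / k\<^sup>2) * (c - 2 * k)"
    using k by (simp add: field_simps power2_eq_square)
  moreover have "(b\<^sup>2 / k\<^sup>2) * (c - 2 * k) < 0"
    using b k by (intro mult_pos_neg) auto
  ultimately show False using assms[of "- b / k"] by linarith
qed

text \<open>The quadratic form attains its maximum on the compact unit sphere; homogeneity extends the
  bound to all vectors.\<close>

lemma rayleigh_maximum:
  assumes d: "1 \<le> d"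
  shows "\<exists>x. (\<Sum>i=1..d. (x i)\<^sup>2) = 1 \<and>
    (\<forall>y. quad_form d C y y \<le> quad_form d C x x * (\<Sum>i=1..d. (y i)\<^sup>2))"
proof -
  \<comment> \<open>Coordinates outside \<open>{1..d}\<close> are pinned to 0, which makes the product compact by Tychonoff.\<close>
  define K where "K = (\<Pi>\<^sub>E i\<in>UNIV. if i \<in> {1..d} then {-1..1::real} else {0})"
  \<comment> \<open>The unit sphere is the intersection of \<open>K\<close> with the closed set \<open>U\<close>.\<close>
  define U where "U = {x :: nat \<Rightarrow> real. (\<Sum>i=1..d. (x i)\<^sup>2) = 1}"
  have coord: "continuous_on A (\<lambda>x::nat \<Rightarrow> real. x i)" for A i
    by (rule continuous_on_subset[OF continuous_on_product_coordinates subset_UNIV])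
  have "compactin (product_topology (\<lambda>i. euclidean) UNIV) K"
    unfolding K_def by (subst compactin_PiE) (auto simp: compactin_euclidean_iff)
  then have "compact K" by (simp add: euclidean_product_topology compactin_euclidean_iff)
  moreover have "closed U"
    unfolding U_def by (intro closed_Collect_eq continuous_intros coord)
  ultimately have cpt: "compact (K \<inter> U)" by (rule compact_Int_closed)
  have "(\<lambda>i. if i = 1 then 1 else 0) \<in> K"
    using d by (auto simp: K_def)
  moreover have "(\<lambda>i. if i = 1 then 1 else 0) \<in> U"
    unfolding U_def
  proof (rule CollectI)
    have "(\<Sum>i=1..d. (if i = 1 then 1 else 0 :: real)\<^sup>2) = (\<Sum>i=1..d. if i = 1 then 1 else 0)"
      by (intro sum.cong) auto
    also have "\<dots> = 1" using d by simp
    finally show "(\<Sum>i=1..d. (if i = 1 then 1 else 0 :: real)\<^sup>2) = 1" .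
  qed
  ultimately have "(\<lambda>i. if i = 1 then 1 else 0) \<in> K \<inter> U" by (rule IntI)
  then have ne: "K \<inter> U \<noteq> {}" by (intro notI) simp
  have cont: "continuous_on (K \<inter> U) (\<lambda>x. quad_form d C x x)"
    unfolding quad_form_def by (intro continuous_intros coord)
  from continuous_attains_sup[OF cpt ne cont] obtain x where
    x: "x \<in> K \<inter> U" "\<forall>y\<in>K \<inter> U. quad_form d C y y \<le> quad_form d C x x"
    by (rule bexE)
  have "quad_form d C y y \<le> quad_form d C x x * (\<Sum>i=1..d. (y i)\<^sup>2)" for y
  proof (cases "(\<Sum>i=1..d. (y i)\<^sup>2) = 0")
    case True
    then have "y i = 0" if "i \<in> {1..d}" for i using that by (simp add: sum_nonneg_eq_0_iff)
    then have "quad_form d C y y = 0" unfolding quad_form_def by (intro sum.neutral ballI) simp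
    then show ?thesis using True by simp
  next
    case False
    define r where "r = sqrt (\<Sum>i=1..d. (y i)\<^sup>2)"
    have r2: "r\<^sup>2 = (\<Sum>i=1..d. (y i)\<^sup>2)" by (simp add: r_def sum_nonneg)
    have r: "r > 0" using False by (simp add: r_def sum_nonneg order_less_le)
    define u where "u i = (if i \<in> {1..d} then y i / r else 0)" for i
    have u1: "(\<Sum>i=1..d. (u i)\<^sup>2) = 1"
    proof -
      have "(\<Sum>i=1..d. (u i)\<^sup>2) = (\<Sum>i=1..d. (y i)\<^sup>2 / r\<^sup>2)"
        by (intro sum.cong) (auto simp: u_def power_divide)
      also have "\<dots> = (\<Sum>i=1..d. (y i)\<^sup>2) / r\<^sup>2" by (rule sum_divide_distrib[symmetric])
      finally show ?thesis using r unfolding r2[symmetric] by simp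
    qed
    have ub: "\<bar>u i\<bar> \<le> 1" for i
    proof (cases "i \<in> {1..d}")
      case True
      then have "(u i)\<^sup>2 \<le> (\<Sum>i=1..d. (u i)\<^sup>2)" by (intro member_le_sum) auto
      then have "(u i)\<^sup>2 \<le> 1" unfolding u1 .
      then show ?thesis by (simp add: abs_square_le_1)
    next
      case False
      then have "u i = 0" unfolding u_def by (rule if_not_P)
      then show ?thesis by simp
    qed
    have "u \<in> K"
      unfolding K_def
    proof (intro PiE_I)
      fix i show "u i \<in> (if i \<in> {1..d} then {-1..1} else {0})"
      proof (cases "i \<in> {1..d}")
        case True
        have "u i \<in> {-1..1}" using abs_le_D1[OF ub[of i]] abs_le_D2[OF ub[of i]] by simp
        then show ?thesis unfolding if_P[OF True] .
      next
        case False
        then show ?thesis unfolding if_not_P[OF False] u_def by simp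
      qed
    qed simp
    moreover have "u \<in> U" unfolding U_def by (rule CollectI, rule u1)
    ultimately have "u \<in> K \<inter> U" by (rule IntI)
    then have le: "quad_form d C u u \<le> quad_form d C x x" using x(2) by blast
    have "quad_form d C u u = (\<Sum>i=1..d. \<Sum>j=1..d. y i * C i j * y j / r\<^sup>2)"
      unfolding quad_form_def by (intro sum.cong) (auto simp: u_def power2_eq_square)
    also have "\<dots> = quad_form d C y y / r\<^sup>2"
      unfolding quad_form_def by (simp only: sum_divide_distrib)
    finally show ?thesis using le r unfolding r2[symmetric] by (simp add: pos_divide_le_eq)
  qed
  moreover have "(\<Sum>i=1..d. (x i)\<^sup>2) = 1" using x(1) by (simp add: U_def)
  ultimately show ?thesis by (intro exI[of _ x] conjI allI)
qed

text \<open>At a maximiser \<open>x\<close> of the Rayleigh quotient the form \<open>s |y|\<^sup>2 - \<langle>y, C y\<rangle>\<close> is nonnegative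
  and vanishes at \<open>x\<close>. Varying \<open>x\<close> in the direction \<open>w = s x - C x\<close> shows \<open>w = 0\<close>, so the
  maximum \<open>s\<close> is an eigenvalue.\<close>

lemma quad_form_le_lambda_max:
  assumes d: "1 \<le> d" and sym: "\<And>i j. C i j = C j i"
  shows "quad_form d C y y \<le> lambda_max d C * (\<Sum>i=1..d. (y i)\<^sup>2)"
proof -
  from rayleigh_maximum[OF d, of C] obtain x where x: "(\<Sum>i=1..d. (x i)\<^sup>2) = 1 \<and>
    (\<forall>y. quad_form d C y y \<le> quad_form d C x x * (\<Sum>i=1..d. (y i)\<^sup>2))" ..
  note x = x[THEN conjunct1] x[THEN conjunct2, rule_format]
  define s where "s = quad_form d C x x"
  define w where "w i = s * x i - (\<Sum>j=1..d. C i j * x j)" for i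
  \<comment> \<open>Maximality of \<open>s\<close> at \<open>x + t w\<close>; the linear coefficient is \<open>2 |w|\<^sup>2\<close>.\<close>
  have "0 \<le> 2 * t * (\<Sum>i=1..d. (w i)\<^sup>2) + t\<^sup>2 * (s * (\<Sum>i=1..d. (w i)\<^sup>2) - quad_form d C w w)" for t
  proof -
    have "quad_form d C w x = (\<Sum>i=1..d. w i * (\<Sum>j=1..d. C i j * x j))"
      by (simp add: quad_form_def sum_distrib_left mult_ac)
    also have "\<dots> = (\<Sum>i=1..d. s * (x i * w i) - (w i)\<^sup>2)"
      by (intro sum.cong refl) (simp add: w_def algebra_simps power2_eq_square)
    finally have wx: "quad_form d C w x = s * (\<Sum>i=1..d. x i * w i) - (\<Sum>i=1..d. (w i)\<^sup>2)"
      by (simp add: sum_subtractf sum_distrib_left)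
    have "(\<Sum>i=1..d. (x i + t * w i)\<^sup>2) = (\<Sum>i=1..d. (x i)\<^sup>2 + 2 * t * (x i * w i) + t\<^sup>2 * (w i)\<^sup>2)"
      by (intro sum.cong refl) (simp add: algebra_simps power2_eq_square)
    also have "\<dots> = 1 + 2 * t * (\<Sum>i=1..d. x i * w i) + t\<^sup>2 * (\<Sum>i=1..d. (w i)\<^sup>2)"
      by (simp add: sum.distrib sum_distrib_left x(1) del: One_nat_def)
    finally have nrm: "(\<Sum>i=1..d. (x i + t * w i)\<^sup>2) = 1 + 2 * t * (\<Sum>i=1..d. x i * w i) + t\<^sup>2 * (\<Sum>i=1..d. (w i)\<^sup>2)" .
    have "quad_form d C (\<lambda>i. x i + t * w i) (\<lambda>i. x i + t * w i) \<le> s * (\<Sum>i=1..d. (x i + t * w i)\<^sup>2)"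
      unfolding s_def by (rule x(2))
    then show ?thesis
      unfolding quad_form_line[of C d x t w, OF sym] nrm wx by (simp add: s_def[symmetric] algebra_simps)
  qed
  then have "(\<Sum>i=1..d. (w i)\<^sup>2) = 0" by (rule linear_coeff_zero)
  then have w0: "(\<Sum>j=1..d. C i j * x j) = s * x i" if "i \<in> {1..d}" for i
    using that by (simp add: sum_nonneg_eq_0_iff w_def)
  define A where "A = Matrix.mat d d (\<lambda>(i, j). C (Suc i) (Suc j))"
  define v where "v = Matrix.vec d (\<lambda>i. x (Suc i))"
  have A: "A \<in> carrier_mat d d" by (simp add: A_def)
  have "A *\<^sub>v v = s \<cdot>\<^sub>v v"
  proof (rule eq_vecI)
    fix i assume "i < dim_vec (s \<cdot>\<^sub>v v)"
    then have i: "i < d" by (simp add: v_def)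
    have "vec_index (A *\<^sub>v v) i = (\<Sum>j\<in>{0..<d}. C (Suc i) (Suc j) * x (Suc j))"
      using i by (simp add: A_def v_def scalar_prod_def)
    also have "\<dots> = (\<Sum>j=1..d. C (Suc i) j * x j)"
      by (simp add: sum.atLeast1_atMost_eq lessThan_atLeast0)
    also have "\<dots> = vec_index (s \<cdot>\<^sub>v v) i" using i w0[of "Suc i"] by (simp add: v_def)
    finally show "vec_index (A *\<^sub>v v) i = vec_index (s \<cdot>\<^sub>v v) i" .
  qed (simp add: A_def v_def)
  moreover have "v \<noteq> 0\<^sub>v d"
  proof
    assume "v = 0\<^sub>v d"
    then have "vec_index v i = 0" if "i < d" for i using that by simp
    then have xi: "x (Suc i) = 0" if "i < d" for i using that by (simp add: v_def)
    have "x i = 0" if "i \<in> {1..d}" for i using xi[of "i - 1"] that by (cases i) auto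
    then have "(\<Sum>i=1..d. (x i)\<^sup>2) = 0" by simp
    then show False using x(1) by simp
  qed
  ultimately have ev: "eigenvalue A s"
    unfolding eigenvalue_def eigenvector_def using A by (intro exI[of _ v]) (auto simp: v_def)
  have "finite {z. eigenvalue A z}"
  proof -
    have "char_poly A \<noteq> 0" using degree_monic_char_poly[OF A] by auto
    then show ?thesis unfolding eigenvalue_root_char_poly[OF A] by (rule poly_roots_finite)
  qed
  then have "s \<le> lambda_max d C"
    unfolding lambda_max_def A_def[symmetric] using ev by (intro Max_ge) auto
  then have "s * (\<Sum>i=1..d. (y i)\<^sup>2) \<le> lambda_max d C * (\<Sum>i=1..d. (y i)\<^sup>2)"
    by (intro mult_right_mono sum_nonneg) auto
  then show ?thesis using x(2)[of y] unfolding s_def[symmetric] by linarith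
qed

section \<open>The smoothed correlation under a conditionally Gaussian law\<close>

lemma integrable_power2_add:
  fixes f g :: "'a \<Rightarrow> real"
  assumes [measurable]: "f \<in> borel_measurable M" "g \<in> borel_measurable M"
    and f: "integrable M (\<lambda>x. (f x)\<^sup>2)" and g: "integrable M (\<lambda>x. (g x)\<^sup>2)"
  shows "integrable M (\<lambda>x. (f x + g x)\<^sup>2)" "integrable M (\<lambda>x. f x * g x)"
proof -
  have bound: "integrable M (\<lambda>x. 2 * (f x)\<^sup>2 + 2 * (g x)\<^sup>2)" using f g by simp
  have b: "norm ((a + b)\<^sup>2) \<le> norm (2 * a\<^sup>2 + 2 * b\<^sup>2)" "norm (a * b) \<le> norm (2 * a\<^sup>2 + 2 * b\<^sup>2)" for a b :: real
  proof -
    have 1: "0 \<le> (a - b)\<^sup>2" "0 \<le> (a + b)\<^sup>2" "0 \<le> a\<^sup>2" "0 \<le> b\<^sup>2" by simp_all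
    have 2: "(a - b)\<^sup>2 = a\<^sup>2 - 2 * (a * b) + b\<^sup>2" "(a + b)\<^sup>2 = a\<^sup>2 + 2 * (a * b) + b\<^sup>2"
      by (simp_all add: power2_eq_square algebra_simps)
    show "norm ((a + b)\<^sup>2) \<le> norm (2 * a\<^sup>2 + 2 * b\<^sup>2)" unfolding real_norm_def using 1 2 by linarith
    show "norm (a * b) \<le> norm (2 * a\<^sup>2 + 2 * b\<^sup>2)" unfolding real_norm_def using 1 2 by linarith
  qed
  show "integrable M (\<lambda>x. (f x + g x)\<^sup>2)" 
    by (rule Bochner_Integration.integrable_bound[OF bound]) (use b in auto)
  show "integrable M (\<lambda>x. f x * g x)"
    by (rule Bochner_Integration.integrable_bound[OF bound]) (use b in auto)
qed

lemma integrable_power2_sum: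
  fixes f :: "'i \<Rightarrow> 'a \<Rightarrow> real"
  assumes "finite I" "\<And>i. i \<in> I \<Longrightarrow> f i \<in> borel_measurable M"
    and "\<And>i. i \<in> I \<Longrightarrow> integrable M (\<lambda>x. (f i x)\<^sup>2)"
  shows "integrable M (\<lambda>x. (\<Sum>i\<in>I. f i x)\<^sup>2)"
  using assms
proof (induction I rule: finite_induct)
  case (insert i I)
  then have "integrable M (\<lambda>x. (f i x + (\<Sum>i\<in>I. f i x))\<^sup>2)"
    by (intro integrable_power2_add borel_measurable_sum) auto
  then show ?case using insert by simp
qed simp

text \<open>As a function of \<open>t\<^sup>2\<close>, the reciprocal \<open>1/t\<close> is convex, and the left-hand side is its tangent
  at \<open>t = m\<close>.\<close>

lemma tangent_inverse_norm:
  fixes t m :: real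
  assumes "t > 0" "m > 0"
  shows "(3 * m\<^sup>2 - t\<^sup>2) / (2 * m^3) \<le> 1 / t"
proof -
  have "0 \<le> (m - t)\<^sup>2 * (2 * m + t)" using assms by simp
  also have "\<dots> = 2 * m^3 - (3 * m\<^sup>2 - t\<^sup>2) * t"
    by (simp add: power2_eq_square power3_eq_cube algebra_simps)
  finally show ?thesis using assms by (simp add: divide_le_eq le_divide_eq mult.commute)
qed

text \<open>The smoothed correlation minus \<open>a\<close> times the tangent minorant of \<open>1/\<rho>\<close>. Being a polynomial
  in \<open>u\<close> apart from the first term, it has a computable expectation even though \<open>1/\<rho>\<close> has not.\<close>

definition smoothed_gap :: "nat \<Rightarrow> (nat \<Rightarrow> real) \<Rightarrow> real \<Rightarrow> real \<Rightarrow> real \<Rightarrow> (nat \<Rightarrow> real) \<Rightarrow> real" where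
  "smoothed_gap d \<theta> e a m u = (\<Sum>j=1..d. (u j - \<theta> j) * u j) / sqrt ((\<Sum>j=1..d. (u j)\<^sup>2) + e)
     - a * ((3 * m\<^sup>2 - ((\<Sum>j=1..d. (u j)\<^sup>2) + e)) / (2 * m^3))"

lemma quad_form_factored:
  assumes "\<And>i j. i \<in> {1..d} \<Longrightarrow> j \<in> {1..d} \<Longrightarrow> C i j = (\<Sum>l<k. A i l * A j l)"
  shows "quad_form d C y y = (\<Sum>l<k. (\<Sum>j=1..d. A j l * y j)\<^sup>2)"
proof -
  have "quad_form d C y y = (\<Sum>i=1..d. \<Sum>j=1..d. \<Sum>l<k. (A i l * y i) * (A j l * y j))"
    unfolding quad_form_def
    by (intro sum.cong refl) (simp add: assms sum_distrib_left sum_distrib_right mult_ac)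
  also have "\<dots> = (\<Sum>i=1..d. \<Sum>l<k. \<Sum>j=1..d. (A i l * y i) * (A j l * y j))"
    by (intro sum.cong refl sum.swap)
  also have "\<dots> = (\<Sum>l<k. \<Sum>i=1..d. \<Sum>j=1..d. (A i l * y i) * (A j l * y j))"
    by (rule sum.swap)
  also have "\<dots> = (\<Sum>l<k. (\<Sum>j=1..d. A j l * y j)\<^sup>2)"
    by (simp add: power2_eq_square sum_product)
  finally show ?thesis .
qed

text \<open>Integration by parts turns the correlation into \<open>tr C / \<rho> - \<langle>u, C u\<rangle> / \<rho>\<^sup>3\<close>, which is
  pointwise at least \<open>(tr C - L) / \<rho>\<close> because \<open>\<langle>u, C u\<rangle> \<le> L |u|\<^sup>2 \<le> L \<rho>\<^sup>2\<close>.\<close>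

lemma gaussian_smoothed_gap_nonneg:
  fixes \<theta> :: "nat \<Rightarrow> real"
  assumes law: "gaussian_law {1..d} (\<lambda>i. 0) C \<mu>"
    and L: "\<And>y. quad_form d C y y \<le> L * (\<Sum>i=1..d. (y i)\<^sup>2)" and l: "l \<le> (\<Sum>i=1..d. C i i) - L"
    and pos: "1 \<le> d" "0 \<le> l" "0 < e" "0 < m"
  shows "integrable \<mu> (\<lambda>x. smoothed_gap d \<theta> e (s\<^sup>2 * l) m (\<lambda>j. \<theta> j + s * x j))" (is "integrable \<mu> ?w")
    and "0 \<le> (\<integral>x. smoothed_gap d \<theta> e (s\<^sup>2 * l) m (\<lambda>j. \<theta> j + s * x j) \<partial>\<mu>)"
proof -
  let ?J = "{1..d}"
  from law obtain k A where CA: "\<And>i j. i \<in> ?J \<Longrightarrow> j \<in> ?J \<Longrightarrow> C i j = (\<Sum>l<k. A i l * A j l)"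
    and \<mu>: "\<mu> = distr (std_normal_product k) (\<Pi>\<^sub>M i\<in>?J. borel) (\<lambda>z. \<lambda>i\<in>?J. 0 + (\<Sum>l<k. A i l * z l))"
    unfolding gaussian_law_def by blast
  have qff: "quad_form d C y y = (\<Sum>l<k. (\<Sum>j\<in>?J. A j l * y j)\<^sup>2)" for y
    by (rule quad_form_factored) (rule CA)
  let ?Z = "std_normal_product k"
  interpret prob_space ?Z by (rule prob_space_std_normal_product)
  note coord [measurable] = measurable_std_normal_product_coord
  define T where "T z = (\<lambda>i\<in>?J. 0 + (\<Sum>l<k. A i l * z l))" for z :: "nat \<Rightarrow> real"
  have T[measurable]: "T \<in> ?Z \<rightarrow>\<^sub>M (\<Pi>\<^sub>M i\<in>?J. borel)"
    unfolding T_def by (intro measurable_restrict borel_measurable_add borel_measurable_const borel_measurable_sum borel_measurable_times coord) auto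
  have w[measurable]: "?w \<in> borel_measurable (\<Pi>\<^sub>M i\<in>?J. borel)"
    unfolding smoothed_gap_def by measurable
  define B where "B j l = s * A j l" for j l
  define x where "x z j = \<theta> j + (\<Sum>l<k. B j l * z l)" for z :: "nat \<Rightarrow> real" and j
  define \<rho> where "\<rho> z = sqrt ((\<Sum>j\<in>?J. (x z j)\<^sup>2) + e)" for z
  have \<rho>2: "(\<rho> z)\<^sup>2 = (\<Sum>j\<in>?J. (x z j)\<^sup>2) + e" for z
    using pos by (simp add: \<rho>_def sum_nonneg)
  have \<rho>pos: "\<rho> z > 0" for z unfolding \<rho>_def using pos by (simp add: add_nonneg_pos sum_nonneg)
  note stein = gaussian_stein_identity[where J="?J" and e=e and \<theta>=\<theta> and A=B and k=k, OF finite_atLeastAtMost pos(3),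
      folded x_def, folded \<rho>_def]
  let ?h = "\<lambda>z. (\<Sum>j\<in>?J. (x z j - \<theta> j) * x z j) / \<rho> z"
  let ?g = "\<lambda>z. (\<Sum>l<k. \<Sum>j\<in>?J. (B j l)\<^sup>2) / \<rho> z - (\<Sum>l<k. (\<Sum>j\<in>?J. B j l * x z j)\<^sup>2) / (\<rho> z)^3"
  let ?t = "\<lambda>z. (s\<^sup>2 * l) * ((3 * m\<^sup>2 - (\<rho> z)\<^sup>2) / (2 * m^3))"
  have wT: "?w (T z) = ?h z - ?t z" for z
  proof -
    have "\<theta> j + s * T z j = x z j" if "j \<in> ?J" for j
      using that by (simp add: T_def x_def B_def sum_distrib_left mult_ac)
    then show ?thesis unfolding smoothed_gap_def \<rho>2 by (simp add: \<rho>_def)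
  qed
  have coord2: "integrable ?Z (\<lambda>z. (x z j)\<^sup>2)" for j
    unfolding x_def
  proof (intro integrable_power2_add integrable_power2_sum)
    show "integrable ?Z (\<lambda>z. (B j i * z i)\<^sup>2)" if "i \<in> {..<k}" for i
      using integrable_std_normal_product_coord[of i k 2] that by (simp add: power_mult_distrib)
  qed (auto intro!: borel_measurable_times borel_measurable_sum coord)
  have t_int: "integrable ?Z ?t" unfolding \<rho>2 using coord2 by auto
  have g_ge: "?t z \<le> ?g z" for z
  proof -
    let ?S = "\<Sum>j\<in>?J. (x z j)\<^sup>2"
    have tr: "(\<Sum>l<k. \<Sum>j\<in>?J. (B j l)\<^sup>2) = s\<^sup>2 * (\<Sum>j\<in>?J. C j j)"
      by (subst sum.swap) (simp add: CA B_def sum_distrib_left power2_eq_square mult_ac)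
    have qf: "(\<Sum>l<k. (\<Sum>j\<in>?J. B j l * x z j)\<^sup>2) = s\<^sup>2 * quad_form d C (x z) (x z)"
    proof -
      have BA: "(\<Sum>j\<in>?J. B j l * x z j) = s * (\<Sum>j\<in>?J. A j l * x z j)" for l
        by (simp add: B_def sum_distrib_left mult_ac)
      have "quad_form d C (x z) (x z) = (\<Sum>l<k. (\<Sum>j\<in>?J. A j l * x z j)\<^sup>2)"
        by (rule qff)
      then show ?thesis
        by (simp only: BA power_mult_distrib) (rule sum_distrib_left[symmetric])
    qed
    \<comment> \<open>A covariance is positive semidefinite, so testing at a unit vector gives the sign of \<open>L\<close>.\<close>
    have L0: "0 \<le> L"
    proof -
      let ?y = "\<lambda>i::nat. if i = 1 then 1 else 0 :: real"
      have "0 \<le> quad_form d C ?y ?y" unfolding qff by (simp add: sum_nonneg)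
      also have "\<dots> \<le> L * (\<Sum>i\<in>?J. (?y i)\<^sup>2)" by (rule L)
      also have "(\<Sum>i\<in>?J. (?y i)\<^sup>2) = (\<Sum>i\<in>?J. ?y i)" by (intro sum.cong) auto
      also have "\<dots> = 1" using pos(1) by simp
      finally show ?thesis by simp
    qed
    have "quad_form d C (x z) (x z) \<le> L * ?S" by (rule L)
    also have "\<dots> \<le> L * (\<rho> z)\<^sup>2" unfolding \<rho>2 using L0 pos by (intro mult_left_mono) auto
    finally have qf_le: "quad_form d C (x z) (x z) / (\<rho> z)^3 \<le> L / \<rho> z"
      using \<rho>pos[of z] by (simp add: field_simps power2_eq_square power3_eq_cube)
    have "?t z \<le> (s\<^sup>2 * l) * (1 / \<rho> z)"
      using pos \<rho>pos[of z] by (intro mult_left_mono tangent_inverse_norm) auto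
    also have "\<dots> \<le> s\<^sup>2 * (((\<Sum>j\<in>?J. C j j) - L) / \<rho> z)"
      using l \<rho>pos[of z] by (simp add: mult_left_mono divide_right_mono)
    also have "\<dots> \<le> s\<^sup>2 * ((\<Sum>j\<in>?J. C j j) / \<rho> z - quad_form d C (x z) (x z) / (\<rho> z)^3)"
      using qf_le by (intro mult_left_mono) (simp_all add: diff_divide_distrib)
    also have "\<dots> = ?g z" unfolding tr qf by (simp only: right_diff_distrib times_divide_eq_right)
    finally show ?thesis .
  qed
  have \<mu>T: "\<mu> = distr ?Z (\<Pi>\<^sub>M i\<in>?J. borel) T"
    unfolding T_def by (rule \<mu>)
  have ht_int: "integrable ?Z (\<lambda>z. ?h z - ?t z)"
    by (intro Bochner_Integration.integrable_diff stein(1) t_int)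
  have gt_int: "integrable ?Z (\<lambda>z. ?g z - ?t z)"
    by (intro Bochner_Integration.integrable_diff stein(2) t_int)
  show "integrable \<mu> ?w"
    unfolding \<mu>T integrable_distr_eq[OF T w] wT by (rule ht_int)
  have "(\<integral>x. ?w x \<partial>\<mu>) = (\<integral>z. ?h z - ?t z \<partial>?Z)"
    unfolding \<mu>T integral_distr[OF T w] wT by (rule refl)
  also have "\<dots> = (\<integral>z. ?h z \<partial>?Z) - (\<integral>z. ?t z \<partial>?Z)"
    by (rule Bochner_Integration.integral_diff[OF stein(1) t_int])
  also have "(\<integral>z. ?h z \<partial>?Z) = (\<integral>z. ?g z \<partial>?Z)" by (rule stein(3))
  also have "(\<integral>z. ?g z \<partial>?Z) - (\<integral>z. ?t z \<partial>?Z) = (\<integral>z. ?g z - ?t z \<partial>?Z)"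
    by (rule Bochner_Integration.integral_diff[OF stein(2) t_int, symmetric])
  finally have "(\<integral>x. ?w x \<partial>\<mu>) = (\<integral>z. ?g z - ?t z \<partial>?Z)" .
  moreover have "0 \<le> (\<integral>z. ?g z - ?t z \<partial>?Z)"
    by (rule Bochner_Integration.integral_nonneg) (simp only: diff_ge_0_iff_ge g_ge)
  ultimately show "0 \<le> (\<integral>x. ?w x \<partial>\<mu>)" by (simp only:)
qed

lemma nn_integral_neg_le_pos:
  fixes w :: "'a \<Rightarrow> real"
  assumes w: "integrable N w" and nonneg: "0 \<le> (\<integral>x. w x \<partial>N)"
  shows "(\<integral>\<^sup>+x. ennreal (- w x) \<partial>N) \<le> (\<integral>\<^sup>+x. ennreal (w x) \<partial>N)"
proof -
  have fin: "(\<integral>\<^sup>+x. ennreal (w x) \<partial>N) \<noteq> \<infinity>" "(\<integral>\<^sup>+x. ennreal (- w x) \<partial>N) \<noteq> \<infinity>"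
    using w by (simp_all add: real_integrable_def)
  have "enn2real (\<integral>\<^sup>+x. ennreal (- w x) \<partial>N) \<le> enn2real (\<integral>\<^sup>+x. ennreal (w x) \<partial>N)"
    using nonneg by (simp add: real_lebesgue_integral_def[OF w])
  then have "ennreal (enn2real (\<integral>\<^sup>+x. ennreal (- w x) \<partial>N)) \<le> ennreal (enn2real (\<integral>\<^sup>+x. ennreal (w x) \<partial>N))"
    by (rule ennreal_leI)
  then show ?thesis using fin by (simp add: ennreal_enn2real_if)
qed

text \<open>The law of \<open>X\<close> is the mixture of the conditional laws \<open>\<kappa> \<omega>\<close>. The positive and
  negative parts of \<open>w\<close> are treated separately, so that \<open>w\<close> need not be bounded.\<close>

lemma cond_distribution_integral_nonneg:
  fixes X :: "'w \<Rightarrow> 'b" and w :: "'b \<Rightarrow> real"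
  assumes M: "prob_space M" and G: "subalgebra M G"
    and X[measurable]: "X \<in> M \<rightarrow>\<^sub>M P"
    and \<kappa>: "\<kappa> \<in> G \<rightarrow>\<^sub>M prob_algebra P"
    and cond: "\<And>B. B \<in> sets P \<Longrightarrow> AE \<omega> in M. real_cond_exp M G (\<lambda>\<omega>. indicator B (X \<omega>)) \<omega> = measure (\<kappa> \<omega>) B"
    and w[measurable]: "w \<in> borel_measurable P" and wX: "integrable M (\<lambda>\<omega>. w (X \<omega>))"
    and nonneg: "AE \<omega> in M. integrable (\<kappa> \<omega>) w \<and> 0 \<le> (\<integral>x. w x \<partial>\<kappa> \<omega>)"
  shows "0 \<le> (\<integral>\<omega>. w (X \<omega>) \<partial>M)"
proof -
  interpret M: prob_space M by fact
  interpret finite_measure_subalgebra M G by unfold_locales fact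
  have kM: "\<kappa> \<in> M \<rightarrow>\<^sub>M prob_algebra P" by (rule measurable_from_subalg[OF G \<kappa>])
  then have kS[measurable]: "\<kappa> \<in> M \<rightarrow>\<^sub>M subprob_algebra P" by (rule measurable_prob_algebraD)
  have ne: "space M \<noteq> {}" by (rule M.not_empty)
  have law: "distr M P X = bind M \<kappa>"
  proof (rule measure_eqI)
    show "sets (distr M P X) = sets (bind M \<kappa>)"
      using ne by (simp add: sets_bind[OF sets_kernel[OF kS]])
    fix B assume "B \<in> sets (distr M P X)"
    then have B[measurable]: "B \<in> sets P" by simp
    have ind: "integrable M (\<lambda>\<omega>. indicator B (X \<omega>) :: real)"
      by (rule M.integrable_const_bound[of _ 1]) auto
    have "emeasure (bind M \<kappa>) B = (\<integral>\<^sup>+\<omega>. emeasure (\<kappa> \<omega>) B \<partial>M)"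
      by (rule emeasure_bind[OF ne kS B])
    also have "\<dots> = (\<integral>\<^sup>+\<omega>. ennreal (measure (\<kappa> \<omega>) B) \<partial>M)"
    proof (rule nn_integral_cong)
      fix \<omega> assume "\<omega> \<in> space M"
      then have "subprob_space (\<kappa> \<omega>)" by (rule subprob_space_kernel[OF kS])
      then show "emeasure (\<kappa> \<omega>) B = ennreal (measure (\<kappa> \<omega>) B)"
        by (intro finite_measure.emeasure_eq_measure subprob_space.axioms(1))
    qed
    also have "\<dots> = (\<integral>\<^sup>+\<omega>. ennreal (real_cond_exp M G (\<lambda>\<omega>. indicator B (X \<omega>)) \<omega>) \<partial>M)"
      using cond[OF B] by (intro nn_integral_cong_AE) auto
    also have "\<dots> = ennreal (\<integral>\<omega>. real_cond_exp M G (\<lambda>\<omega>. indicator B (X \<omega>)) \<omega> \<partial>M)"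
    proof (rule nn_integral_eq_integral)
      show "AE \<omega> in M. 0 \<le> real_cond_exp M G (\<lambda>\<omega>. indicator B (X \<omega>)) \<omega>"
        using cond[OF B] by eventually_elim simp
    qed (rule real_cond_exp_int(1)[OF ind])
    also have "\<dots> = ennreal (\<integral>\<omega>. indicator B (X \<omega>) \<partial>M)"
      by (simp add: real_cond_exp_int(2)[OF ind])
    also have "\<dots> = (\<integral>\<^sup>+\<omega>. ennreal (indicator B (X \<omega>)) \<partial>M)"
      by (rule nn_integral_eq_integral[symmetric, OF ind]) simp
    also have "\<dots> = (\<integral>\<^sup>+\<omega>. indicator B (X \<omega>) \<partial>M)"
      by (simp add: ennreal_indicator)
    also have "\<dots> = (\<integral>\<^sup>+x. indicator B x \<partial>distr M P X)"
      by (rule nn_integral_distr[symmetric]) auto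
    also have "\<dots> = emeasure (distr M P X) B" by (rule nn_integral_indicator) simp
    finally show "emeasure (distr M P X) B = emeasure (bind M \<kappa>) B" by simp
  qed
  have split: "(\<integral>\<^sup>+\<omega>. ennreal (v (X \<omega>)) \<partial>M) = (\<integral>\<^sup>+\<omega>. \<integral>\<^sup>+x. ennreal (v x) \<partial>\<kappa> \<omega> \<partial>M)"
    if [measurable]: "v \<in> borel_measurable P" for v :: "'b \<Rightarrow> real"
  proof -
    have "(\<integral>\<^sup>+\<omega>. ennreal (v (X \<omega>)) \<partial>M) = (\<integral>\<^sup>+x. ennreal (v x) \<partial>distr M P X)"
      by (rule nn_integral_distr[symmetric]) auto
    also have "\<dots> = (\<integral>\<^sup>+\<omega>. \<integral>\<^sup>+x. ennreal (v x) \<partial>\<kappa> \<omega> \<partial>M)"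
      unfolding law by (rule nn_integral_bind[OF _ kS]) auto
    finally show ?thesis .
  qed
  have "(\<integral>\<^sup>+\<omega>. ennreal (- w (X \<omega>)) \<partial>M) = (\<integral>\<^sup>+\<omega>. \<integral>\<^sup>+x. ennreal (- w x) \<partial>\<kappa> \<omega> \<partial>M)"
    by (rule split) auto
  also have "\<dots> \<le> (\<integral>\<^sup>+\<omega>. \<integral>\<^sup>+x. ennreal (w x) \<partial>\<kappa> \<omega> \<partial>M)"
  proof (rule nn_integral_mono_AE)
    show "AE \<omega> in M. (\<integral>\<^sup>+x. ennreal (- w x) \<partial>\<kappa> \<omega>) \<le> (\<integral>\<^sup>+x. ennreal (w x) \<partial>\<kappa> \<omega>)"
      using nonneg by eventually_elim (rule nn_integral_neg_le_pos; blast)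
  qed
  also have "\<dots> = (\<integral>\<^sup>+\<omega>. ennreal (w (X \<omega>)) \<partial>M)" by (rule split[OF w, symmetric])
  finally have le: "(\<integral>\<^sup>+\<omega>. ennreal (- w (X \<omega>)) \<partial>M) \<le> (\<integral>\<^sup>+\<omega>. ennreal (w (X \<omega>)) \<partial>M)" .
  have "enn2real (\<integral>\<^sup>+\<omega>. ennreal (- w (X \<omega>)) \<partial>M) \<le> enn2real (\<integral>\<^sup>+\<omega>. ennreal (w (X \<omega>)) \<partial>M)"
    by (rule enn2real_mono[OF le]) (use wX in \<open>simp add: real_integrable_def less_top[symmetric]\<close>)
  then show ?thesis by (simp add: real_lebesgue_integral_def[OF wX])
qed

section \<open>The correlation of the noise with the normalised observation\<close>

text \<open>A dominating function for the smoothing limit that does not depend on \<open>e\<close>. The case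
  \<open>e = 0\<close> includes \<open>u = 0\<close>, where division by zero yields 0.\<close>

lemma inner_over_norm_bound:
  fixes u \<theta> :: "nat \<Rightarrow> real"
  assumes "0 \<le> e"
  shows "\<bar>(\<Sum>j=1..d. (u j - \<theta> j) * u j) / sqrt ((\<Sum>j=1..d. (u j)\<^sup>2) + e)\<bar> \<le> (\<Sum>j=1..d. \<bar>u j - \<theta> j\<bar>)"
proof -
  define \<rho> where "\<rho> = sqrt ((\<Sum>j=1..d. (u j)\<^sup>2) + e)"
  have \<rho>0: "0 \<le> \<rho>" using assms by (simp add: \<rho>_def sum_nonneg)
  have le: "\<bar>u j\<bar> \<le> \<rho>" if "j \<in> {1..d}" for j
  proof -
    have "(u j)\<^sup>2 \<le> (\<Sum>j=1..d. (u j)\<^sup>2)" by (rule member_le_sum[OF that]) auto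
    then have "sqrt ((u j)\<^sup>2) \<le> \<rho>" unfolding \<rho>_def using assms by (intro real_sqrt_le_mono) simp
    then show ?thesis by simp
  qed
  have "\<bar>\<Sum>j=1..d. (u j - \<theta> j) * u j\<bar> \<le> (\<Sum>j=1..d. \<bar>u j - \<theta> j\<bar> * \<rho>)"
    by (rule order_trans[OF sum_abs], rule sum_mono) (simp add: abs_mult mult_left_mono le)
  also have "\<dots> = (\<Sum>j=1..d. \<bar>u j - \<theta> j\<bar>) * \<rho>" by (rule sum_distrib_right[symmetric])
  finally have main: "\<bar>\<Sum>j=1..d. (u j - \<theta> j) * u j\<bar> \<le> (\<Sum>j=1..d. \<bar>u j - \<theta> j\<bar>) * \<rho>" .
  show ?thesis
  proof (cases "\<rho> = 0")
    case True
    then show ?thesis unfolding \<rho>_def[symmetric] by (simp add: sum_nonneg)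
  next
    case False
    then have "0 < \<rho>" using \<rho>0 by simp
    then show ?thesis unfolding \<rho>_def[symmetric] using main
      by (simp add: pos_divide_le_eq)
  qed
qed

text \<open>At \<open>u = 0\<close> both sides are 0, so the convergence holds everywhere.\<close>

lemma inner_over_norm_smoothing_limit:
  fixes u \<theta> :: "nat \<Rightarrow> real"
  shows "(\<lambda>k. (\<Sum>j=1..d. (u j - \<theta> j) * u j) / sqrt ((\<Sum>j=1..d. (u j)\<^sup>2) + 1 / real (Suc k)))
    \<longlonglongrightarrow> (\<Sum>j=1..d. (u j - \<theta> j) * u j) / eucl_norm d u"
proof (cases "(\<Sum>j=1..d. (u j)\<^sup>2) = 0")
  case True
  then have "u j = 0" if "j \<in> {1..d}" for j using that by (simp add: sum_nonneg_eq_0_iff)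
  then have "(\<Sum>j=1..d. (u j - \<theta> j) * u j) = 0" by (intro sum.neutral) simp
  then show ?thesis by simp
next
  case False
  have "(\<lambda>k. (\<Sum>j=1..d. (u j)\<^sup>2) + 1 / real (Suc k)) \<longlonglongrightarrow> (\<Sum>j=1..d. (u j)\<^sup>2) + 0"
    by (intro tendsto_add tendsto_const LIMSEQ_Suc lim_1_over_n)
  then have "(\<lambda>k. sqrt ((\<Sum>j=1..d. (u j)\<^sup>2) + 1 / real (Suc k))) \<longlonglongrightarrow> eucl_norm d u"
    unfolding eucl_norm_def using tendsto_real_sqrt by fastforce
  moreover have "eucl_norm d u \<noteq> 0" using False by (simp add: eucl_norm_def)
  ultimately show ?thesis by (intro tendsto_divide tendsto_const)
qed

text \<open>The smoothed gap has nonnegative conditional expectation, hence nonnegative expectation. This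
  bounds the smoothed correlation from below by a multiple of \<open>(2 m\<^sup>2 - e) / (2 m\<^sup>3)\<close>,
  which tends to \<open>1 / m\<close>.\<close>

lemma stein_correlation_bound:
  fixes X :: "nat \<Rightarrow> 'w \<Rightarrow> real" and \<theta> :: "nat \<Rightarrow> real" and s l m :: real
  assumes M: "prob_space M" and G: "subalgebra M G"
    and X: "\<And>j. j \<in> {1..d} \<Longrightarrow> X j \<in> borel_measurable M"
      "\<And>j. j \<in> {1..d} \<Longrightarrow> integrable M (\<lambda>\<omega>. (X j \<omega>)\<^sup>2)"
    and gauss: "cond_gaussian M G {1..d} X (\<lambda>\<omega> i. 0) (cond_cov M G X)"
    and gap: "AE \<omega> in M. l \<le> (\<Sum>i=1..d. cond_cov M G X \<omega> i i) - lambda_max d (cond_cov M G X \<omega>)"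
    and pos: "1 \<le> d" "0 < l" "0 < m"
    and second_moment: "(\<Sum>j=1..d. \<integral>\<omega>. (\<theta> j + s * X j \<omega>)\<^sup>2 \<partial>M) \<le> m\<^sup>2"
  defines "u \<equiv> \<lambda>\<omega> j. \<theta> j + s * X j \<omega>"
  shows "s\<^sup>2 * l / m \<le> (\<integral>\<omega>. (\<Sum>j=1..d. (u \<omega> j - \<theta> j) * u \<omega> j) / eucl_norm d (u \<omega>) \<partial>M)"
proof -
  interpret M: prob_space M by fact
  let ?J = "{1..d}"
  define H where "H e \<omega> = (\<Sum>j=1..d. (u \<omega> j - \<theta> j) * u \<omega> j) / sqrt ((\<Sum>j=1..d. (u \<omega> j)\<^sup>2) + e)" for e \<omega>
  have um: "(\<lambda>\<omega>. u \<omega> j) \<in> borel_measurable M" if "j \<in> ?J" for j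
    unfolding u_def using X(1)[OF that] by measurable
  have u2: "integrable M (\<lambda>\<omega>. (u \<omega> j)\<^sup>2)" if "j \<in> ?J" for j
    unfolding u_def using X[OF that]
    by (intro integrable_power2_add(1)) (auto simp: power_mult_distrib)
  have Xi: "integrable M (X j)" if "j \<in> ?J" for j
    using X[OF that] by (rule M.square_integrable_imp_integrable)
  have [measurable]: "(\<lambda>\<omega>. \<Sum>j=1..d. (u \<omega> j)\<^sup>2) \<in> borel_measurable M"
    by (intro borel_measurable_sum borel_measurable_power um)
  have [measurable]: "(\<lambda>\<omega>. \<Sum>j=1..d. (u \<omega> j - \<theta> j) * u \<omega> j) \<in> borel_measurable M"
    by (intro borel_measurable_sum borel_measurable_times borel_measurable_diff borel_measurable_const um)
  have Hm: "H e \<in> borel_measurable M" for e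
    unfolding H_def by measurable
  have dom: "integrable M (\<lambda>\<omega>. \<Sum>j=1..d. \<bar>u \<omega> j - \<theta> j\<bar>)"
    unfolding u_def using Xi by (intro Bochner_Integration.integrable_sum) (auto simp: abs_mult)
  have Hb: "\<bar>H e \<omega>\<bar> \<le> (\<Sum>j=1..d. \<bar>u \<omega> j - \<theta> j\<bar>)" if "0 \<le> e" for e \<omega>
    unfolding H_def by (rule inner_over_norm_bound[OF that])
  have Hi: "integrable M (H e)" if "0 \<le> e" for e
    by (rule Bochner_Integration.integrable_bound[OF dom Hm]) (use Hb[OF that] in \<open>auto intro: order_trans\<close>)
  have low: "s\<^sup>2 * l * ((2 * m\<^sup>2 - e) / (2 * m^3)) \<le> (\<integral>\<omega>. H e \<omega> \<partial>M)" if e: "0 < e" for e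
  proof -
    define w where "w x = smoothed_gap d \<theta> e (s\<^sup>2 * l) m (\<lambda>j. \<theta> j + s * x j)" for x
    define Y where "Y \<omega> = (\<lambda>i\<in>?J. X i \<omega>)" for \<omega>
    have wY: "w (Y \<omega>) = H e \<omega> - s\<^sup>2 * l * ((3 * m\<^sup>2 - ((\<Sum>j=1..d. (u \<omega> j)\<^sup>2) + e)) / (2 * m^3))" for \<omega>
    proof -
      have Yu: "\<theta> j + s * Y \<omega> j = u \<omega> j" if "j \<in> ?J" for j
        unfolding u_def Y_def restrict_apply if_P[OF that] ..
      have "(\<Sum>j=1..d. (\<theta> j + s * Y \<omega> j)\<^sup>2) = (\<Sum>j=1..d. (u \<omega> j)\<^sup>2)"
        "(\<Sum>j=1..d. (\<theta> j + s * Y \<omega> j - \<theta> j) * (\<theta> j + s * Y \<omega> j)) = (\<Sum>j=1..d. (u \<omega> j - \<theta> j) * u \<omega> j)"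
        by (rule sum.cong[OF refl], simp only: Yu)+
      then show ?thesis unfolding w_def smoothed_gap_def H_def by (simp only:)
    qed
    have sum_u2: "integrable M (\<lambda>\<omega>. \<Sum>j=1..d. (u \<omega> j)\<^sup>2)"
      using u2 by (intro Bochner_Integration.integrable_sum)
    have rest_int: "integrable M (\<lambda>\<omega>. s\<^sup>2 * l * ((3 * m\<^sup>2 - ((\<Sum>j=1..d. (u \<omega> j)\<^sup>2) + e)) / (2 * m^3)))"
      using sum_u2 by (intro integrable_mult_right integrable_divide Bochner_Integration.integrable_diff
          Bochner_Integration.integrable_add M.integrable_const)
    from gauss[unfolded cond_gaussian_def] obtain \<kappa> where \<kappa>: "\<kappa> \<in> G \<rightarrow>\<^sub>M prob_algebra (\<Pi>\<^sub>M i\<in>?J. borel)"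
      and cond: "\<forall>B \<in> sets (\<Pi>\<^sub>M i\<in>?J. borel). AE \<omega> in M.
           real_cond_exp M G (\<lambda>\<omega>. indicator B (\<lambda>i\<in>?J. X i \<omega>)) \<omega> = measure (\<kappa> \<omega>) B"
      and law: "AE \<omega> in M. gaussian_law ?J (\<lambda>i. 0) (cond_cov M G X \<omega>) (\<kappa> \<omega>)"
      by blast
    have "0 \<le> (\<integral>\<omega>. w (Y \<omega>) \<partial>M)"
    proof (rule cond_distribution_integral_nonneg[where X=Y and w=w, OF M G _ \<kappa>])
      show "Y \<in> M \<rightarrow>\<^sub>M (\<Pi>\<^sub>M i\<in>?J. borel)" unfolding Y_def by (intro measurable_restrict X)
      show "AE \<omega> in M. real_cond_exp M G (\<lambda>\<omega>. indicator B (Y \<omega>)) \<omega> = measure (\<kappa> \<omega>) B"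
        if "B \<in> sets (\<Pi>\<^sub>M i\<in>?J. borel)" for B
        using cond that unfolding Y_def by (rule bspec)
      show "w \<in> borel_measurable (\<Pi>\<^sub>M i\<in>?J. borel)"
        unfolding w_def smoothed_gap_def by measurable
      show "integrable M (\<lambda>\<omega>. w (Y \<omega>))"
        unfolding wY using e by (intro Bochner_Integration.integrable_diff Hi rest_int) simp
      show "AE \<omega> in M. integrable (\<kappa> \<omega>) w \<and> 0 \<le> (\<integral>x. w x \<partial>\<kappa> \<omega>)"
        using law gap
      proof eventually_elim
        case (elim \<omega>)
        have sym: "cond_cov M G X \<omega> i j = cond_cov M G X \<omega> j i" for i j
          unfolding cond_cov_def by (simp add: mult.commute)
        have L: "quad_form d (cond_cov M G X \<omega>) y y \<le> lambda_max d (cond_cov M G X \<omega>) * (\<Sum>i=1..d. (y i)\<^sup>2)" for y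
          by (rule quad_form_le_lambda_max[OF pos(1) sym])
        note gg = gaussian_smoothed_gap_nonneg[OF elim(1) L elim(2) pos(1) less_imp_le[OF pos(2)] e pos(3)]
        show ?case unfolding w_def using gg by blast
      qed
    qed
    moreover have "(\<integral>\<omega>. (\<Sum>j=1..d. (u \<omega> j)\<^sup>2) \<partial>M) = (\<Sum>j=1..d. \<integral>\<omega>. (u \<omega> j)\<^sup>2 \<partial>M)"
      using u2 by (intro Bochner_Integration.integral_sum)
    then have "(\<integral>\<omega>. s\<^sup>2 * l * ((3 * m\<^sup>2 - ((\<Sum>j=1..d. (u \<omega> j)\<^sup>2) + e)) / (2 * m^3)) \<partial>M)
        = s\<^sup>2 * l * ((3 * m\<^sup>2 - ((\<Sum>j=1..d. \<integral>\<omega>. (u \<omega> j)\<^sup>2 \<partial>M) + e)) / (2 * m^3))"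
      using sum_u2 by (simp add: M.prob_space)
    moreover have "(\<integral>\<omega>. w (Y \<omega>) \<partial>M) = (\<integral>\<omega>. H e \<omega> \<partial>M) -
        (\<integral>\<omega>. s\<^sup>2 * l * ((3 * m\<^sup>2 - ((\<Sum>j=1..d. (u \<omega> j)\<^sup>2) + e)) / (2 * m^3)) \<partial>M)"
      unfolding wY using e by (intro Bochner_Integration.integral_diff Hi rest_int) simp
    ultimately have "s\<^sup>2 * l * ((3 * m\<^sup>2 - ((\<Sum>j=1..d. \<integral>\<omega>. (u \<omega> j)\<^sup>2 \<partial>M) + e)) / (2 * m^3)) \<le> (\<integral>\<omega>. H e \<omega> \<partial>M)"
      by linarith
    moreover have "s\<^sup>2 * l * ((2 * m\<^sup>2 - e) / (2 * m^3)) \<le> s\<^sup>2 * l * ((3 * m\<^sup>2 - ((\<Sum>j=1..d. \<integral>\<omega>. (u \<omega> j)\<^sup>2 \<partial>M) + e)) / (2 * m^3))"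
      using pos second_moment unfolding u_def by (intro mult_left_mono divide_right_mono) simp_all
    ultimately show ?thesis by (rule order_trans[rotated])
  qed
  have "(\<lambda>k. \<integral>\<omega>. H (1 / real (Suc k)) \<omega> \<partial>M) \<longlonglongrightarrow> (\<integral>\<omega>. (\<Sum>j=1..d. (u \<omega> j - \<theta> j) * u \<omega> j) / eucl_norm d (u \<omega>) \<partial>M)"
  proof (rule integral_dominated_convergence[OF _ Hm dom])
    show "AE \<omega> in M. (\<lambda>k. H (1 / real (Suc k)) \<omega>) \<longlonglongrightarrow> (\<Sum>j=1..d. (u \<omega> j - \<theta> j) * u \<omega> j) / eucl_norm d (u \<omega>)"
      unfolding H_def by (intro AE_I2 inner_over_norm_smoothing_limit)
    show "AE \<omega> in M. norm (H (1 / real (Suc k)) \<omega>) \<le> (\<Sum>j=1..d. \<bar>u \<omega> j - \<theta> j\<bar>)" for k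
      unfolding real_norm_def by (intro AE_I2 Hb) simp
    have "H 0 = (\<lambda>\<omega>. (\<Sum>j=1..d. (u \<omega> j - \<theta> j) * u \<omega> j) / eucl_norm d (u \<omega>))"
      by (simp add: H_def eucl_norm_def fun_eq_iff)
    then show "(\<lambda>\<omega>. (\<Sum>j=1..d. (u \<omega> j - \<theta> j) * u \<omega> j) / eucl_norm d (u \<omega>)) \<in> borel_measurable M"
      using Hm[of 0] by simp
  qed
  note limH = this
  have limL: "(\<lambda>k. s\<^sup>2 * l * ((2 * m\<^sup>2 - 1 / real (Suc k)) / (2 * m^3))) \<longlonglongrightarrow> s\<^sup>2 * l * ((2 * m\<^sup>2 - 0) / (2 * m^3))"
    using pos by (intro tendsto_intros LIMSEQ_Suc lim_1_over_n) simp
  have "s\<^sup>2 * l * ((2 * m\<^sup>2 - 0) / (2 * m^3)) \<le> (\<integral>\<omega>. (\<Sum>j=1..d. (u \<omega> j - \<theta> j) * u \<omega> j) / eucl_norm d (u \<omega>) \<partial>M)"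
    by (rule LIMSEQ_le[OF limL limH]) (intro exI[of _ 0] allI impI low, simp)
  moreover have "(2 * m\<^sup>2 - 0) / (2 * m^3) = 1 / m" using pos by (simp add: power2_eq_square power3_eq_cube)
  ultimately show ?thesis by (simp only: times_divide_eq_right mult_1_right)
qed

section \<open>Cadlag integrands and the drift of the observation\<close>

lemma cadlag_local_oscillation:
  assumes f: "cadlag_on UNIV f" and e: "e > 0"
  shows "\<exists>\<delta>>0. (\<forall>u v. x \<le> u \<longrightarrow> u < x + \<delta> \<longrightarrow> x \<le> v \<longrightarrow> v < x + \<delta> \<longrightarrow> \<bar>f u - f v\<bar> < e) \<and>
    (\<forall>u v. x - \<delta> < u \<longrightarrow> u < x \<longrightarrow> x - \<delta> < v \<longrightarrow> v < x \<longrightarrow> \<bar>f u - f v\<bar> < e)"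
proof -
  have "(f \<longlongrightarrow> f x) (at x within UNIV \<inter> {x<..})" and "\<exists>l. (f \<longlongrightarrow> l) (at x within UNIV \<inter> {..<x})"
    using f unfolding cadlag_on_def by auto
  then obtain l where r: "(f \<longlongrightarrow> f x) (at_right x)" and l: "(f \<longlongrightarrow> l) (at_left x)"
    by auto
  have "\<forall>\<^sub>F u in at_right x. \<bar>f u - f x\<bar> < e/2"
    using tendstoD[OF r, of "e/2"] e by (simp add: dist_real_def)
  then obtain b where b: "b > x" "\<And>u. x < u \<Longrightarrow> u < b \<Longrightarrow> \<bar>f u - f x\<bar> < e/2"
    unfolding eventually_at_right_field by auto
  have "\<forall>\<^sub>F u in at_left x. \<bar>f u - l\<bar> < e/2"
    using tendstoD[OF l, of "e/2"] e by (simp add: dist_real_def)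
  then obtain a where a: "a < x" "\<And>u. a < u \<Longrightarrow> u < x \<Longrightarrow> \<bar>f u - l\<bar> < e/2"
    unfolding eventually_at_left_field by auto
  define \<delta> where "\<delta> = min (b - x) (x - a)"
  show ?thesis
  proof (intro exI[of _ \<delta>] conjI allI impI)
    show "\<delta> > 0" using a b by (simp add: \<delta>_def)
    fix u v
    show "\<bar>f u - f v\<bar> < e" if "x \<le> u" "u < x + \<delta>" "x \<le> v" "v < x + \<delta>"
    proof -
      have "\<bar>f y - f x\<bar> < e/2" if "x \<le> y" "y < x + \<delta>" for y
        using b(2)[of y] that e by (cases "y = x") (auto simp: \<delta>_def)
      from this[of u] this[of v] that show ?thesis by linarith
    qed
    show "\<bar>f u - f v\<bar> < e" if "x - \<delta> < u" "u < x" "x - \<delta> < v" "v < x"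
    proof -
      have "a < u" "a < v" using that by (auto simp: \<delta>_def min_def split: if_splits)
      then show ?thesis using a(2)[of u] a(2)[of v] that by linarith
    qed
  qed
qed

lemma cadlag_bounded:
  assumes f: "cadlag_on UNIV f" and ab: "a \<le> b"
  shows "\<exists>B. \<forall>s\<in>{a..b}. \<bar>f s\<bar> \<le> B"
  using ab
proof (induction rule: Bolzano)
  case (trans a b c)
  then obtain B C where "\<forall>s\<in>{a..b}. \<bar>f s\<bar> \<le> B" "\<forall>s\<in>{b..c}. \<bar>f s\<bar> \<le> C" by blast
  then have "\<forall>s\<in>{a..c}. \<bar>f s\<bar> \<le> max B C"
    by (force simp: le_max_iff_disj)
  then show ?case ..
next
  case (local x)
  have one: "(0::real) < 1" by simp
  from cadlag_local_oscillation[OF f one, of x] obtain \<delta> where d: "\<delta> > 0 \<and>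
    (\<forall>u v. x \<le> u \<longrightarrow> u < x + \<delta> \<longrightarrow> x \<le> v \<longrightarrow> v < x + \<delta> \<longrightarrow> \<bar>f u - f v\<bar> < 1) \<and>
    (\<forall>u v. x - \<delta> < u \<longrightarrow> u < x \<longrightarrow> x - \<delta> < v \<longrightarrow> v < x \<longrightarrow> \<bar>f u - f v\<bar> < 1)" ..
  note d = d[THEN conjunct1] d[THEN conjunct2, THEN conjunct1, rule_format] d[THEN conjunct2, THEN conjunct2, rule_format]
  have "\<forall>s\<in>{a..b}. \<bar>f s\<bar> \<le> \<bar>f x\<bar> + \<bar>f (x - \<delta>/2)\<bar> + 1" if "a \<le> x" "x \<le> b" "b - a < \<delta>" for a b
  proof
    fix s assume "s \<in> {a..b}"
    then show "\<bar>f s\<bar> \<le> \<bar>f x\<bar> + \<bar>f (x - \<delta>/2)\<bar> + 1"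
      using d(1) d(2)[of s x] d(3)[of s "x - \<delta>/2"] that by (cases "x \<le> s") auto
  qed
  then show ?case using d(1) by blast
qed

text \<open>A cadlag function has only finitely many jumps of a given size on a bounded interval; between
  consecutive points of \<open>P\<close> it oscillates by less than \<open>e\<close>. Bisection reduces the claim to the
  one-sided limits at a single point.\<close>

lemma cadlag_oscillation_partition:
  assumes f: "cadlag_on UNIV f" and ab: "a \<le> b" and e: "e > 0"
  shows "\<exists>P. finite P \<and>
    (\<forall>u s. a \<le> u \<longrightarrow> u \<le> s \<longrightarrow> s \<le> b \<longrightarrow> (\<forall>q\<in>P. q \<le> u \<or> s < q) \<longrightarrow> \<bar>f u - f s\<bar> < e)"
proof -
  define small where "small P a b \<longleftrightarrow>
    (\<forall>u s. a \<le> u \<longrightarrow> u \<le> s \<longrightarrow> s \<le> b \<longrightarrow> (\<forall>q\<in>P. q \<le> u \<or> s < q) \<longrightarrow> \<bar>f u - f s\<bar> < e)" for P a b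
  have smallD: "\<bar>f u - f s\<bar> < e"
    if "small P a b" "a \<le> u" "u \<le> s" "s \<le> b" "\<And>q. q \<in> P \<Longrightarrow> q \<le> u \<or> s < q" for P a b u s
    using that unfolding small_def by blast
  have "\<exists>P. finite P \<and> small P a b"
    using ab
  proof (induction rule: Bolzano)
    case (trans a b c)
    from trans(1) obtain P where P: "finite P \<and> small P a b" ..
    from trans(2) obtain R where R: "finite R \<and> small R b c" ..
    have "small (insert b (P \<union> R)) a c"
      unfolding small_def
    proof (intro allI impI)
      fix u s assume us: "a \<le> u" "u \<le> s" "s \<le> c" and q: "\<forall>q\<in>insert b (P \<union> R). q \<le> u \<or> s < q"
      then have "b \<le> u \<or> s < b" by simp
      then show "\<bar>f u - f s\<bar> < e"
      proof
        assume "b \<le> u"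
        then show ?thesis using R us q by (intro smallD[of R b c]) simp_all
      next
        assume "s < b"
        then show ?thesis using P us q by (intro smallD[of P a b]) simp_all
      qed
    qed
    moreover have "finite (insert b (P \<union> R))" using P R by simp
    ultimately show ?case by (intro exI conjI)
  next
    case (local x)
    from cadlag_local_oscillation[OF f e, of x] obtain \<delta> where d: "\<delta> > 0 \<and>
      (\<forall>u v. x \<le> u \<longrightarrow> u < x + \<delta> \<longrightarrow> x \<le> v \<longrightarrow> v < x + \<delta> \<longrightarrow> \<bar>f u - f v\<bar> < e) \<and>
      (\<forall>u v. x - \<delta> < u \<longrightarrow> u < x \<longrightarrow> x - \<delta> < v \<longrightarrow> v < x \<longrightarrow> \<bar>f u - f v\<bar> < e)" ..
    note d = d[THEN conjunct1] d[THEN conjunct2, THEN conjunct1, rule_format] d[THEN conjunct2, THEN conjunct2, rule_format]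
    have sm: "small {x} a b" if ab: "a \<le> x" "x \<le> b" "b - a < \<delta>" for a b
      unfolding small_def
    proof (intro allI impI)
      fix u s assume us: "a \<le> u" "u \<le> s" "s \<le> b" and "\<forall>q\<in>{x}. q \<le> u \<or> s < q"
      then have "x \<le> u \<or> s < x" by simp
      then show "\<bar>f u - f s\<bar> < e"
      proof
        assume "x \<le> u"
        then show ?thesis using us ab by (intro d(2)) linarith+
      next
        assume "s < x"
        then show ?thesis using us ab by (intro d(3)) linarith+
      qed
    qed
    show ?case
    proof (intro exI[of _ \<delta>] conjI allI impI)
      fix a b assume "a \<le> x \<and> x \<le> b \<and> b - a < \<delta>"
      then show "\<exists>P. finite P \<and> small P a b" using sm by (intro exI[of _ "{x}"]) simp
    qed (rule d(1))
  qed
  then show ?thesis unfolding small_def .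
qed

lemma set_integral_Icc_combine:
  fixes g :: "real \<Rightarrow> real"
  assumes "set_integrable lborel {a..c} g" "a \<le> b" "b \<le> c"
  shows "(LINT s:{a..c}|lborel. g s) = (LINT s:{a..b}|lborel. g s) + (LINT s:{b..c}|lborel. g s)"
proof -
  have "{a..c} = {a..b} \<union> {b..c}" using assms by auto
  moreover have "set_integrable lborel {a..b} g" "set_integrable lborel {b..c} g"
    using assms by (auto intro: set_integrable_subset)
  moreover have "AE x in lborel. \<not> (x \<in> {a..b} \<and> x \<in> {b..c})"
    using AE_lborel_singleton[of b] by eventually_elim auto
  ultimately show ?thesis by (simp add: set_integral_Un_AE)
qed

lemma partition_bounds:
  assumes "is_partition T N p" "i \<le> N"
  shows "0 \<le> p i" "p i \<le> T"
proof -
  have mono: "p i \<le> p j" if "i \<le> j" "j \<le> N" for i j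
    using that
  proof (induction j rule: dec_induct)
    case (step n)
    then show ?case using assms(1) unfolding is_partition_def by (meson Suc_le_eq Suc_leD order_trans)
  qed simp
  show "0 \<le> p i" "p i \<le> T" 
    using mono[of 0 i] mono[of i N] assms by (auto simp: is_partition_def)
qed

lemma set_integral_partition:
  fixes g :: "real \<Rightarrow> real"
  assumes p: "is_partition T N p" and g: "set_integrable lborel {0..T} g"
  shows "(LINT s:{0..T}|lborel. g s) = (\<Sum>i<N. LINT s:{p i..p (Suc i)}|lborel. g s)"
proof -
  have "(LINT s:{0..p m}|lborel. g s) = (\<Sum>i<m. LINT s:{p i..p (Suc i)}|lborel. g s)" if "m \<le> N" for m
    using that
  proof (induction m)
    case 0
    have "p 0 = 0" using p by (simp add: is_partition_def)
    moreover have "AE x in lborel. indicator {0..0::real} x *\<^sub>R g x = 0"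
      using AE_lborel_singleton[of 0] by eventually_elim (simp add: indicator_def)
    ultimately show ?case by (simp add: set_lebesgue_integral_def integral_eq_zero_AE)
  next
    case (Suc m)
    have "(LINT s:{0..p (Suc m)}|lborel. g s) = (LINT s:{0..p m}|lborel. g s) + (LINT s:{p m..p (Suc m)}|lborel. g s)"
    proof (rule set_integral_Icc_combine)
      show "set_integrable lborel {0..p (Suc m)} g"
        by (rule set_integrable_subset[OF g]) (use partition_bounds[OF p, of "Suc m"] Suc in auto)
      show "0 \<le> p m" using partition_bounds[OF p, of m] Suc by simp
      show "p m \<le> p (Suc m)" using p Suc by (auto simp: is_partition_def)
    qed
    then show ?case using Suc by simp
  qed
  from this[of N] p show ?thesis by (simp add: is_partition_def)
qed

text \<open>The intervals shrink to a finite set, which is null.\<close>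

lemma set_integral_near_finite_small:
  fixes g :: "real \<Rightarrow> real"
  assumes P: "finite P" and g: "set_integrable lborel {a..b} g" and e: "e > 0"
  obtains \<delta> :: real where "\<delta> > 0" "\<bar>LINT s:{a..b}|lborel. (\<Sum>q\<in>P. indicator {q..q+\<delta>} s) * g s\<bar> < e"
proof -
  have gi: "integrable lborel (\<lambda>s. indicator {a..b} s * g s)" using g by (simp add: set_integrable_def)
  note [measurable] = borel_measurable_integrable[OF gi]
  have "(\<lambda>k. \<integral>s. (\<Sum>q\<in>P. indicator {q..q+1/real (Suc k)} s) * (indicator {a..b} s * g s) \<partial>lborel)
    \<longlonglongrightarrow> (\<integral>s. (\<Sum>q\<in>P. indicator {q} s) * (indicator {a..b} s * g s) \<partial>lborel)"
  proof (rule integral_dominated_convergence)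
    show "integrable lborel (\<lambda>s. real (card P) * \<bar>indicator {a..b} s * g s\<bar>)"
      using gi by auto
    show "AE s in lborel. (\<lambda>k. (\<Sum>q\<in>P. indicator {q..q+1/real (Suc k)} s) * (indicator {a..b} s * g s))
      \<longlonglongrightarrow> (\<Sum>q\<in>P. indicator {q} s) * (indicator {a..b} s * g s)"
    proof (rule AE_I2)
      fix s :: real
      have "(\<lambda>k. indicator {q..q+1/real (Suc k)} s :: real) \<longlonglongrightarrow> indicator {q} s" for q
      proof (cases "s \<le> q")
        case True
        then show ?thesis by (auto simp: indicator_def)
      next
        case False
        have "(\<lambda>k. q + 1 / real (Suc k)) \<longlonglongrightarrow> q + 0"
          by (intro tendsto_add tendsto_const LIMSEQ_Suc lim_1_over_n)
        then have "\<forall>\<^sub>F k in sequentially. q + 1 / real (Suc k) < s"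
          using False order_tendstoD(2) by fastforce
        then have "\<forall>\<^sub>F k in sequentially. indicator {q..q+1/real (Suc k)} s = (indicator {q} s :: real)"
          by eventually_elim (use False in auto)
        then show ?thesis by (rule tendsto_eventually)
      qed
      then show "(\<lambda>k. (\<Sum>q\<in>P. indicator {q..q+1/real (Suc k)} s) * (indicator {a..b} s * g s))
      \<longlonglongrightarrow> (\<Sum>q\<in>P. indicator {q} s) * (indicator {a..b} s * g s)"
        by (intro tendsto_mult tendsto_sum tendsto_const)
    qed
    show "AE s in lborel. norm ((\<Sum>q\<in>P. indicator {q..q+1/real (Suc k)} s) * (indicator {a..b} s * g s))
      \<le> real (card P) * \<bar>indicator {a..b} s * g s\<bar>" for k
    proof (rule AE_I2)
      fix s :: real
      have "(\<Sum>q\<in>P. indicator {q..q+1/real (Suc k)} s :: real) \<le> (\<Sum>q\<in>P. 1)"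
        by (intro sum_mono) (simp add: indicator_def)
      moreover have "0 \<le> (\<Sum>q\<in>P. indicator {q..q+1/real (Suc k)} s :: real)" by (intro sum_nonneg) simp
      ultimately show "norm ((\<Sum>q\<in>P. indicator {q..q+1/real (Suc k)} s) * (indicator {a..b} s * g s))
        \<le> real (card P) * \<bar>indicator {a..b} s * g s\<bar>"
        unfolding real_norm_def abs_mult by (intro mult_right_mono) auto
    qed
  qed measurable
  moreover have "(\<integral>s. (\<Sum>q\<in>P. indicator {q} s) * (indicator {a..b} s * g s) \<partial>lborel) = 0"
  proof (rule integral_eq_zero_AE)
    have "AE s in lborel. \<forall>q\<in>P. s \<noteq> q"
      using P by (intro AE_ball_countable' AE_lborel_singleton) (auto intro: countable_finite)
    then show "AE s in lborel. (\<Sum>q\<in>P. indicator {q} s) * (indicator {a..b} s * g s) = 0"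
      by eventually_elim (simp add: indicator_def sum.neutral)
  qed
  ultimately have "\<forall>\<^sub>F k in sequentially. \<bar>\<integral>s. (\<Sum>q\<in>P. indicator {q..q+1/real (Suc k)} s) * (indicator {a..b} s * g s) \<partial>lborel\<bar> < e"
    using e by (auto dest!: tendstoD simp: dist_real_def)
  then obtain k where "\<bar>\<integral>s. (\<Sum>q\<in>P. indicator {q..q+1/real (Suc k)} s) * (indicator {a..b} s * g s) \<partial>lborel\<bar> < e"
    by (auto dest: eventually_happens)
  then show ?thesis
    by (intro that[of "1/real (Suc k)"]) (simp_all add: set_lebesgue_integral_def mult_ac)
qed

text \<open>On a partition interval the left-endpoint value differs from \<open>f s\<close> by at most \<open>\<eta>\<close>, unless a
  point of the finite set \<open>P\<close> of large jumps lies between the left endpoint and \<open>s\<close>. Such \<open>s\<close> lie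
  within the mesh of \<open>P\<close>, where the signal has small integral.\<close>

lemma riemann_stieltjes_drift:
  assumes f: "cadlag_on UNIV f" "set_borel_measurable lborel {0..T} f"
    and S: "set_integrable lborel {0..T} S" and T: "0 \<le> T" and e: "e > 0"
  shows "set_integrable lborel {0..T} (\<lambda>s. f s * S s)"
    and "\<exists>\<delta>>0. \<forall>N p. is_partition T N p \<and> (\<forall>i<N. p (Suc i) - p i < \<delta>) \<longrightarrow>
      \<bar>(\<Sum>i<N. f (p i) * ((LINT s:{0..p (Suc i)}|lborel. S s) - (LINT s:{0..p i}|lborel. S s)))
        - (LINT s:{0..T}|lborel. f s * S s)\<bar> \<le> e"
proof -
  obtain B0 where B0: "\<forall>s\<in>{0..T}. \<bar>f s\<bar> \<le> B0" using cadlag_bounded[OF f(1) T] by auto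
  define B where "B = \<bar>B0\<bar> + 1"
  have B: "\<bar>f s\<bar> \<le> B" if "s \<in> {0..T}" for s using B0 that by (force simp: B_def)
  have Bpos: "B > 0" by (simp add: B_def)
  have Sm: "(\<lambda>s. indicator {0..T} s * S s) \<in> borel_measurable lborel"
    using S by (auto simp: set_integrable_def)
  have fm: "(\<lambda>s. indicator {0..T} s * f s) \<in> borel_measurable lborel"
    using f by (simp add: set_borel_measurable_def)
  have bd_int: "set_integrable lborel {0..T} (\<lambda>s. h s * S s)"
    if h: "(\<lambda>s. indicator {0..T} s * h s) \<in> borel_measurable lborel"
      "\<And>s. s \<in> {0..T} \<Longrightarrow> \<bar>h s\<bar> \<le> C" for h :: "real \<Rightarrow> real" and C
  proof (rule set_integrable_bound)
    show "set_integrable lborel {0..T} (\<lambda>s. C * S s)" using S by simp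
    have "(\<lambda>s. (indicator {0..T} s * h s) * (indicator {0..T} s * S s)) \<in> borel_measurable lborel"
      by (rule borel_measurable_times[OF h(1) Sm])
    moreover have "(\<lambda>s. (indicator {0..T} s * h s) * (indicator {0..T} s * S s)) =
      (\<lambda>s. indicator {0..T} s *\<^sub>R (h s * S s))" by (auto simp: indicator_def)
    ultimately show "set_borel_measurable lborel {0..T} (\<lambda>s. h s * S s)"
      by (simp add: set_borel_measurable_def)
    show "AE x in lborel. x \<in> {0..T} \<longrightarrow> norm (h x * S x) \<le> norm (C * S x)"
    proof (intro AE_I2 impI)
      fix x assume "x \<in> {0..T}"
      then have "\<bar>h x\<bar> \<le> \<bar>C\<bar>" using h(2)[of x] by auto
      then show "norm (h x * S x) \<le> norm (C * S x)" by (simp add: abs_mult mult_right_mono)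
    qed
  qed
  show fS: "set_integrable lborel {0..T} (\<lambda>s. f s * S s)"
    by (rule bd_int[OF fm B])
  define I where "I = (LINT s:{0..T}|lborel. \<bar>S s\<bar>)"
  have I0: "I \<ge> 0" unfolding I_def set_lebesgue_integral_def by (intro integral_nonneg_AE) auto
  define \<eta> where "\<eta> = e / (2 * (I + 1))"
  have \<eta>: "\<eta> > 0" "\<eta> * I \<le> e / 2" using e I0 by (auto simp: \<eta>_def field_simps)
  obtain P where P: "finite P"
    "\<And>u s. 0 \<le> u \<Longrightarrow> u \<le> s \<Longrightarrow> s \<le> T \<Longrightarrow> \<forall>q\<in>P. q \<le> u \<or> s < q \<Longrightarrow> \<bar>f u - f s\<bar> < \<eta>"
    using cadlag_oscillation_partition[OF f(1) T \<eta>(1)] by blast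
  obtain \<delta> where \<delta>: "\<delta> > 0" "\<bar>LINT s:{0..T}|lborel. (\<Sum>q\<in>P. indicator {q..q+\<delta>} s) * \<bar>S s\<bar>\<bar> < e / (4 * B)"
    using set_integral_near_finite_small[OF P(1) set_integrable_abs[OF S], of "e/(4*B)"] e Bpos by auto
  \<comment> \<open>A pointwise bound for the error of the left-endpoint value, for any partition of mesh below \<open>\<delta>\<close>.\<close>
  define w where "w s = \<eta> + 2 * B * (\<Sum>q\<in>P. indicator {q..q+\<delta>} s)" for s
  have ind_int: "set_integrable lborel {0..T} (\<lambda>s. (\<Sum>q\<in>P. indicator {q..q+\<delta>} s) * \<bar>S s\<bar>)"
  proof -
    have "set_integrable lborel {0..T} (\<lambda>s. (\<Sum>q\<in>P. indicator {q..q+\<delta>} s) * S s)"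
    proof (rule bd_int)
      show "\<bar>\<Sum>q\<in>P. indicator {q..q+\<delta>} s\<bar> \<le> (\<Sum>q\<in>P. (1::real))" for s :: real
        by (rule order_trans[OF sum_abs]) (intro sum_mono, simp add: indicator_def)
    qed measurable
    from set_integrable_abs[OF this] show ?thesis
      by (simp add: abs_mult sum_nonneg)
  qed
  have w_int: "set_integrable lborel {0..T} (\<lambda>s. w s * \<bar>S s\<bar>)"
    and w_le: "(LINT s:{0..T}|lborel. w s * \<bar>S s\<bar>) \<le> e"
  proof -
    have eq: "(\<lambda>s. w s * \<bar>S s\<bar>) = (\<lambda>s. \<eta> * \<bar>S s\<bar> + (2 * B) * ((\<Sum>q\<in>P. indicator {q..q+\<delta>} s) * \<bar>S s\<bar>))"
      by (auto simp: w_def algebra_simps)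
    show "set_integrable lborel {0..T} (\<lambda>s. w s * \<bar>S s\<bar>)"
      unfolding eq by (intro set_integral_add(1) set_integrable_mult_right set_integrable_abs S ind_int)
    have "(LINT s:{0..T}|lborel. w s * \<bar>S s\<bar>) = \<eta> * I + 2 * B * (LINT s:{0..T}|lborel. (\<Sum>q\<in>P. indicator {q..q+\<delta>} s) * \<bar>S s\<bar>)"
      unfolding eq I_def
      by (subst set_integral_add(2)) (use S ind_int in \<open>auto intro: set_integrable_abs set_integrable_mult_right\<close>)
    also have "\<dots> \<le> e / 2 + 2 * B * (e / (4 * B))"
      using \<eta> \<delta> Bpos by (intro add_mono mult_left_mono) auto
    also have "\<dots> = e" using Bpos by simp
    finally show "(LINT s:{0..T}|lborel. w s * \<bar>S s\<bar>) \<le> e" .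
  qed
  show "\<exists>\<delta>>0. \<forall>N p. is_partition T N p \<and> (\<forall>i<N. p (Suc i) - p i < \<delta>) \<longrightarrow>
      \<bar>(\<Sum>i<N. f (p i) * ((LINT s:{0..p (Suc i)}|lborel. S s) - (LINT s:{0..p i}|lborel. S s)))
        - (LINT s:{0..T}|lborel. f s * S s)\<bar> \<le> e"
  proof (intro exI[of _ \<delta>] conjI allI impI \<delta>(1))
    fix N p assume *: "is_partition T N p \<and> (\<forall>i<N. p (Suc i) - p i < \<delta>)"
    then have p: "is_partition T N p" and mesh: "\<And>i. i < N \<Longrightarrow> p (Suc i) - p i < \<delta>" by auto
    have step: "\<bar>f (p i) * ((LINT s:{0..p (Suc i)}|lborel. S s) - (LINT s:{0..p i}|lborel. S s))
        - (LINT s:{p i..p (Suc i)}|lborel. f s * S s)\<bar> \<le> (LINT s:{p i..p (Suc i)}|lborel. w s * \<bar>S s\<bar>)"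
      if i: "i < N" for i
    proof -
      have b: "0 \<le> p i" "p i \<le> p (Suc i)" "p (Suc i) \<le> T"
        using partition_bounds[OF p] p i by (auto simp: is_partition_def Suc_le_eq)
      have sub: "set_integrable lborel {p i..p (Suc i)} h" if "set_integrable lborel {0..T} h" for h :: "real \<Rightarrow> real"
        using b by (intro set_integrable_subset[OF that]) auto
      have inc: "(LINT s:{0..p (Suc i)}|lborel. S s) - (LINT s:{0..p i}|lborel. S s) = (LINT s:{p i..p (Suc i)}|lborel. S s)"
        using set_integral_Icc_combine[of 0 "p (Suc i)" S "p i"] b set_integrable_subset[OF S, of "{0..p (Suc i)}"] by auto
      have "f (p i) * (LINT s:{p i..p (Suc i)}|lborel. S s) - (LINT s:{p i..p (Suc i)}|lborel. f s * S s)
        = (LINT s:{p i..p (Suc i)}|lborel. f (p i) * S s - f s * S s)"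
        by (subst set_integral_diff(2)) (use sub[OF S] sub[OF fS] in auto)
      also have "\<bar>\<dots>\<bar> \<le> (LINT s:{p i..p (Suc i)}|lborel. \<bar>f (p i) * S s - f s * S s\<bar>)"
        unfolding set_lebesgue_integral_def
        by (rule order_trans[OF integral_abs_bound]) (simp add: abs_mult)
      also have "\<dots> \<le> (LINT s:{p i..p (Suc i)}|lborel. w s * \<bar>S s\<bar>)"
      proof (rule set_integral_mono)
        show "set_integrable lborel {p i..p (Suc i)} (\<lambda>s. \<bar>f (p i) * S s - f s * S s\<bar>)"
          using sub[OF S] sub[OF fS] by (intro set_integrable_abs set_integral_diff(1)) auto
        show "set_integrable lborel {p i..p (Suc i)} (\<lambda>s. w s * \<bar>S s\<bar>)" by (rule sub[OF w_int])
        fix s assume s: "s \<in> {p i..p (Suc i)}"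
        have "\<bar>f (p i) - f s\<bar> \<le> w s"
        proof (cases "\<forall>q\<in>P. q \<le> p i \<or> s < q")
          case True
          then have "\<bar>f (p i) - f s\<bar> < \<eta>" using P(2)[of "p i" s] s b by simp
          moreover have "0 \<le> 2 * B * (\<Sum>q\<in>P. indicator {q..q+\<delta>} s)" using Bpos by (intro mult_nonneg_nonneg sum_nonneg) auto
          ultimately show ?thesis unfolding w_def by linarith
        next
          case False
          then obtain q where q: "q \<in> P" "p i < q" "q \<le> s" by (auto simp: not_le not_less)
          have "indicator {q..q+\<delta>} s \<le> (\<Sum>q\<in>P. indicator {q..q+\<delta>} s :: real)"
            by (rule member_le_sum) (use q P in auto)
          moreover have "indicator {q..q+\<delta>} s = (1::real)" using q s mesh[OF i] by (auto simp: indicator_def)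
          ultimately have "2 * B * 1 \<le> 2 * B * (\<Sum>q\<in>P. indicator {q..q+\<delta>} s)"
            using Bpos by (intro mult_left_mono) auto
          moreover have "\<bar>f (p i)\<bar> \<le> B" "\<bar>f s\<bar> \<le> B" using B b s by auto
          ultimately show ?thesis unfolding w_def using \<eta>(1) by linarith
        qed
        then show "\<bar>f (p i) * S s - f s * S s\<bar> \<le> w s * \<bar>S s\<bar>"
          by (simp add: left_diff_distrib[symmetric] abs_mult mult_right_mono)
      qed
      finally show ?thesis by (simp add: inc)
    qed
    have "\<bar>(\<Sum>i<N. f (p i) * ((LINT s:{0..p (Suc i)}|lborel. S s) - (LINT s:{0..p i}|lborel. S s)))
        - (LINT s:{0..T}|lborel. f s * S s)\<bar> = \<bar>\<Sum>i<N. f (p i) * ((LINT s:{0..p (Suc i)}|lborel. S s) - (LINT s:{0..p i}|lborel. S s))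
        - (LINT s:{p i..p (Suc i)}|lborel. f s * S s)\<bar>"
      by (simp add: set_integral_partition[OF p fS] sum_subtractf)
    also have "\<dots> \<le> (\<Sum>i<N. LINT s:{p i..p (Suc i)}|lborel. w s * \<bar>S s\<bar>)"
      using step by (intro order_trans[OF sum_abs] sum_mono) auto
    also have "\<dots> = (LINT s:{0..T}|lborel. w s * \<bar>S s\<bar>)"
      by (rule set_integral_partition[OF p w_int, symmetric])
    finally show "\<bar>(\<Sum>i<N. f (p i) * ((LINT s:{0..p (Suc i)}|lborel. S s) - (LINT s:{0..p i}|lborel. S s)))
        - (LINT s:{0..T}|lborel. f s * S s)\<bar> \<le> e"
      using w_le by linarith
  qed
qed

lemma is_stoch_integralD:
  assumes "is_stoch_integral M T X f I" "e > 0"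
  shows "\<exists>\<delta>>0. \<forall>N p. is_partition T N p \<longrightarrow> (\<forall>i<N. p (Suc i) - p i < \<delta>) \<longrightarrow>
    measure M {\<omega> \<in> space M. e < \<bar>(\<Sum>i<N. f (p i) * (X (p (Suc i)) \<omega> - X (p i) \<omega>)) - I \<omega>\<bar>} < e"
  using assms unfolding is_stoch_integral_def imp_conjL[symmetric] by blast

lemma is_stoch_integral_observation:
  assumes M: "prob_space M" and \<xi>: "\<And>t. t \<in> {0..T} \<Longrightarrow> \<xi> t \<in> borel_measurable M"
    and f: "cadlag_on UNIV f" "set_borel_measurable lborel {0..T} f"
    and S: "set_integrable lborel {0..T} S" and T: "0 \<le> T"
    and I: "is_stoch_integral M T \<xi> f I"
  shows "is_stoch_integral M T (observation S \<xi>) f (\<lambda>\<omega>. (LINT s:{0..T}|lborel. f s * S s) + I \<omega>)"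
  unfolding is_stoch_integral_def
proof (intro conjI allI impI)
  interpret prob_space M by fact
  have [measurable]: "I \<in> borel_measurable M" using I by (simp add: is_stoch_integral_def)
  show "(\<lambda>\<omega>. (LINT s:{0..T}|lborel. f s * S s) + I \<omega>) \<in> borel_measurable M" by measurable
  fix e :: real assume e: "e > 0"
  have e2: "e / 2 > 0" using e by simp
  from riemann_stieltjes_drift(2)[OF f S T e2] obtain d1 where d1: "d1 > 0 \<and> (\<forall>N p. is_partition T N p \<and> (\<forall>i<N. p (Suc i) - p i < d1) \<longrightarrow>
      \<bar>(\<Sum>i<N. f (p i) * ((LINT s:{0..p (Suc i)}|lborel. S s) - (LINT s:{0..p i}|lborel. S s)))
        - (LINT s:{0..T}|lborel. f s * S s)\<bar> \<le> e/2)" ..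
  note d1 = d1[THEN conjunct1] d1[THEN conjunct2, rule_format]
    from is_stoch_integralD[OF I e2] obtain d2 where d2: "d2 > 0 \<and> (\<forall>N p. is_partition T N p \<longrightarrow> (\<forall>i<N. p (Suc i) - p i < d2) \<longrightarrow>
      measure M {\<omega> \<in> space M. e/2 < \<bar>(\<Sum>i<N. f (p i) * (\<xi> (p (Suc i)) \<omega> - \<xi> (p i) \<omega>)) - I \<omega>\<bar>} < e/2)" ..
    note d2 = d2[THEN conjunct1] d2[THEN conjunct2, rule_format]
  show "\<exists>\<delta>>0. \<forall>N p. is_partition T N p \<and> (\<forall>i<N. p (Suc i) - p i < \<delta>) \<longrightarrow>
        measure M {\<omega> \<in> space M.
          e < \<bar>(\<Sum>i<N. f (p i) * (observation S \<xi> (p (Suc i)) \<omega> - observation S \<xi> (p i) \<omega>)) - ((LINT s:{0..T}|lborel. f s * S s) + I \<omega>)\<bar>} < e"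
  proof (intro exI[of _ "min d1 d2"] conjI allI impI)
    show "0 < min d1 d2" using d1 d2 by simp
    fix N p assume p: "is_partition T N p \<and> (\<forall>i<N. p (Suc i) - p i < min d1 d2)"
    have [measurable]: "\<xi> (p i) \<in> borel_measurable M" if "i \<le> N" for i
      using partition_bounds[of T N p i] p that by (intro \<xi>) auto
    have [measurable]: "(\<lambda>\<omega>. (\<Sum>i<N. f (p i) * (\<xi> (p (Suc i)) \<omega> - \<xi> (p i) \<omega>)) - I \<omega>) \<in> borel_measurable M"
      by (intro borel_measurable_diff borel_measurable_sum borel_measurable_times) auto
    have "measure M {\<omega> \<in> space M.
          e < \<bar>(\<Sum>i<N. f (p i) * (observation S \<xi> (p (Suc i)) \<omega> - observation S \<xi> (p i) \<omega>)) - ((LINT s:{0..T}|lborel. f s * S s) + I \<omega>)\<bar>}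
      \<le> measure M {\<omega> \<in> space M. e/2 < \<bar>(\<Sum>i<N. f (p i) * (\<xi> (p (Suc i)) \<omega> - \<xi> (p i) \<omega>)) - I \<omega>\<bar>}"
    proof (rule finite_measure_mono)
      show "{\<omega> \<in> space M. e/2 < \<bar>(\<Sum>i<N. f (p i) * (\<xi> (p (Suc i)) \<omega> - \<xi> (p i) \<omega>)) - I \<omega>\<bar>} \<in> sets M"
        by measurable
      have split: "(\<Sum>i<N. f (p i) * (observation S \<xi> (p (Suc i)) \<omega> - observation S \<xi> (p i) \<omega>))
        = (\<Sum>i<N. f (p i) * ((LINT s:{0..p (Suc i)}|lborel. S s) - (LINT s:{0..p i}|lborel. S s)))
        + (\<Sum>i<N. f (p i) * (\<xi> (p (Suc i)) \<omega> - \<xi> (p i) \<omega>))" for \<omega>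
        unfolding observation_def sum.distrib[symmetric] by (intro sum.cong) (auto simp: algebra_simps)
      show "{\<omega> \<in> space M.
          e < \<bar>(\<Sum>i<N. f (p i) * (observation S \<xi> (p (Suc i)) \<omega> - observation S \<xi> (p i) \<omega>)) - ((LINT s:{0..T}|lborel. f s * S s) + I \<omega>)\<bar>}
        \<subseteq> {\<omega> \<in> space M. e/2 < \<bar>(\<Sum>i<N. f (p i) * (\<xi> (p (Suc i)) \<omega> - \<xi> (p i) \<omega>)) - I \<omega>\<bar>}"
      proof (intro subsetI CollectI conjI; elim CollectE conjE)
        have d1': "\<bar>(\<Sum>i<N. f (p i) * ((LINT s:{0..p (Suc i)}|lborel. S s) - (LINT s:{0..p i}|lborel. S s)))
          - (LINT s:{0..T}|lborel. f s * S s)\<bar> \<le> e/2"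
          using d1(2)[of N p] p by simp
        fix \<omega> assume "e < \<bar>(\<Sum>i<N. f (p i) * (observation S \<xi> (p (Suc i)) \<omega> - observation S \<xi> (p i) \<omega>)) - ((LINT s:{0..T}|lborel. f s * S s) + I \<omega>)\<bar>"
        then show "e/2 < \<bar>(\<Sum>i<N. f (p i) * (\<xi> (p (Suc i)) \<omega> - \<xi> (p i) \<omega>)) - I \<omega>\<bar>"
          using d1' unfolding split by linarith
      qed
    qed
    also have "\<dots> < e/2" using d2(2)[of N p] p by simp
    finally show "measure M {\<omega> \<in> space M.
          e < \<bar>(\<Sum>i<N. f (p i) * (observation S \<xi> (p (Suc i)) \<omega> - observation S \<xi> (p i) \<omega>)) - ((LINT s:{0..T}|lborel. f s * S s) + I \<omega>)\<bar>} < e"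
      using e by linarith
  qed
qed

text \<open>Riemann sums along one sufficiently fine partition are close in probability to both limits.\<close>

lemma is_stoch_integral_unique:
  assumes M: "prob_space M" and X: "\<And>t. t \<in> {0..T} \<Longrightarrow> X t \<in> borel_measurable M"
    and T: "0 \<le> T"
    and I: "is_stoch_integral M T X f I" and I': "is_stoch_integral M T X f I'"
  shows "AE \<omega> in M. I \<omega> = I' \<omega>"
proof -
  interpret prob_space M by fact
  have [measurable]: "I \<in> borel_measurable M" "I' \<in> borel_measurable M"
    using I I' by (auto simp: is_stoch_integral_def)
  have small: "measure M {\<omega> \<in> space M. 2 * e < \<bar>I \<omega> - I' \<omega>\<bar>} \<le> 2 * e" if e: "e > 0" for e
  proof -
    define R where "R N p \<omega> = (\<Sum>i<N. f (p i) * (X (p (Suc i)) \<omega> - X (p i) \<omega>))" for N :: nat and p \<omega>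
    from is_stoch_integralD[OF I e, folded R_def] obtain d1 where d1: "d1 > 0 \<and> (\<forall>N p. is_partition T N p \<longrightarrow> (\<forall>i<N. p (Suc i) - p i < d1) \<longrightarrow>
      measure M {\<omega> \<in> space M. e < \<bar>R N p \<omega> - I \<omega>\<bar>} < e)" ..
    note d1 = d1[THEN conjunct1] d1[THEN conjunct2, rule_format]
    from is_stoch_integralD[OF I' e, folded R_def] obtain d2 where d2: "d2 > 0 \<and> (\<forall>N p. is_partition T N p \<longrightarrow> (\<forall>i<N. p (Suc i) - p i < d2) \<longrightarrow>
      measure M {\<omega> \<in> space M. e < \<bar>R N p \<omega> - I' \<omega>\<bar>} < e)" ..
    note d2 = d2[THEN conjunct1] d2[THEN conjunct2, rule_format]
    \<comment> \<open>The uniform partition into \<open>N\<close> intervals is fine enough for both limits.\<close>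
    obtain N :: nat where N: "T / min d1 d2 < real N" using reals_Archimedean2 by blast
    have N0: "N > 0" using N T d1 d2 by (metis divide_nonneg_pos gr0I min_less_iff_conj not_less of_nat_0)
    define p where "p i = T * real i / real N" for i
    have p: "is_partition T N p" 
      using T N0 by (auto simp: is_partition_def p_def divide_right_mono mult_left_mono)
    have mesh: "p (Suc i) - p i < min d1 d2" for i
    proof -
      have eq: "p (Suc i) - p i = T / real N" by (simp add: p_def add_divide_distrib distrib_left)
      have scale: "T / real N < m" if "T / m < real N" "m > 0" for m
        using that N0 by (simp add: pos_divide_less_eq mult.commute)
      have "T / real N < min d1 d2" by (rule scale[OF N]) (use d1(1) d2(1) in simp)
      with eq show ?thesis by simp
    qed
    have [measurable]: "X (p i) \<in> borel_measurable M" if "i \<le> N" for i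
      using partition_bounds[OF p that] by (intro X) auto
    have [measurable]: "R N p \<in> borel_measurable M" unfolding R_def
      by (intro borel_measurable_diff borel_measurable_sum borel_measurable_times) auto
    have "measure M {\<omega> \<in> space M. 2 * e < \<bar>I \<omega> - I' \<omega>\<bar>}
      \<le> measure M ({\<omega> \<in> space M. e < \<bar>R N p \<omega> - I \<omega>\<bar>} \<union> {\<omega> \<in> space M. e < \<bar>R N p \<omega> - I' \<omega>\<bar>})"
      by (intro finite_measure_mono) (auto, measurable)
    also have "\<dots> \<le> measure M {\<omega> \<in> space M. e < \<bar>R N p \<omega> - I \<omega>\<bar>} + measure M {\<omega> \<in> space M. e < \<bar>R N p \<omega> - I' \<omega>\<bar>}"
      by (intro measure_Un_le) measurable
    also have "\<dots> \<le> 2 * e" using d1(2)[OF p] d2(2)[OF p] mesh by simp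
    finally show ?thesis .
  qed
  have zero: "measure M {\<omega> \<in> space M. 1 / real (Suc k) < \<bar>I \<omega> - I' \<omega>\<bar>} = 0" for k
  proof -
    have "measure M {\<omega> \<in> space M. 1 / real (Suc k) < \<bar>I \<omega> - I' \<omega>\<bar>} \<le> 0 + e" if "e > 0" for e
    proof -
      let ?e = "min e (1 / real (Suc k)) / 2"
      have "measure M {\<omega> \<in> space M. 1 / real (Suc k) < \<bar>I \<omega> - I' \<omega>\<bar>} \<le> measure M {\<omega> \<in> space M. 2 * ?e < \<bar>I \<omega> - I' \<omega>\<bar>}"
        by (intro finite_measure_mono) (auto, measurable)
      also have "\<dots> \<le> 2 * ?e" using that by (intro small) auto
      finally show ?thesis by auto
    qed
    then have "measure M {\<omega> \<in> space M. 1 / real (Suc k) < \<bar>I \<omega> - I' \<omega>\<bar>} \<le> 0" by (rule field_le_epsilon)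
    then show ?thesis by (simp add: measure_le_0_iff)
  qed
  have "AE \<omega> in M. \<forall>k. \<not> (1 / real (Suc k) < \<bar>I \<omega> - I' \<omega>\<bar>)"
  proof (subst AE_all_countable, intro allI)
    fix k
    show "AE \<omega> in M. \<not> (1 / real (Suc k) < \<bar>I \<omega> - I' \<omega>\<bar>)"
      using zero[of k] by (subst (asm) prob_eq_0) auto
  qed
  then show ?thesis
  proof eventually_elim
    case (elim \<omega>)
    show ?case
    proof (rule ccontr)
      assume "I \<omega> \<noteq> I' \<omega>"
      then obtain k where "inverse (real (Suc k)) < \<bar>I \<omega> - I' \<omega>\<bar>"
        using reals_Archimedean[of "\<bar>I \<omega> - I' \<omega>\<bar>"] by auto
      then show False using elim by (auto simp: inverse_eq_divide)
    qed
  qed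
qed

section \<open>Empirical Fourier coefficients\<close>

lemma cadlag_on_subset:
  assumes "cadlag_on UNIV f" shows "cadlag_on A f"
  unfolding cadlag_on_def
proof (intro ballI conjI)
  fix t
  have r: "(f \<longlongrightarrow> f t) (at t within UNIV \<inter> {t<..})" and l: "\<exists>l. (f \<longlongrightarrow> l) (at t within UNIV \<inter> {..<t})"
    using assms unfolding cadlag_on_def by blast+
  show "(f \<longlongrightarrow> f t) (at t within A \<inter> {t<..})"
    by (rule tendsto_within_subset[OF r]) blast
  from l obtain y where y: "(f \<longlongrightarrow> y) (at t within UNIV \<inter> {..<t})" ..
  have "(f \<longlongrightarrow> y) (at t within A \<inter> {..<t})"
    by (rule tendsto_within_subset[OF y]) blast
  then show "\<exists>l. (f \<longlongrightarrow> l) (at t within A \<inter> {..<t})" ..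
qed

lemma periodic1_shift:
  assumes "periodic1 f"
  shows "f (t + real_of_int k) = f t"
proof (induction k rule: int_induct[where k=0])
  case (step1 i)
  have "f (t + real_of_int (i + 1)) = f ((t + real_of_int i) + 1)" by (simp add: add.assoc)
  also have "\<dots> = f t" using assms step1 by (simp add: periodic1_def)
  finally show ?case .
next
  case (step2 i)
  have "f (t + real_of_int (i - 1)) = f ((t + real_of_int (i - 1)) + 1)"
    by (rule assms[unfolded periodic1_def, rule_format, symmetric])
  also have "\<dots> = f (t + real_of_int i)" by (simp add: algebra_simps)
  finally show ?case using step2 by simp
qed simp

text \<open>The value at \<open>x\<close> is the value at the fractional part of \<open>x\<close>, and the floor is measurable.\<close>

lemma periodic1_borel_measurable:
  assumes f: "periodic1 f" and m: "set_borel_measurable lborel {0..1} f"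
  shows "f \<in> borel_measurable borel"
proof -
  define g where "g x = indicator {0..1} x * f x" for x
  have "g = (\<lambda>x. indicator {0..1} x * f x)" by (simp add: g_def fun_eq_iff)
  then have [measurable]: "g \<in> borel_measurable borel" using m by (simp add: set_borel_measurable_def)
  have "f x = g (x - real_of_int \<lfloor>x\<rfloor>)" for x
  proof -
    have "x - real_of_int \<lfloor>x\<rfloor> \<in> {0..1}" by (simp, linarith)
    moreover have "f (x - real_of_int \<lfloor>x\<rfloor>) = f x" using periodic1_shift[OF f, of x "- \<lfloor>x\<rfloor>"] by simp
    ultimately show ?thesis by (simp add: g_def)
  qed
  moreover have "(\<lambda>x. g (x - real_of_int \<lfloor>x\<rfloor>)) \<in> borel_measurable borel" by measurable
  ultimately show ?thesis by (simp cong: measurable_cong)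
qed

lemma periodic1_set_integral:
  fixes g :: "real \<Rightarrow> real"
  assumes g: "periodic1 g" and i: "set_integrable lborel {0..1} g"
  shows "set_integrable lborel {0..real n} g \<and> (LINT s:{0..real n}|lborel. g s) = real n * (LINT s:{0..1}|lborel. g s)"
proof (induction n)
  case 0
  have "AE x in lborel. indicator {0..0::real} x *\<^sub>R g x = 0"
    using AE_lborel_singleton[of 0] by eventually_elim (simp add: indicator_def)
  moreover have "g \<in> borel_measurable borel"
    using i by (intro periodic1_borel_measurable[OF g]) (simp add: set_borel_measurable_def set_integrable_def)
  ultimately show ?case
    unfolding set_integrable_def set_lebesgue_integral_def
    by (simp add: integral_eq_zero_AE integrable_cong_AE[where g="\<lambda>_. 0"])
next
  case (Suc n)
  have sh: "(\<lambda>x. indicator {0..1} (- real n + 1 * x) *\<^sub>R g (- real n + 1 * x)) = (\<lambda>x. indicator {real n..real (Suc n)} x *\<^sub>R g x)"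
  proof
    fix x
    have "g (- real n + 1 * x) = g x" using periodic1_shift[OF g, of x "- int n"] by simp
    then show "indicator {0..1} (- real n + 1 * x) *\<^sub>R g (- real n + 1 * x) = indicator {real n..real (Suc n)} x *\<^sub>R g x"
      by (auto simp: indicator_def)
  qed
  have last: "set_integrable lborel {real n..real (Suc n)} g"
    using lborel_integrable_real_affine[of "\<lambda>x. indicator {0..1} x *\<^sub>R g x" 1 "- real n"] i
    unfolding sh set_integrable_def by simp
  have last_eq: "(LINT s:{real n..real (Suc n)}|lborel. g s) = (LINT s:{0..1}|lborel. g s)"
    using lborel_integral_real_affine[of 1 "\<lambda>x. indicator {0..1} x *\<^sub>R g x" "- real n"]
    unfolding sh set_lebesgue_integral_def by simp
  have un: "{0..real (Suc n)} = {0..real n} \<union> {real n..real (Suc n)}" by auto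
  have all: "set_integrable lborel {0..real (Suc n)} g"
    unfolding un using Suc last by (intro set_integrable_Un) auto
  have "(LINT s:{0..real (Suc n)}|lborel. g s) = (LINT s:{0..real n}|lborel. g s) + (LINT s:{real n..real (Suc n)}|lborel. g s)"
    by (rule set_integral_Icc_combine[OF all]) auto
  then show ?case using all Suc last_eq by (simp add: distrib_right)
qed

lemma set_integrable_mult_L2:
  fixes f g :: "real \<Rightarrow> real"
  assumes f: "L2_fun a b f" and g: "L2_fun a b g"
  shows "set_integrable lborel {a..b} (\<lambda>t. f t * g t)"
proof -
  have sq: "integrable lborel (\<lambda>t. (indicator {a..b} t *\<^sub>R h t)\<^sup>2)" if "L2_fun a b h" for h :: "real \<Rightarrow> real"
  proof -
    have "(\<lambda>t. (indicator {a..b} t *\<^sub>R h t)\<^sup>2) = (\<lambda>t. indicator {a..b} t *\<^sub>R (h t)\<^sup>2)"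
      by (auto simp: indicator_def)
    then show ?thesis using that by (simp add: L2_fun_def set_integrable_def)
  qed
  have "integrable lborel (\<lambda>t. (indicator {a..b} t *\<^sub>R f t) * (indicator {a..b} t *\<^sub>R g t))"
    using f g sq[OF f] sq[OF g] by (intro integrable_power2_add(2)) (auto simp: L2_fun_def set_borel_measurable_def)
  moreover have "(\<lambda>t. (indicator {a..b} t *\<^sub>R f t) * (indicator {a..b} t *\<^sub>R g t)) = (\<lambda>t. indicator {a..b} t *\<^sub>R (f t * g t))"
    by (auto simp: indicator_def)
  ultimately show ?thesis by (simp add: set_integrable_def)
qed

lemma orthonormal_basis_facts:
  assumes b: "orthonormal_basis \<phi>" and j: "1 \<le> j"
  shows "cadlag_on UNIV (\<phi> j)" "periodic1 (\<phi> j)" "L2_fun 0 1 (\<phi> j)" "\<phi> j \<in> borel_measurable borel"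
    "L2_fun 0 (real n) (\<phi> j)" "(LINT s:{0..real n}|lborel. (\<phi> j s)\<^sup>2) = real n"
proof -
  show 1: "cadlag_on UNIV (\<phi> j)" "periodic1 (\<phi> j)" "L2_fun 0 1 (\<phi> j)"
    using b j by (simp_all add: orthonormal_basis_def)
  show m: "\<phi> j \<in> borel_measurable borel"
    using 1 by (intro periodic1_borel_measurable) (simp_all add: L2_fun_def)
  have p2: "periodic1 (\<lambda>t. (\<phi> j t)\<^sup>2)" using 1 by (simp add: periodic1_def)
  have i2: "set_integrable lborel {0..1} (\<lambda>t. (\<phi> j t)\<^sup>2)" using 1 by (simp add: L2_fun_def)
  show "L2_fun 0 (real n) (\<phi> j)"
    using periodic1_set_integral[OF p2 i2, of n] m by (simp add: L2_fun_def set_borel_measurable_def)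
  have "L2_inner (\<phi> j) (\<phi> j) = 1" using b j by (simp add: orthonormal_basis_def)
  then have "(LINT s:{0..1}|lborel. (\<phi> j s)\<^sup>2) = 1" by (simp add: L2_inner_def power2_eq_square)
  then show "(LINT s:{0..real n}|lborel. (\<phi> j s)\<^sup>2) = real n"
    using periodic1_set_integral[OF p2 i2, of n] by simp
qed

text \<open>Parseval's computation for a finite linear combination of the basis functions.\<close>

lemma L2_norm_expansion:
  assumes b: "orthonormal_basis \<phi>" and S: "L2_fun 0 1 S"
  shows "(L2_norm (\<lambda>t. (\<Sum>j=1..N. a j * \<phi> j t) - S t))\<^sup>2 =
    (\<Sum>j=1..N. (a j)\<^sup>2 - 2 * a j * L2_inner S (\<phi> j)) + (L2_norm S)\<^sup>2"
proof -
  define p where "p j t = indicator {0..1::real} t * \<phi> j t" for j t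
  define s where "s t = indicator {0..1::real} t * S t" for t
  have L2: "L2_fun 0 1 (\<phi> j)" if "j \<in> {1..N}" for j using orthonormal_basis_facts(3)[OF b] that by simp
  have pp: "integrable lborel (\<lambda>t. p i t * p j t)" "(\<integral>t. p i t * p j t \<partial>lborel) = (if i = j then 1 else 0)"
    if "i \<in> {1..N}" "j \<in> {1..N}" for i j
  proof -
    have eq: "(\<lambda>t. p i t * p j t) = (\<lambda>t. indicator {0..1} t *\<^sub>R (\<phi> i t * \<phi> j t))"
      by (auto simp: p_def indicator_def)
    show "integrable lborel (\<lambda>t. p i t * p j t)"
      unfolding eq using set_integrable_mult_L2[OF L2 L2, OF that] by (simp add: set_integrable_def)
    have "L2_inner (\<phi> i) (\<phi> j) = (if i = j then 1 else 0)"
      using b that by (simp add: orthonormal_basis_def)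
    then show "(\<integral>t. p i t * p j t \<partial>lborel) = (if i = j then 1 else 0)"
      unfolding eq by (simp add: L2_inner_def set_lebesgue_integral_def)
  qed
  have sp: "integrable lborel (\<lambda>t. s t * p j t)" "(\<integral>t. s t * p j t \<partial>lborel) = L2_inner S (\<phi> j)"
    if "j \<in> {1..N}" for j
  proof -
    have eq: "(\<lambda>t. s t * p j t) = (\<lambda>t. indicator {0..1} t *\<^sub>R (S t * \<phi> j t))"
      by (auto simp: p_def s_def indicator_def)
    show "integrable lborel (\<lambda>t. s t * p j t)"
      unfolding eq using set_integrable_mult_L2[OF S L2, OF that] by (simp add: set_integrable_def)
    show "(\<integral>t. s t * p j t \<partial>lborel) = L2_inner S (\<phi> j)"
      unfolding eq by (simp add: L2_inner_def set_lebesgue_integral_def)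
  qed
  have eqs: "(\<lambda>t. (s t)\<^sup>2) = (\<lambda>t. indicator {0..1} t *\<^sub>R (S t)\<^sup>2)"
    by (auto simp: s_def indicator_def)
  have ss: "integrable lborel (\<lambda>t. (s t)\<^sup>2)"
    unfolding eqs using S by (simp add: L2_fun_def set_integrable_def)
  have nn: "0 \<le> (LINT t:{0..1}|lborel. (h t)\<^sup>2)" for h :: "real \<Rightarrow> real"
    unfolding set_lebesgue_integral_def by (intro integral_nonneg_AE AE_I2) simp
  have sS: "(\<integral>t. (s t)\<^sup>2 \<partial>lborel) = (L2_norm S)\<^sup>2"
  proof -
    have "(L2_norm S)\<^sup>2 = (LINT t:{0..1}|lborel. (S t)\<^sup>2)"
      unfolding L2_norm_def by (rule real_sqrt_pow2[OF nn])
    then show ?thesis by (simp only: eqs set_lebesgue_integral_def)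
  qed
  have "(\<lambda>t. indicator {0..1} t *\<^sub>R ((\<Sum>j=1..N. a j * \<phi> j t) - S t)\<^sup>2) =
      (\<lambda>t. ((\<Sum>j=1..N. a j * p j t) - s t)\<^sup>2)"
    by (auto simp: p_def s_def indicator_def)
  also have "\<dots> = (\<lambda>t. (\<Sum>i=1..N. \<Sum>j=1..N. a i * a j * (p i t * p j t)) - (\<Sum>j=1..N. 2 * a j * (s t * p j t)) + (s t)\<^sup>2)"
  proof
    fix t
    have "((\<Sum>j=1..N. a j * p j t) - s t)\<^sup>2 = (\<Sum>j=1..N. a j * p j t) * (\<Sum>j=1..N. a j * p j t)
        - 2 * s t * (\<Sum>j=1..N. a j * p j t) + (s t)\<^sup>2"
      by (simp add: power2_eq_square algebra_simps)
    also have "(\<Sum>j=1..N. a j * p j t) * (\<Sum>j=1..N. a j * p j t) = (\<Sum>i=1..N. \<Sum>j=1..N. a i * a j * (p i t * p j t))"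
      by (simp add: sum_product mult_ac)
    also have "2 * s t * (\<Sum>j=1..N. a j * p j t) = (\<Sum>j=1..N. 2 * a j * (s t * p j t))"
      by (simp add: sum_distrib_left mult_ac)
    finally show "((\<Sum>j=1..N. a j * p j t) - s t)\<^sup>2 = (\<Sum>i=1..N. \<Sum>j=1..N. a i * a j * (p i t * p j t)) - (\<Sum>j=1..N. 2 * a j * (s t * p j t)) + (s t)\<^sup>2" .
  qed
  finally have expand: "(\<lambda>t. indicator {0..1} t *\<^sub>R ((\<Sum>j=1..N. a j * \<phi> j t) - S t)\<^sup>2) =
    (\<lambda>t. (\<Sum>i=1..N. \<Sum>j=1..N. a i * a j * (p i t * p j t)) - (\<Sum>j=1..N. 2 * a j * (s t * p j t)) + (s t)\<^sup>2)" .
  have i1: "integrable lborel (\<lambda>t. \<Sum>i=1..N. \<Sum>j=1..N. a i * a j * (p i t * p j t))"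
    by (intro Bochner_Integration.integrable_sum integrable_mult_right pp)
  have i2: "integrable lborel (\<lambda>t. \<Sum>j=1..N. 2 * a j * (s t * p j t))"
    by (intro Bochner_Integration.integrable_sum integrable_mult_right sp)
  have v1: "(\<integral>t. (\<Sum>i=1..N. \<Sum>j=1..N. a i * a j * (p i t * p j t)) \<partial>lborel) = (\<Sum>j=1..N. (a j)\<^sup>2)"
  proof -
    have "(\<integral>t. (\<Sum>i=1..N. \<Sum>j=1..N. a i * a j * (p i t * p j t)) \<partial>lborel) =
      (\<Sum>i=1..N. \<integral>t. (\<Sum>j=1..N. a i * a j * (p i t * p j t)) \<partial>lborel)"
      by (rule Bochner_Integration.integral_sum) (intro Bochner_Integration.integrable_sum integrable_mult_right pp)
    also have "\<dots> = (\<Sum>i=1..N. \<Sum>j=1..N. \<integral>t. a i * a j * (p i t * p j t) \<partial>lborel)"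
      by (intro sum.cong refl Bochner_Integration.integral_sum integrable_mult_right pp)
    also have "\<dots> = (\<Sum>i=1..N. \<Sum>j=1..N. if i = j then a i * a j else 0)"
      by (intro sum.cong refl) (simp add: pp)
    also have "\<dots> = (\<Sum>i=1..N. (a i)\<^sup>2)"
      by (intro sum.cong refl) (simp add: power2_eq_square)
    finally show ?thesis .
  qed
  have v2: "(\<integral>t. (\<Sum>j=1..N. 2 * a j * (s t * p j t)) \<partial>lborel) = (\<Sum>j=1..N. 2 * a j * L2_inner S (\<phi> j))"
  proof -
    have "(\<integral>t. (\<Sum>j=1..N. 2 * a j * (s t * p j t)) \<partial>lborel) = (\<Sum>j=1..N. \<integral>t. 2 * a j * (s t * p j t) \<partial>lborel)"
      by (intro Bochner_Integration.integral_sum integrable_mult_right sp)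
    also have "\<dots> = (\<Sum>j=1..N. 2 * a j * L2_inner S (\<phi> j))"
      by (intro sum.cong refl) (simp add: sp)
    finally show ?thesis .
  qed
  have "(L2_norm (\<lambda>t. (\<Sum>j=1..N. a j * \<phi> j t) - S t))\<^sup>2 = (LINT t:{0..1}|lborel. ((\<Sum>j=1..N. a j * \<phi> j t) - S t)\<^sup>2)"
    unfolding L2_norm_def by (rule real_sqrt_pow2[OF nn])
  also have "\<dots> = (\<integral>t. (\<Sum>i=1..N. \<Sum>j=1..N. a i * a j * (p i t * p j t)) - (\<Sum>j=1..N. 2 * a j * (s t * p j t)) + (s t)\<^sup>2 \<partial>lborel)"
    unfolding set_lebesgue_integral_def expand ..
  also have "\<dots> = (\<Sum>j=1..N. (a j)\<^sup>2) - (\<Sum>j=1..N. 2 * a j * L2_inner S (\<phi> j)) + (L2_norm S)\<^sup>2"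
    using i1 i2 ss by (simp only: Bochner_Integration.integral_add Bochner_Integration.integral_diff Bochner_Integration.integrable_diff v1 v2 sS)
  finally show ?thesis by (simp only: sum_subtractf)
qed

lemma bessel_inequality:
  assumes b: "orthonormal_basis \<phi>" and S: "L2_fun 0 1 S"
  shows "(\<Sum>j=1..N. (L2_inner S (\<phi> j))\<^sup>2) \<le> (L2_norm S)\<^sup>2"
proof -
  have "0 \<le> (L2_norm (\<lambda>t. (\<Sum>j=1..N. L2_inner S (\<phi> j) * \<phi> j t) - S t))\<^sup>2" by simp
  also have "\<dots> = (\<Sum>j=1..N. - (L2_inner S (\<phi> j))\<^sup>2) + (L2_norm S)\<^sup>2"
    unfolding L2_norm_expansion[OF b S] by (simp add: power2_eq_square)
  finally show ?thesis by (simp add: sum_negf)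
qed

lemma is_stoch_integral_stoch_integral:
  assumes "is_stoch_integral M T X f I"
  shows "is_stoch_integral M T X f (stoch_integral M T X f)"
  unfolding stoch_integral_def using assms by (rule someI[of "is_stoch_integral M T X f"])

lemma noise_model_facts:
  assumes nm: "noise_model n Q M \<xi> k"
  shows "prob_space M" "t \<in> {0..real n} \<Longrightarrow> \<xi> t \<in> borel_measurable M" "0 < k"
proof -
  show "prob_space M" "0 < k" using nm by (simp_all add: noise_model_def)
  have "(\<lambda>\<omega>. \<lambda>t\<in>{0..real n}. \<xi> t \<omega>) \<in> M \<rightarrow>\<^sub>M skorokhod_space (real n)"
    using nm by (simp add: noise_model_def)
  then have path: "(\<lambda>\<omega>. \<lambda>t\<in>{0..real n}. \<xi> t \<omega>) \<in> M \<rightarrow>\<^sub>M (\<Pi>\<^sub>M t\<in>{0..real n}. borel)"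
    unfolding skorokhod_space_def measurable_restrict_space2_iff by blast
  show "\<xi> t \<in> borel_measurable M" if t: "t \<in> {0..real n}"
  proof -
    have "(\<lambda>\<omega>. (\<lambda>t\<in>{0..real n}. \<xi> t \<omega>) t) \<in> borel_measurable M"
      by (rule measurable_compose[OF path measurable_component_singleton[OF t]])
    then show ?thesis unfolding restrict_apply if_P[OF t] .
  qed
qed

lemma noise_coefficients:
  assumes nm: "noise_model n Q M \<xi> k" and b: "orthonormal_basis \<phi>" and j: "1 \<le> j" and n: "1 \<le> n"
  shows "xi_coef n M \<phi> \<xi> j \<in> borel_measurable M" "integrable M (xi_coef n M \<phi> \<xi> j)"
    "integrable M (\<lambda>\<omega>. (xi_coef n M \<phi> \<xi> j \<omega>)\<^sup>2)"
    "(\<integral>\<omega>. xi_coef n M \<phi> \<xi> j \<omega> \<partial>M) = 0" "(\<integral>\<omega>. (xi_coef n M \<phi> \<xi> j \<omega>)\<^sup>2 \<partial>M) \<le> k"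
proof -
  let ?I = "stoch_integral M (real n) \<xi> (\<phi> j)"
  have "cadlag_on {0..real n} (\<phi> j) \<and> L2_fun 0 (real n) (\<phi> j)"
    using orthonormal_basis_facts(1,5)[OF b j] cadlag_on_subset by blast
  with nm have I: "\<exists>I. is_stoch_integral M (real n) \<xi> (\<phi> j) I" "integrable M ?I"
    "integrable M (\<lambda>\<omega>. (?I \<omega>)\<^sup>2)" "(\<integral>\<omega>. ?I \<omega> \<partial>M) = 0"
    "(\<integral>\<omega>. (?I \<omega>)\<^sup>2 \<partial>M) \<le> k * (LINT s:{0..real n}|lborel. (\<phi> j s)\<^sup>2)"
    unfolding noise_model_def by blast+
  have sq: "(\<lambda>\<omega>. (xi_coef n M \<phi> \<xi> j \<omega>)\<^sup>2) = (\<lambda>\<omega>. (?I \<omega>)\<^sup>2 / real n)"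
    by (simp add: xi_coef_def power_divide)
  have eq: "xi_coef n M \<phi> \<xi> j = (\<lambda>\<omega>. ?I \<omega> / sqrt (real n))" by (simp add: xi_coef_def fun_eq_iff)
  show i: "integrable M (xi_coef n M \<phi> \<xi> j)" unfolding eq using I(2) by simp
  then show "xi_coef n M \<phi> \<xi> j \<in> borel_measurable M" by simp
  show "integrable M (\<lambda>\<omega>. (xi_coef n M \<phi> \<xi> j \<omega>)\<^sup>2)" unfolding sq using I(3) by simp
  show "(\<integral>\<omega>. xi_coef n M \<phi> \<xi> j \<omega> \<partial>M) = 0" unfolding eq using I(4) by simp
  show "(\<integral>\<omega>. (xi_coef n M \<phi> \<xi> j \<omega>)\<^sup>2 \<partial>M) \<le> k"
    unfolding sq using I(5) n orthonormal_basis_facts(6)[OF b j, of n] by (simp add: divide_le_eq)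
qed

text \<open>Only an almost sure identity: stochastic integrals are determined up to null sets.\<close>

lemma theta_hat_decomposition:
  assumes nm: "noise_model n Q M \<xi> k" and b: "orthonormal_basis \<phi>" and j: "1 \<le> j" and n: "1 \<le> n"
    and S: "S \<in> signals"
  shows "theta_hat n M \<phi> (observation S \<xi>) j \<in> borel_measurable M"
    "AE \<omega> in M. theta_hat n M \<phi> (observation S \<xi>) j \<omega> =
      L2_inner S (\<phi> j) + 1 / sqrt (real n) * xi_coef n M \<phi> \<xi> j \<omega>"
proof -
  interpret prob_space M by (rule noise_model_facts[OF nm])
  have Sp: "periodic1 S" "S \<in> borel_measurable borel" "L2_fun 0 1 S" using S by (simp_all add: signals_def)
  note \<phi> = orthonormal_basis_facts[OF b j]
  have one: "L2_fun 0 1 (\<lambda>t. 1::real)"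
    by (simp add: L2_fun_def set_borel_measurable_def set_integrable_def)
  have "set_integrable lborel {0..1} S" using set_integrable_mult_L2[OF Sp(3) one] by simp
  then have Si: "set_integrable lborel {0..real n} S"
    using periodic1_set_integral[OF Sp(1), of n] by blast
  have "periodic1 (\<lambda>s. \<phi> j s * S s)" using Sp \<phi> by (simp add: periodic1_def)
  from periodic1_set_integral[OF this set_integrable_mult_L2[OF \<phi>(3) Sp(3)], of n]
  have drift: "(LINT s:{0..real n}|lborel. \<phi> j s * S s) = real n * L2_inner S (\<phi> j)"
    by (simp add: L2_inner_def mult.commute)
  have "cadlag_on {0..real n} (\<phi> j) \<and> L2_fun 0 (real n) (\<phi> j)"
    using \<phi>(1,5) cadlag_on_subset by blast
  with nm obtain I where I0: "is_stoch_integral M (real n) \<xi> (\<phi> j) I"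
    unfolding noise_model_def by blast
  note I = is_stoch_integral_stoch_integral[OF I0]
  have \<phi>m: "set_borel_measurable lborel {0..real n} (\<phi> j)"
    using \<phi>(5)[of n] by (simp add: L2_fun_def)
  have y: "is_stoch_integral M (real n) (observation S \<xi>) (\<phi> j)
      (\<lambda>\<omega>. (LINT s:{0..real n}|lborel. \<phi> j s * S s) + stoch_integral M (real n) \<xi> (\<phi> j) \<omega>)"
    by (rule is_stoch_integral_observation[OF prob_space_axioms noise_model_facts(2)[OF nm] \<phi>(1) \<phi>m Si _ I]) simp_all
  note y' = is_stoch_integral_stoch_integral[OF y]
  show "theta_hat n M \<phi> (observation S \<xi>) j \<in> borel_measurable M"
  proof -
    have "stoch_integral M (real n) (observation S \<xi>) (\<phi> j) \<in> borel_measurable M"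
      using y' unfolding is_stoch_integral_def by blast
    then show ?thesis unfolding theta_hat_def by simp
  qed
  have ym: "observation S \<xi> t \<in> borel_measurable M" if "t \<in> {0..real n}" for t
    unfolding observation_def using noise_model_facts(2)[OF nm that] by simp
  have "AE \<omega> in M. stoch_integral M (real n) (observation S \<xi>) (\<phi> j) \<omega> =
      (LINT s:{0..real n}|lborel. \<phi> j s * S s) + stoch_integral M (real n) \<xi> (\<phi> j) \<omega>"
    by (rule is_stoch_integral_unique[OF prob_space_axioms ym _ y' y]) simp_all
  then show "AE \<omega> in M. theta_hat n M \<phi> (observation S \<xi>) j \<omega> =
      L2_inner S (\<phi> j) + 1 / sqrt (real n) * xi_coef n M \<phi> \<xi> j \<omega>"
  proof eventually_elim
    case (elim \<omega>)
    have "theta_hat n M \<phi> (observation S \<xi>) j \<omega> =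
        L2_inner S (\<phi> j) + stoch_integral M (real n) \<xi> (\<phi> j) \<omega> / real n"
      unfolding theta_hat_def elim drift using n by (simp add: add_divide_distrib)
    moreover have "1 / sqrt (real n) * xi_coef n M \<phi> \<xi> j \<omega> = stoch_integral M (real n) \<xi> (\<phi> j) \<omega> / real n"
      using n by (simp add: xi_coef_def)
    ultimately show ?case by simp
  qed
qed

section \<open>Comparison of the risks\<close>

text \<open>Shrinking moves the vector by at most \<open>|c|\<close>, so square integrability is preserved.\<close>

lemma abs_shrink_le:
  "\<bar>shrink c d a j\<bar> \<le> \<bar>a j\<bar> + \<bar>c\<bar>"
proof (cases "1 \<le> j \<and> j \<le> d")
  case True
  have "\<bar>shrink_factor c d a j * a j\<bar> \<le> \<bar>c\<bar>"
  proof (cases "eucl_norm d a = 0")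
    case False
    have "(a j)\<^sup>2 \<le> (\<Sum>j=1..d. (a j)\<^sup>2)" by (rule member_le_sum) (use True in auto)
    then have "sqrt ((a j)\<^sup>2) \<le> eucl_norm d a" unfolding eucl_norm_def by (rule real_sqrt_le_mono)
    then have le: "\<bar>a j\<bar> \<le> eucl_norm d a" by simp
    then have pos: "0 < eucl_norm d a" using False by linarith
    have "\<bar>shrink_factor c d a j * a j\<bar> = \<bar>c\<bar> * (\<bar>a j\<bar> / eucl_norm d a)"
      using True pos by (simp add: shrink_factor_def abs_mult)
    also have "\<dots> \<le> \<bar>c\<bar> * 1" using le pos by (intro mult_left_mono) simp_all
    finally show ?thesis by simp
  qed (simp add: shrink_factor_def)
  moreover have "shrink c d a j = a j - shrink_factor c d a j * a j"
    by (simp add: shrink_def left_diff_distrib)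
  ultimately show ?thesis by linarith
next
  case False
  have "shrink_factor c d a j = 0" unfolding shrink_factor_def if_not_P[OF False] ..
  then show ?thesis by (simp add: shrink_def)
qed

text \<open>The loss, up to the constant \<open>\<parallel>S\<parallel>\<^sup>2\<close>, is \<open>\<Sum> (x\<^sub>j\<^sup>2 - 2 x\<^sub>j \<theta>\<^sub>j)\<close>. Equality holds unless
  the first \<open>d\<close> coefficients vanish together; then shrinking has no effect and the term \<open>c\<^sup>2\<close> is
  absent.\<close>

lemma shrink_loss_difference:
  assumes d: "d \<le> n" and \<gamma>: "\<And>j. j \<in> {1..d} \<Longrightarrow> \<gamma> j = 1"
  shows "(\<Sum>j=1..n. (\<gamma> j * shrink c d a j)\<^sup>2 - 2 * (\<gamma> j * shrink c d a j) * \<theta> j)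
      - (\<Sum>j=1..n. (\<gamma> j * a j)\<^sup>2 - 2 * (\<gamma> j * a j) * \<theta> j)
    \<le> c\<^sup>2 - 2 * c * ((\<Sum>j=1..d. (a j - \<theta> j) * a j) / eucl_norm d a)"
proof -
  \<comment> \<open>If the norm is 0, then \<open>q = 0\<close> and also all \<open>a j\<close> vanish.\<close>
  define q where "q = c / eucl_norm d a"
  let ?D = "\<lambda>j. ((\<gamma> j * shrink c d a j)\<^sup>2 - 2 * (\<gamma> j * shrink c d a j) * \<theta> j) - ((\<gamma> j * a j)\<^sup>2 - 2 * (\<gamma> j * a j) * \<theta> j)"
  have "(\<Sum>j=1..n. (\<gamma> j * shrink c d a j)\<^sup>2 - 2 * (\<gamma> j * shrink c d a j) * \<theta> j)
      - (\<Sum>j=1..n. (\<gamma> j * a j)\<^sup>2 - 2 * (\<gamma> j * a j) * \<theta> j) = (\<Sum>j=1..n. ?D j)"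
    by (rule sum_subtractf[symmetric])
  also have "\<dots> = (\<Sum>j=1..d. ?D j)"
    using d by (intro sum.mono_neutral_right) (auto simp: shrink_def shrink_factor_def)
  also have "\<dots> = (\<Sum>j=1..d. q\<^sup>2 * (a j)\<^sup>2 - 2 * q * ((a j - \<theta> j) * a j))"
  proof (rule sum.cong[OF refl])
    fix j assume j: "j \<in> {1..d}"
    then have sh: "shrink c d a j = a j - q * a j"
      by (simp add: shrink_def shrink_factor_def q_def left_diff_distrib)
    show "?D j = q\<^sup>2 * (a j)\<^sup>2 - 2 * q * ((a j - \<theta> j) * a j)"
      unfolding sh \<gamma>[OF j] by (simp add: power2_eq_square algebra_simps)
  qed
  also have "\<dots> = q\<^sup>2 * (\<Sum>j=1..d. (a j)\<^sup>2) - 2 * q * (\<Sum>j=1..d. (a j - \<theta> j) * a j)"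
    by (simp only: sum_subtractf sum_distrib_left)
  also have "\<dots> \<le> c\<^sup>2 - 2 * c * ((\<Sum>j=1..d. (a j - \<theta> j) * a j) / eucl_norm d a)"
  proof -
    have sq: "(eucl_norm d a)\<^sup>2 = (\<Sum>j=1..d. (a j)\<^sup>2)"
      unfolding eucl_norm_def by (intro real_sqrt_pow2 sum_nonneg) simp
    have "q\<^sup>2 * (\<Sum>j=1..d. (a j)\<^sup>2) \<le> c\<^sup>2"
      unfolding sq[symmetric] by (cases "eucl_norm d a = 0") (simp_all add: q_def power_divide)
    then show ?thesis by (simp add: q_def)
  qed
  finally show ?thesis .
qed

text \<open>The losses are expanded in the coefficients and compared pointwise; afterwards the observed
  coefficients are replaced by \<open>\<theta> + X / sqrt n\<close>, to which they are almost surely equal.\<close>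

lemma risk_difference_bound:
  fixes M :: "'w measure"
  assumes nm: "noise_model n Q M \<xi> k" and b: "orthonormal_basis \<phi>" and n: "1 \<le> n"
    and S: "S \<in> signals" and d: "d \<le> n" and \<gamma>: "\<And>j. j \<in> {1..d} \<Longrightarrow> \<gamma> j = 1"
  defines "u \<equiv> \<lambda>\<omega> j. L2_inner S (\<phi> j) + 1 / sqrt (real n) * xi_coef n M \<phi> \<xi> j \<omega>"
  shows "risk_difference n M \<xi> \<phi> \<gamma> c d S \<le>
    c\<^sup>2 - 2 * c * (\<integral>\<omega>. (\<Sum>j=1..d. (u \<omega> j - L2_inner S (\<phi> j)) * u \<omega> j) / eucl_norm d (u \<omega>) \<partial>M)"
proof -
  interpret prob_space M by (rule noise_model_facts[OF nm])
  have S2: "L2_fun 0 1 S" using S by (simp add: signals_def)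
  define \<theta> where "\<theta> j = L2_inner S (\<phi> j)" for j
  define a where "a \<omega> j = theta_hat n M \<phi> (observation S \<xi>) j \<omega>" for \<omega> j
  define V where "V x = (\<Sum>j=1..n. (\<gamma> j * x j)\<^sup>2 - 2 * (\<gamma> j * x j) * \<theta> j)" for x
  define H where "H x = (\<Sum>j=1..d. (x j - \<theta> j) * x j) / eucl_norm d x" for x
  have am: "(\<lambda>\<omega>. a \<omega> j) \<in> borel_measurable M" if "j \<in> {1..n}" for j
    using theta_hat_decomposition(1)[OF nm b _ n S, of j] that by (simp add: a_def)
  have um: "(\<lambda>\<omega>. u \<omega> j) \<in> borel_measurable M" if "j \<in> {1..n}" for j
    unfolding u_def using noise_coefficients(1)[OF nm b _ n, of j] that by simp
  have au: "AE \<omega> in M. a \<omega> j = u \<omega> j" if "j \<in> {1..n}" for j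
    using theta_hat_decomposition(2)[OF nm b _ n S, of j] that by (simp add: a_def u_def)
  have u2: "integrable M (\<lambda>\<omega>. (u \<omega> j)\<^sup>2)" if "j \<in> {1..n}" for j
    unfolding u_def using noise_coefficients(1,3)[OF nm b _ n, of j] that
    by (intro integrable_power2_add(1)) (simp_all add: power_mult_distrib power_divide)
  have a2: "integrable M (\<lambda>\<omega>. (a \<omega> j)\<^sup>2)" if j: "j \<in> {1..n}" for j
  proof -
    have "AE \<omega> in M. (a \<omega> j)\<^sup>2 = (u \<omega> j)\<^sup>2" using au[OF j] by eventually_elim simp
    then show ?thesis
      using integrable_cong_AE[of "\<lambda>\<omega>. (a \<omega> j)\<^sup>2" M "\<lambda>\<omega>. (u \<omega> j)\<^sup>2"] am[OF j] um[OF j] u2[OF j] by simp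
  qed
  have norm_m: "(\<lambda>\<omega>. eucl_norm d (a \<omega>)) \<in> borel_measurable M"
  proof -
    have "(\<lambda>\<omega>. \<Sum>j=1..d. (a \<omega> j)\<^sup>2) \<in> borel_measurable M"
      using d by (intro borel_measurable_sum borel_measurable_power am) auto
    then show ?thesis unfolding eucl_norm_def by measurable
  qed
  have sm: "(\<lambda>\<omega>. shrink c d (a \<omega>) j) \<in> borel_measurable M" if "j \<in> {1..n}" for j
  proof -
    have [measurable]: "(\<lambda>\<omega>. a \<omega> j) \<in> borel_measurable M" by (rule am[OF that])
    note [measurable] = norm_m
    show ?thesis unfolding shrink_def shrink_factor_def by measurable
  qed
  have s2: "integrable M (\<lambda>\<omega>. (shrink c d (a \<omega>) j)\<^sup>2)" if j: "j \<in> {1..n}" for j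
  proof (rule Bochner_Integration.integrable_bound)
    show "integrable M (\<lambda>\<omega>. 2 * (a \<omega> j)\<^sup>2 + 2 * c\<^sup>2)" using a2[OF j] by simp
    show "(\<lambda>\<omega>. (shrink c d (a \<omega>) j)\<^sup>2) \<in> borel_measurable M" using sm[OF j] by simp
    show "AE \<omega> in M. norm ((shrink c d (a \<omega>) j)\<^sup>2) \<le> norm (2 * (a \<omega> j)\<^sup>2 + 2 * c\<^sup>2)"
    proof (rule AE_I2)
      fix \<omega>
      have "\<bar>shrink c d (a \<omega>) j\<bar>\<^sup>2 \<le> (\<bar>a \<omega> j\<bar> + \<bar>c\<bar>)\<^sup>2"
        by (rule power_mono[OF abs_shrink_le]) simp
      also have "\<dots> \<le> 2 * (a \<omega> j)\<^sup>2 + 2 * c\<^sup>2"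
      proof -
        have "0 \<le> (\<bar>a \<omega> j\<bar> - \<bar>c\<bar>)\<^sup>2" by simp
        then show ?thesis unfolding power2_sum power2_diff by simp
      qed
      finally show "norm ((shrink c d (a \<omega>) j)\<^sup>2) \<le> norm (2 * (a \<omega> j)\<^sup>2 + 2 * c\<^sup>2)" by simp
    qed
  qed
  have V_int: "integrable M (\<lambda>\<omega>. V (x \<omega>))"
    if x: "\<And>j. j \<in> {1..n} \<Longrightarrow> (\<lambda>\<omega>. x \<omega> j) \<in> borel_measurable M"
      "\<And>j. j \<in> {1..n} \<Longrightarrow> integrable M (\<lambda>\<omega>. (x \<omega> j)\<^sup>2)" for x
    unfolding V_def
  proof (rule Bochner_Integration.integrable_sum)
    fix j assume j: "j \<in> {1..n}"
    have "integrable M (\<lambda>\<omega>. x \<omega> j)" by (rule square_integrable_imp_integrable[OF x[OF j]])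
    then show "integrable M (\<lambda>\<omega>. (\<gamma> j * x \<omega> j)\<^sup>2 - 2 * (\<gamma> j * x \<omega> j) * \<theta> j)"
      using x(2)[OF j] by (simp add: power_mult_distrib)
  qed
  have risk: "risk M (\<lambda>\<omega>. weighted_series n \<gamma> \<phi> (x \<omega>)) S = (\<integral>\<omega>. V (x \<omega>) + (L2_norm S)\<^sup>2 \<partial>M)" for x
    unfolding risk_def weighted_series_def V_def \<theta>_def
    by (intro Bochner_Integration.integral_cong refl L2_norm_expansion[OF b S2])
  have Va: "integrable M (\<lambda>\<omega>. V (a \<omega>))" by (rule V_int[OF am a2])
  have Vs: "integrable M (\<lambda>\<omega>. V (shrink c d (a \<omega>)))" by (rule V_int[OF sm s2])
  have a_fun: "a \<omega> = (\<lambda>j. theta_hat n M \<phi> (observation S \<xi>) j \<omega>)" for \<omega>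
    by (simp add: a_def fun_eq_iff)
  have star: "S_star n M \<phi> \<gamma> c d (observation S \<xi>) = (\<lambda>\<omega>. weighted_series n \<gamma> \<phi> (shrink c d (a \<omega>)))"
    by (intro ext) (simp only: S_star_def a_fun)
  have hat: "S_hat n M \<phi> \<gamma> (observation S \<xi>) = (\<lambda>\<omega>. weighted_series n \<gamma> \<phi> (a \<omega>))"
    by (intro ext) (simp only: S_hat_def a_fun)
  have "risk_difference n M \<xi> \<phi> \<gamma> c d S =
      (\<integral>\<omega>. V (shrink c d (a \<omega>)) + (L2_norm S)\<^sup>2 \<partial>M) - (\<integral>\<omega>. V (a \<omega>) + (L2_norm S)\<^sup>2 \<partial>M)"
    unfolding risk_difference_def star hat risk ..
  also have "\<dots> = (\<integral>\<omega>. V (shrink c d (a \<omega>)) - V (a \<omega>) \<partial>M)"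
    using Va Vs by simp
  finally have diff: "risk_difference n M \<xi> \<phi> \<gamma> c d S = (\<integral>\<omega>. V (shrink c d (a \<omega>)) - V (a \<omega>) \<partial>M)" .
  have Ha_m: "(\<lambda>\<omega>. H (a \<omega>)) \<in> borel_measurable M"
  proof -
    have [measurable]: "(\<lambda>\<omega>. \<Sum>j=1..d. (a \<omega> j - \<theta> j) * a \<omega> j) \<in> borel_measurable M"
      using d by (intro borel_measurable_sum borel_measurable_times borel_measurable_diff borel_measurable_const am) auto
    note [measurable] = norm_m
    show ?thesis unfolding H_def by measurable
  qed
  have Ha: "integrable M (\<lambda>\<omega>. H (a \<omega>))"
  proof (rule Bochner_Integration.integrable_bound[OF _ Ha_m])
    show "integrable M (\<lambda>\<omega>. \<Sum>j=1..d. \<bar>a \<omega> j - \<theta> j\<bar>)"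
    proof (rule Bochner_Integration.integrable_sum)
      fix j assume "j \<in> {1..d}"
      then have j: "j \<in> {1..n}" using d by simp
      have "integrable M (\<lambda>\<omega>. a \<omega> j)" by (rule square_integrable_imp_integrable[OF am[OF j] a2[OF j]])
      then show "integrable M (\<lambda>\<omega>. \<bar>a \<omega> j - \<theta> j\<bar>)" by simp
    qed
    show "AE \<omega> in M. norm (H (a \<omega>)) \<le> norm (\<Sum>j=1..d. \<bar>a \<omega> j - \<theta> j\<bar>)"
    proof (rule AE_I2)
      fix \<omega>
      have "\<bar>H (a \<omega>)\<bar> \<le> (\<Sum>j=1..d. \<bar>a \<omega> j - \<theta> j\<bar>)"
        using inner_over_norm_bound[where e=0 and d=d and u="a \<omega>" and \<theta>=\<theta>] by (simp add: H_def eucl_norm_def)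
      then show "norm (H (a \<omega>)) \<le> norm (\<Sum>j=1..d. \<bar>a \<omega> j - \<theta> j\<bar>)" by simp
    qed
  qed
  have "(\<integral>\<omega>. V (shrink c d (a \<omega>)) - V (a \<omega>) \<partial>M) \<le> (\<integral>\<omega>. c\<^sup>2 - 2 * c * H (a \<omega>) \<partial>M)"
  proof (rule integral_mono)
    show "integrable M (\<lambda>\<omega>. V (shrink c d (a \<omega>)) - V (a \<omega>))" using Va Vs by simp
    show "integrable M (\<lambda>\<omega>. c\<^sup>2 - 2 * c * H (a \<omega>))" using Ha by simp
    show "V (shrink c d (a \<omega>)) - V (a \<omega>) \<le> c\<^sup>2 - 2 * c * H (a \<omega>)" for \<omega>
      unfolding V_def H_def by (rule shrink_loss_difference[OF d \<gamma>])
  qed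
  also have "\<dots> = c\<^sup>2 - 2 * c * (\<integral>\<omega>. H (a \<omega>) \<partial>M)"
    using Ha by (simp add: prob_space)
  finally have le: "risk_difference n M \<xi> \<phi> \<gamma> c d S \<le> c\<^sup>2 - 2 * c * (\<integral>\<omega>. H (a \<omega>) \<partial>M)"
    by (simp only: diff)
  have Hau: "AE \<omega> in M. H (a \<omega>) = H (u \<omega>)"
  proof -
    have "AE \<omega> in M. \<forall>j\<in>{1..d}. a \<omega> j = u \<omega> j"
      using au d by (intro AE_finite_allI) auto
    then show ?thesis
    proof eventually_elim
      case (elim \<omega>)
      have "(\<Sum>j=1..d. (a \<omega> j - \<theta> j) * a \<omega> j) = (\<Sum>j=1..d. (u \<omega> j - \<theta> j) * u \<omega> j)"
        by (rule sum.cong[OF refl]) (use elim in simp)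
      moreover have "(\<Sum>j=1..d. (a \<omega> j)\<^sup>2) = (\<Sum>j=1..d. (u \<omega> j)\<^sup>2)"
        by (rule sum.cong[OF refl]) (use elim in simp)
      ultimately show ?case by (simp only: H_def eucl_norm_def)
    qed
  qed
  have Hu_m: "(\<lambda>\<omega>. H (u \<omega>)) \<in> borel_measurable M"
  proof -
    have [measurable]: "(\<lambda>\<omega>. \<Sum>j=1..d. (u \<omega> j - \<theta> j) * u \<omega> j) \<in> borel_measurable M"
      using d by (intro borel_measurable_sum borel_measurable_times borel_measurable_diff borel_measurable_const um) auto
    have [measurable]: "(\<lambda>\<omega>. \<Sum>j=1..d. (u \<omega> j)\<^sup>2) \<in> borel_measurable M"
      using d by (intro borel_measurable_sum borel_measurable_power um) auto
    show ?thesis unfolding H_def eucl_norm_def by measurable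
  qed
  have "(\<integral>\<omega>. H (a \<omega>) \<partial>M) = (\<integral>\<omega>. H (u \<omega>) \<partial>M)"
    by (rule integral_cong_AE[OF Ha_m Hu_m Hau])
  with le show ?thesis unfolding H_def \<theta>_def by simp
qed

text \<open>The noise coefficient is centred, so the mixed term disappears. This is why \<open>m\<close> is the
  square root of a sum and not a sum of square roots.\<close>

lemma observed_second_moment:
  assumes nm: "noise_model n Q M \<xi> k" and b: "orthonormal_basis \<phi>" and n: "1 \<le> n" and j: "1 \<le> j"
  shows "(\<integral>\<omega>. (t + 1 / sqrt (real n) * xi_coef n M \<phi> \<xi> j \<omega>)\<^sup>2 \<partial>M) \<le> t\<^sup>2 + k / real n"
proof -
  interpret prob_space M by (rule noise_model_facts[OF nm])
  let ?X = "xi_coef n M \<phi> \<xi> j"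
  note X = noise_coefficients[OF nm b j n]
  have "(\<lambda>\<omega>. (t + 1 / sqrt (real n) * ?X \<omega>)\<^sup>2) = (\<lambda>\<omega>. t\<^sup>2 + (2 * t / sqrt (real n)) * ?X \<omega> + (?X \<omega>)\<^sup>2 / real n)"
    by (simp add: power2_sum power_divide fun_eq_iff)
  then have "(\<integral>\<omega>. (t + 1 / sqrt (real n) * ?X \<omega>)\<^sup>2 \<partial>M) = t\<^sup>2 + (2 * t / sqrt (real n)) * (\<integral>\<omega>. ?X \<omega> \<partial>M) + (\<integral>\<omega>. (?X \<omega>)\<^sup>2 \<partial>M) / real n"
    using X(2,3) by (simp add: prob_space)
  also have "\<dots> \<le> t\<^sup>2 + k / real n"
    using X(4,5) n by (simp add: divide_right_mono)
  finally show ?thesis .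
qed

theorem theorem3p1:
  fixes QQ :: "nat \<Rightarrow> (real \<Rightarrow> real) measure set"
    and M :: "nat \<Rightarrow> (real \<Rightarrow> real) measure \<Rightarrow> 'w measure"
    and \<xi> :: "nat \<Rightarrow> (real \<Rightarrow> real) measure \<Rightarrow> real \<Rightarrow> 'w \<Rightarrow> real"
    and \<kappa> :: "nat \<Rightarrow> (real \<Rightarrow> real) measure \<Rightarrow> real"
    and \<phi> :: "nat \<Rightarrow> real \<Rightarrow> real"
    and \<Gamma> :: "nat \<Rightarrow> (nat \<Rightarrow> real) set"
    and dfun :: "nat \<Rightarrow> (nat \<Rightarrow> real) \<Rightarrow> nat"
    and d n0 :: nat
    and l r \<kappa>s c :: "nat \<Rightarrow> real"
  assumes noise: "\<And>n Q. 1 \<le> n \<Longrightarrow> Q \<in> QQ n \<Longrightarrow> noise_model n Q (M n Q) (\<xi> n Q) (\<kappa> n Q)"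
    and kappa_bounded: "\<And>n. 1 \<le> n \<Longrightarrow> bdd_above (\<kappa> n ` QQ n)"
    and kappa_star: "\<And>n. \<kappa>s n = (SUP Q\<in>QQ n. \<kappa> n Q)"
    and basis: "orthonormal_basis \<phi>"
    and weights: "weight_family \<Gamma>"
    and radius: "radius_sequence r"
    and D1: "cond_D1 \<Gamma> dfun"
    and D2: "cond_D2 QQ M \<xi> \<phi> d l n0"
    and c_def: "\<And>n. c n = shrink_const n d (l n) (r n) (\<kappa>s n)"
  shows "\<forall>n\<ge>n0. \<forall>\<gamma>\<in>\<Gamma> n. dfun n \<gamma> = d \<longrightarrow>
    (SUP Q\<in>QQ n. SUP S\<in>{S \<in> signals. L2_norm S \<le> r n}.
       ereal (risk_difference n (M n Q) (\<xi> n Q) \<phi> \<gamma> (c n) d S)) < ereal (- (c n)\<^sup>2)"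
proof (intro allI ballI impI)
  fix n \<gamma> assume n0: "n0 \<le> n" and \<gamma>: "\<gamma> \<in> \<Gamma> n" and dfun: "dfun n \<gamma> = d"
  have n: "1 \<le> n" using D2 n0 by (auto simp: cond_D2_def)
  have lpos: "0 < l n" using D2 n0 by (simp add: cond_D2_def)
  have rpos: "0 < r n" using radius n by (simp add: radius_sequence_def)
  have d: "1 \<le> d" "d \<le> n" "\<And>j. j \<in> {1..d} \<Longrightarrow> \<gamma> j = 1"
    using D1 n \<gamma> dfun by (auto simp: cond_D1_def)
  show "(SUP Q\<in>QQ n. SUP S\<in>{S \<in> signals. L2_norm S \<le> r n}.
       ereal (risk_difference n (M n Q) (\<xi> n Q) \<phi> \<gamma> (c n) d S)) < ereal (- (c n)\<^sup>2)"
  proof (cases "QQ n = {}")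
    \<comment> \<open>The supremum over the empty set is \<open>- \<infinity>\<close>.\<close>
    case True
    then show ?thesis by (simp add: bot_ereal_def)
  next
    case False
    have k_le: "\<kappa> n Q \<le> \<kappa>s n" if "Q \<in> QQ n" for Q
      unfolding kappa_star by (rule cSUP_upper[OF that kappa_bounded[OF n]])
    obtain Q0 where Q0: "Q0 \<in> QQ n" using False by blast
    have kpos: "0 < \<kappa>s n"
      using noise_model_facts(3)[OF noise[OF n Q0]] k_le[OF Q0] by linarith
    \<comment> \<open>Up to \<open>r\<^sup>2\<close>, the bound for the second moment of the first \<open>d\<close> observed coefficients.\<close>
    define q where "q = real d * \<kappa>s n / real n"
    have q: "0 < q" using kpos d n by (simp add: q_def)
    define m where "m = sqrt ((r n)\<^sup>2 + q)"
    have m2: "m\<^sup>2 = (r n)\<^sup>2 + q" using q by (simp add: m_def)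
    have mpos: "0 < m" using q by (simp add: m_def add_nonneg_pos)
    have m_less: "m < r n + sqrt q"
    proof (rule power2_less_imp_less)
      show "m\<^sup>2 < (r n + sqrt q)\<^sup>2" unfolding m2 power2_sum using rpos q by simp
      show "0 \<le> r n + sqrt q" using rpos q by simp
    qed
    have c: "c n = l n / ((r n + sqrt q) * real n)"
      by (simp add: c_def shrink_const_def q_def)
    have cpos: "0 < c n" unfolding c using lpos rpos q n by (intro divide_pos_pos mult_pos_pos add_pos_pos) simp_all
    \<comment> \<open>The lower bound for the correlation; strictness of the theorem comes from \<open>m < r n + sqrt q\<close>.\<close>
    define h where "h = 1 / real n * l n / m"
    have c_less: "c n < h"
    proof -
      have "c n = (l n / real n) / (r n + sqrt q)" by (simp add: c mult.commute)
      also have "\<dots> < (l n / real n) / m"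
        using lpos n mpos m_less by (intro divide_strict_left_mono mult_pos_pos) simp_all
      finally show ?thesis by (simp add: h_def)
    qed
    have bound: "risk_difference n (M n Q) (\<xi> n Q) \<phi> \<gamma> (c n) d S \<le> (c n)\<^sup>2 - 2 * c n * h"
      if Q: "Q \<in> QQ n" and S: "S \<in> signals" "L2_norm S \<le> r n" for Q S
    proof -
      note nm = noise[OF n Q]
      let ?X = "xi_coef n (M n Q) \<phi> (\<xi> n Q)"
      let ?u = "\<lambda>\<omega> j. L2_inner S (\<phi> j) + 1 / sqrt (real n) * ?X j \<omega>"
      from D2 n0 Q obtain G where G: "subalgebra (M n Q) G"
        and gauss: "cond_gaussian (M n Q) G {1..d} ?X (\<lambda>\<omega> i. 0) (cond_cov (M n Q) G ?X)"
        and gap: "AE \<omega> in M n Q. l n \<le> (\<Sum>i=1..d. cond_cov (M n Q) G ?X \<omega> i i) - lambda_max d (cond_cov (M n Q) G ?X \<omega>)"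
        unfolding cond_D2_def Let_def by blast
      have L2: "L2_fun 0 1 S" using S(1) by (simp add: signals_def)
      have second: "(\<Sum>j=1..d. \<integral>\<omega>. (?u \<omega> j)\<^sup>2 \<partial>M n Q) \<le> m\<^sup>2"
      proof -
        have "(\<Sum>j=1..d. \<integral>\<omega>. (?u \<omega> j)\<^sup>2 \<partial>M n Q) \<le> (\<Sum>j=1..d. (L2_inner S (\<phi> j))\<^sup>2 + \<kappa> n Q / real n)"
          by (intro sum_mono observed_second_moment[OF nm basis n]) simp
        also have "\<dots> = (\<Sum>j=1..d. (L2_inner S (\<phi> j))\<^sup>2) + real d * \<kappa> n Q / real n"
          by (simp add: sum.distrib)
        also have "\<dots> \<le> (r n)\<^sup>2 + q"
        proof (rule add_mono)
          have "0 \<le> L2_norm S"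
            unfolding L2_norm_def set_lebesgue_integral_def by (intro real_sqrt_ge_zero integral_nonneg_AE AE_I2) simp
          then have "(L2_norm S)\<^sup>2 \<le> (r n)\<^sup>2" using S(2) by (intro power_mono)
          then show "(\<Sum>j=1..d. (L2_inner S (\<phi> j))\<^sup>2) \<le> (r n)\<^sup>2"
            using bessel_inequality[OF basis L2, of d] by linarith
          show "real d * \<kappa> n Q / real n \<le> q"
            unfolding q_def using k_le[OF Q] by (intro divide_right_mono mult_left_mono) simp_all
        qed
        finally show ?thesis by (simp only: m2)
      qed
      have "(1 / sqrt (real n))\<^sup>2 * l n / m \<le>
          (\<integral>\<omega>. (\<Sum>j=1..d. (?u \<omega> j - L2_inner S (\<phi> j)) * ?u \<omega> j) / eucl_norm d (?u \<omega>) \<partial>M n Q)"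
        by (rule stein_correlation_bound[OF noise_model_facts(1)[OF nm] G _ _ gauss gap d(1) lpos mpos second])
          (simp_all add: noise_coefficients[OF nm basis _ n])
      then have "h \<le> (\<integral>\<omega>. (\<Sum>j=1..d. (?u \<omega> j - L2_inner S (\<phi> j)) * ?u \<omega> j) / eucl_norm d (?u \<omega>) \<partial>M n Q)"
        using n by (simp add: h_def power_divide)
      then have "2 * c n * h \<le> 2 * c n * (\<integral>\<omega>. (\<Sum>j=1..d. (?u \<omega> j - L2_inner S (\<phi> j)) * ?u \<omega> j) / eucl_norm d (?u \<omega>) \<partial>M n Q)"
        using cpos by (intro mult_left_mono) simp_all
      then show ?thesis
        using risk_difference_bound[OF nm basis n S(1) d(2), of \<gamma> "c n"] d(3) by fastforce
    qed
    have "(SUP Q\<in>QQ n. SUP S\<in>{S \<in> signals. L2_norm S \<le> r n}.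
        ereal (risk_difference n (M n Q) (\<xi> n Q) \<phi> \<gamma> (c n) d S)) \<le> ereal ((c n)\<^sup>2 - 2 * c n * h)"
      by (intro SUP_least) (simp add: bound)
    also have "ereal ((c n)\<^sup>2 - 2 * c n * h) < ereal (- (c n)\<^sup>2)"
    proof -
      have "c n * c n < c n * h" using c_less cpos by (intro mult_strict_left_mono)
      then show ?thesis by (simp add: power2_eq_square)
    qed
    finally show ?thesis .
  qed
qed

end
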